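(* There is an absolute constant $\gamma>0$ such that the following holds. Let $p\in(1,\infty)$ and $\alpha>0$ satisfy $\alpha=1/2-1/p$ (so $p>2$), and let $\beta>1/2-1/p$. Let $\sigma_j=j^{-\alpha}(\log(j+1))^{-\beta}$ for $1\le j\le N$, with associated $p$-ellipsoid $\mathcal{E}_p\subset\mathbb{R}^N$. There are constants $c,c'>0$ depending only on $p,\alpha,\beta$ such that for all $1\le n<N$: (i) if $n\le c\,N(\log(N+1))^{-2\beta}$, then $\mathcal{R}_n(\mathcal{E}_p)\approx1$ with probability at least $1-3e^{-\gamma n}$; (ii) if $c\,N(\log(N+1))^{-2\beta}\le n\le c'N$, then $\mathcal{R}_n(\mathcal{E}_p)\approx n^{-1/2}N^{1/2}(\log(N+1))^{-\beta}$ with probability at least $1-3e^{-\gamma n}$; (iii) if $n\ge c'N$, then $\mathcal{R}_n(\mathcal{E}_p)\approx(\log(N+1))^{-\beta}$ with probability at least $1-3e^{-\gamma pn^{2/p}}$.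
   Context: $\mathcal{E}_p=\{x\in\mathbb{R}^N:\sum_{i=1}^N(|x_i|/\sigma_i)^p\le1\}$. The $n$-th random radius is $\mathcal{R}_n(\mathcal{E}_p)=\max_{y\in E_n\cap\mathcal{E}_p}|y|$, where $|\cdot|$ is the Euclidean norm and $E_n$ is a random $n$-codimensional linear subspace of $\mathbb{R}^N$ distributed according to the normalized Haar measure on the Grassmannian. $a\approx b$ means $C^{-1}b\le a\le Cb$ for a constant $C\ge1$ depending only on $p,\alpha,\beta$ (in particular independent of $n$ and $N$). The paper writes the ranges of $n$ with $\lesssim,\gtrsim$; they are expressed here through the constants $c,c'$. *)

theory Defs
  imports "HOL-Probability.Probability" "HOL-Library.Function_Algebras"
begin

text \<open>
  The dimension \<open>N\<close> is quantified inside the statement (the constants must not depend on it),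
  so \<open>\<real>\<^sup>N\<close> cannot be a type indexed by \<open>N\<close>. It is the space of functions \<open>nat \<Rightarrow> real\<close>
  supported on \<open>{1..N}\<close>; linear algebra is that of \<open>Vector_Spaces\<close>, interpreted on
  \<open>nat \<Rightarrow> real\<close>.
\<close>

definition fscale :: "real \<Rightarrow> (nat \<Rightarrow> real) \<Rightarrow> nat \<Rightarrow> real" where
  "fscale c x = (\<lambda>i. c * x i)"

interpretation fvs: vector_space fscale
  by unfold_locales (auto simp: fscale_def fun_eq_iff algebra_simps)

definition Rn :: "nat \<Rightarrow> (nat \<Rightarrow> real) set" where
  "Rn N = {x. \<forall>i. i \<notin> {1..N} \<longrightarrow> x i = 0}"

definition inner_N :: "nat \<Rightarrow> (nat \<Rightarrow> real) \<Rightarrow> (nat \<Rightarrow> real) \<Rightarrow> real" where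
  "inner_N N x y = (\<Sum>i=1..N. x i * y i)"

definition norm_N :: "nat \<Rightarrow> (nat \<Rightarrow> real) \<Rightarrow> real" where
  "norm_N N x = L2_set x {1..N}"

definition grassmannian :: "nat \<Rightarrow> nat \<Rightarrow> (nat \<Rightarrow> real) set set" where
  "grassmannian N n = {E. E \<subseteq> Rn N \<and> fvs.subspace E \<and> fvs.dim E + n = N}"

definition orth_proj :: "nat \<Rightarrow> (nat \<Rightarrow> real) set \<Rightarrow> (nat \<Rightarrow> real) \<Rightarrow> nat \<Rightarrow> real" where
  "orth_proj N E x = (THE y. y \<in> E \<and> (\<forall>z\<in>E. inner_N N (x - y) z = 0))"

definition proj_matrix :: "nat \<Rightarrow> (nat \<Rightarrow> real) set \<Rightarrow> nat \<times> nat \<Rightarrow> real" where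
  "proj_matrix N E = (\<lambda>(i, j). orth_proj N E (\<lambda>k. if k = j then 1 else 0) i)"

text \<open>
  The Grassmannian carries its usual topology, for which \<open>E \<mapsto> P\<^sub>E\<close> is an embedding into the
  matrices, and the corresponding Borel sigma-algebra. Only the entries of \<open>proj_matrix\<close> with
  indices in \<open>{1..N}\<close> depend on \<open>E\<close>; the others vanish.
\<close>

definition grassmannian_topology :: "nat \<Rightarrow> nat \<Rightarrow> (nat \<Rightarrow> real) set topology" where
  "grassmannian_topology N n = pullback_topology (grassmannian N n) (proj_matrix N) euclidean"

definition grassmannian_borel :: "nat \<Rightarrow> nat \<Rightarrow> (nat \<Rightarrow> real) set measure" where
  "grassmannian_borel N n =
     sigma (grassmannian N n) {U. openin (grassmannian_topology N n) U}"

definition orthogonal_mat :: "nat \<Rightarrow> (nat \<Rightarrow> nat \<Rightarrow> real) \<Rightarrow> bool" where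
  "orthogonal_mat N Q \<longleftrightarrow>
     (\<forall>i\<in>{1..N}. \<forall>j\<in>{1..N}. (\<Sum>k=1..N. Q k i * Q k j) = (if i = j then 1 else 0))"

definition mat_app :: "nat \<Rightarrow> (nat \<Rightarrow> nat \<Rightarrow> real) \<Rightarrow> (nat \<Rightarrow> real) \<Rightarrow> nat \<Rightarrow> real" where
  "mat_app N Q x = (\<lambda>i. if i \<in> {1..N} then \<Sum>j=1..N. Q i j * x j else 0)"

text \<open>
  The normalized Haar measure on the Grassmannian: the (unique) Borel probability measure that is
  invariant under the action \<open>E \<mapsto> Q E\<close> of the orthogonal group.
\<close>

definition is_haar_grassmannian :: "nat \<Rightarrow> nat \<Rightarrow> (nat \<Rightarrow> real) set measure \<Rightarrow> bool" where
  "is_haar_grassmannian N n M \<longleftrightarrow>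
     prob_space M \<and> sets M = sets (grassmannian_borel N n) \<and>
     (\<forall>Q. orthogonal_mat N Q \<longrightarrow> distr M M (\<lambda>E. mat_app N Q ` E) = M)"

definition ellipsoid :: "nat \<Rightarrow> real \<Rightarrow> (nat \<Rightarrow> real) \<Rightarrow> (nat \<Rightarrow> real) set" where
  "ellipsoid N p \<sigma> = {x \<in> Rn N. (\<Sum>i=1..N. (\<bar>x i\<bar> / \<sigma> i) powr p) \<le> 1}"

text \<open>The supremum is attained when \<open>E\<close> is a subspace and \<open>K\<close> is compact and contains \<open>0\<close>.\<close>

definition radius :: "nat \<Rightarrow> (nat \<Rightarrow> real) set \<Rightarrow> (nat \<Rightarrow> real) set \<Rightarrow> real" where
  "radius N K E = (SUP y\<in>E \<inter> K. norm_N N y)"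

definition log_semiaxes :: "real \<Rightarrow> real \<Rightarrow> nat \<Rightarrow> real" where
  "log_semiaxes \<alpha> \<beta> j = real j powr (- \<alpha>) * ln (real j + 1) powr (- \<beta>)"

definition approx_eq :: "real \<Rightarrow> real \<Rightarrow> real \<Rightarrow> bool" where
  "approx_eq C a b \<longleftrightarrow> b / C \<le> a \<and> a \<le> C * b"

end

theory Submission
  imports Defs "HOL-Real_Asymp.Real_Asymp"
begin

text \<open>
  Only the invariance of the Haar measure under reflections is used. For a quadratic functional that is
  invariant under the orthogonal group, the probability of its being nonnegative at \<open>(E, y)\<close> does not
  depend on \<open>y\<close>, so it may be averaged over a Gaussian vector; this reduces all probabilities to an
  exact Gaussian moment generating function for fixed \<open>E\<close>. With nets one obtains, for \<open>F = E\<^sup>\<bottom>\<close>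
  and outside exceptional sets of exponentially small measure, bounds for \<open>P\<^sub>F\<close> on coordinate subspaces.

  Upper bounds: for \<open>n\<close> large, \<open>y \<in> E\<close> is split into a head of length proportional to \<open>n\<close>, on which
  \<open>P\<^sub>F\<close> is bounded below by \<open>sqrt (n / N)\<close>, and dyadic blocks, on which it is bounded above by
  \<open>sqrt (b / N)\<close> with \<open>b\<close> the length of the block; since \<open>P\<^sub>F y = 0\<close>, the tail controls the head.
  For small \<open>n\<close> the whole ellipsoid is bounded.

  Lower bounds: as \<open>\<parallel>P\<^sub>F e\<^sub>1\<parallel>\<close> is of order \<open>sqrt (n / N)\<close>, a truncation argument gives \<open>y \<in> E\<close> whose
  distance to \<open>e\<^sub>1\<close> is at most \<open>C sqrt n / N\<close> in the sup norm. For \<open>n\<close> proportional to \<open>N\<close>, the normalised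
  \<open>P\<^sub>E e\<^sub>1\<close> has small \<open>\<ell>\<^sub>p\<close> norm away from the first coordinate, because no set of \<open>k\<close> of these coordinates
  can be uniformly large.

  The dimensions below a threshold depending on \<open>p\<close> and \<open>\<beta>\<close> are absorbed into the constant.
\<close>

section \<open>Orthonormal families and orthogonal projections\<close>

text \<open>The exponent \<open>\<alpha> = 1/2 - 1/p\<close> is critical: a block of
  \<open>b\<close> coordinates starting near index \<open>b\<close> has Euclidean radius of order at
  most \<open>LN powr (- \<beta>)\<close> in the ellipsoid as long as \<open>ln b\<close> is
  comparable to \<open>LN\<close>, and this bound does not decay with \<open>b\<close>. The upper
  bound works because the projected blocks grow like \<open>sqrt (b / N)\<close>, so that their sum
  is governed by the last block; division by \<open>sqrt (n / N)\<close> on the head then produces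
  the rate \<open>sqrt (N / n)\<close>. The hypothesis \<open>\<beta> > \<alpha>\<close> is the
  convergence of the sum of \<open>\<sigma> i powr (1 / \<alpha>)\<close>, which bounds the whole
  ellipsoid independently of \<open>N\<close>.

  The Haar measure is given only through its Borel sets and its invariance, so the measurability of
  every event, those about the radius included, has to come from the projection matrix. The value
  \<open>1 / 2000\<close> of \<open>c\<close> and \<open>c'\<close> is what the union bound over
  sparse coordinate sets can afford. As \<open>\<gamma>\<close> may be small, factors in front of
  exponentials are absorbed by giving up part of the rate; where the exponential is at least
  \<open>1/3\<close> the claim is empty.\<close>

text \<open>As simp rules these would also rewrite the operations unapplied, to their eta-expanded forms.\<close>

lemmas fun_apply = plus_fun_apply zero_fun_apply minus_apply uminus_apply

declare fun_apply [simp del]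

lemma sum_fun_apply: "(\<Sum>k\<in>A. f k) i = (\<Sum>k\<in>A. f k i)" for f :: "'b \<Rightarrow> 'a \<Rightarrow> real"
  by (induction A rule: infinite_finite_induct) (auto simp: fun_apply)

lemma Rn_subspace: "fvs.subspace (Rn N)"
  by (auto simp: fvs.subspace_def Rn_def fscale_def fun_apply)

lemma inner_N_commute: "inner_N N x y = inner_N N y x"
  by (simp add: inner_N_def mult.commute)

lemma inner_N_add_left: "inner_N N (x + y) z = inner_N N x z + inner_N N y z"
  by (simp add: inner_N_def sum.distrib algebra_simps fun_apply)

lemma inner_N_diff_left: "inner_N N (x - y) z = inner_N N x z - inner_N N y z"
  by (simp add: inner_N_def sum_subtractf algebra_simps fun_apply)

lemma inner_N_scale_left: "inner_N N (fscale c x) z = c * inner_N N x z"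
  by (simp add: inner_N_def fscale_def sum_distrib_left algebra_simps)

lemma inner_N_sum_left: "inner_N N (\<Sum>k\<in>A. f k) z = (\<Sum>k\<in>A. inner_N N (f k) z)"
proof (induction A rule: infinite_finite_induct)
  case (insert x F)
  then show ?case by (simp add: inner_N_add_left)
qed (simp_all add: inner_N_def fun_apply)

lemma inner_N_add_right: "inner_N N z (x + y) = inner_N N z x + inner_N N z y"
  by (simp add: inner_N_add_left inner_N_commute[of N z])

lemma inner_N_diff_right: "inner_N N z (x - y) = inner_N N z x - inner_N N z y"
  by (simp add: inner_N_diff_left inner_N_commute[of N z])

lemma inner_N_scale_right: "inner_N N z (fscale c x) = c * inner_N N z x"
  by (simp add: inner_N_scale_left inner_N_commute[of N z])

lemma inner_N_sum_right: "inner_N N z (\<Sum>k\<in>A. f k) = (\<Sum>k\<in>A. inner_N N z (f k))"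
  by (simp add: inner_N_sum_left inner_N_commute[of N z])

lemmas inner_N_simps = inner_N_add_left inner_N_diff_left inner_N_scale_left inner_N_sum_left
  inner_N_add_right inner_N_diff_right inner_N_scale_right inner_N_sum_right

lemma inner_N_zero [simp]: "inner_N N 0 x = 0" "inner_N N x 0 = 0"
  by (simp_all add: inner_N_def fun_apply)

lemma inner_N_nonneg: "0 \<le> inner_N N x x"
  by (simp add: inner_N_def sum_nonneg)

lemma inner_N_eq_zero_iff: "x \<in> Rn N \<Longrightarrow> inner_N N x x = 0 \<longleftrightarrow> x = 0"
  by (auto simp: inner_N_def sum_nonneg_eq_0_iff Rn_def fun_eq_iff fun_apply)

lemma norm_N_power2: "(norm_N N x)\<^sup>2 = inner_N N x x"
  unfolding norm_N_def L2_set_def inner_N_def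
  by (subst real_sqrt_pow2) (auto simp: sum_nonneg power2_eq_square)

lemma norm_N_nonneg [simp]: "0 \<le> norm_N N x"
  by (simp add: norm_N_def)

lemma norm_N_triangle: "norm_N N (x + y) \<le> norm_N N x + norm_N N y"
  unfolding norm_N_def using L2_set_triangle_ineq[of x y "{1..N}"] by (simp add: plus_fun_def)

lemma norm_N_scale: "norm_N N (fscale c x) = \<bar>c\<bar> * norm_N N x"
  unfolding norm_N_def fscale_def L2_set_def
  by (simp add: power_mult_distrib real_sqrt_mult sum_distrib_left[symmetric])

lemma norm_N_minus: "norm_N N (- x) = norm_N N x"
  unfolding norm_N_def L2_set_def by (simp add: fun_apply)

lemma norm_N_zero [simp]: "norm_N N 0 = 0"
  by (simp add: norm_N_def L2_set_def fun_apply)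

lemma norm_N_minus_commute: "norm_N N (x - y) = norm_N N (y - x)"
  using norm_N_minus[of N "x - y"] by simp

lemma norm_N_triangle_le: "norm_N N x \<le> norm_N N y + norm_N N (x - y)"
  using norm_N_triangle[of N y "x - y"] by simp

lemma norm_N_eq_zero_iff: "x \<in> Rn N \<Longrightarrow> norm_N N x = 0 \<longleftrightarrow> x = 0"
  using inner_N_eq_zero_iff[of x N] norm_N_power2[of N x] by (metis power_zero_numeral zero_eq_power2)

lemma abs_le_norm_N: "x \<in> Rn N \<Longrightarrow> \<bar>x i\<bar> \<le> norm_N N x"
  unfolding norm_N_def using member_le_L2_set[of "{1..N}" i "\<lambda>i. \<bar>x i\<bar>"]
  by (cases "i \<in> {1..N}") (auto simp: Rn_def L2_set_def sum_nonneg)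

definition orthonormal :: "nat \<Rightarrow> nat \<Rightarrow> (nat \<Rightarrow> nat \<Rightarrow> real) \<Rightarrow> bool" where
  "orthonormal N d e \<longleftrightarrow> (\<forall>k<d. e k \<in> Rn N) \<and>
     (\<forall>k<d. \<forall>l<d. inner_N N (e k) (e l) = (if k = l then 1 else 0))"

definition span_proj :: "nat \<Rightarrow> nat \<Rightarrow> (nat \<Rightarrow> nat \<Rightarrow> real) \<Rightarrow> (nat \<Rightarrow> real) \<Rightarrow> nat \<Rightarrow> real" where
  "span_proj N d e x = (\<Sum>k<d. fscale (inner_N N x (e k)) (e k))"

lemma span_proj_in_span: "span_proj N d e x \<in> fvs.span (e ` {..<d})"
  unfolding span_proj_def by (intro fvs.span_sum fvs.span_scale fvs.span_base) auto

lemma span_orthonormal_subset_Rn: "orthonormal N d e \<Longrightarrow> fvs.span (e ` {..<d}) \<subseteq> Rn N"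
  by (intro fvs.span_minimal Rn_subspace) (auto simp: orthonormal_def)

lemma span_proj_residual_family:
  assumes "orthonormal N d e" "l < d"
  shows "inner_N N (x - span_proj N d e x) (e l) = 0"
proof -
  have "inner_N N (span_proj N d e x) (e l) = (\<Sum>k<d. inner_N N x (e k) * (if k = l then 1 else 0))"
    using assms unfolding span_proj_def orthonormal_def by (auto simp: inner_N_simps intro!: sum.cong)
  also have "\<dots> = inner_N N x (e l)"
    using assms(2) by (simp add: if_distrib[of "\<lambda>t. _ * t"] cong: if_cong)
  finally show ?thesis by (simp add: inner_N_simps)
qed

lemma span_proj_residual:
  assumes "orthonormal N d e" "z \<in> fvs.span (e ` {..<d})"
  shows "inner_N N (x - span_proj N d e x) z = 0"
  using assms(2)
proof (induction rule: fvs.span_induct_alt)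
  case (step c y z)
  then show ?case using span_proj_residual_family[OF assms(1)] by (auto simp: inner_N_add_right inner_N_scale_right)
qed simp

lemma span_proj_ident:
  assumes "orthonormal N d e" "x \<in> fvs.span (e ` {..<d})"
  shows "span_proj N d e x = x"
proof -
  let ?r = "x - span_proj N d e x"
  have r: "?r \<in> fvs.span (e ` {..<d})" by (intro fvs.span_diff assms span_proj_in_span)
  then have "inner_N N ?r ?r = 0" by (rule span_proj_residual[OF assms(1)])
  then have "?r = 0" using r span_orthonormal_subset_Rn[OF assms(1)] inner_N_eq_zero_iff by blast
  then show ?thesis by simp
qed

text \<open>One Gram-Schmidt step: the residual of \<open>x\<close> is nonzero, and its
  normalisation is the new vector.\<close>

lemma orthonormal_extend:
  assumes "orthonormal N d e" "fvs.subspace W" "W \<subseteq> Rn N" "\<And>k. k < d \<Longrightarrow> e k \<in> W"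
    and "x \<in> W" "x \<notin> fvs.span (e ` {..<d})"
  obtains v where "v \<in> W" "orthonormal N (Suc d) (e(d := v))"
proof -
  define r where "r = x - span_proj N d e x"
  have span_W: "fvs.span (e ` {..<d}) \<subseteq> W" using assms by (intro fvs.span_minimal) auto
  have r_W: "r \<in> W" unfolding r_def using span_W span_proj_in_span[of N d e x] assms
    by (intro fvs.subspace_diff) auto
  have r_ne: "r \<noteq> 0" using assms(6) span_proj_in_span[of N d e x] unfolding r_def by (metis eq_iff_diff_eq_0)
  then have pos: "inner_N N r r > 0"
    using inner_N_eq_zero_iff[of r N] inner_N_nonneg[of N r] r_W assms(3) by force
  define v where "v = fscale (1 / norm_N N r) r"
  have "norm_N N r \<noteq> 0" using pos norm_N_power2[of N r] by auto
  then have vv: "inner_N N v v = 1"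
    unfolding v_def by (simp add: inner_N_scale_left inner_N_scale_right norm_N_power2[of N r, symmetric] power2_eq_square)
  have ve: "inner_N N v (e l) = 0" if "l < d" for l
    using span_proj_residual_family[OF assms(1) that, of x] unfolding v_def r_def[symmetric] by (simp add: inner_N_simps)
  then have ev: "inner_N N (e l) v = 0" if "l < d" for l using that inner_N_commute by metis
  have v_W: "v \<in> W" unfolding v_def using r_W assms by (intro fvs.subspace_scale) auto
  have "orthonormal N (Suc d) (e(d := v))"
    using assms(1,3) v_W vv ve ev unfolding orthonormal_def by (auto simp: less_Suc_eq)
  with v_W that show thesis by blast
qed

lemma orthonormal_independent:
  assumes "orthonormal N d e"
  shows "fvs.independent (e ` {..<d}) \<and> card (e ` {..<d}) = d"
  using assms
proof (induction d)
  case (Suc d)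
  then have on: "orthonormal N d e" by (auto simp: orthonormal_def)
  have "e d \<notin> fvs.span (e ` {..<d})"
  proof
    assume "e d \<in> fvs.span (e ` {..<d})"
    then have "span_proj N d e (e d) = e d" by (rule span_proj_ident[OF on])
    moreover have "span_proj N d e (e d) = 0"
      unfolding span_proj_def using Suc.prems by (intro sum.neutral) (auto simp: orthonormal_def)
    ultimately show False using Suc.prems unfolding orthonormal_def by (metis inner_N_zero(1) lessI zero_neq_one)
  qed
  moreover have "e ` {..<Suc d} = insert (e d) (e ` {..<d})" by (simp add: lessThan_Suc)
  ultimately show ?case using Suc.IH[OF on] fvs.independent_insertI[of "e d" "e ` {..<d}"] fvs.span_base[of "e d" "e ` {..<d}"]
    by (auto simp: card_insert_if)
qed (simp add: fvs.independent_empty)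

definition unit_vec :: "nat \<Rightarrow> nat \<Rightarrow> real" where
  "unit_vec j = (\<lambda>k. if k = j then 1 else 0)"

lemma unit_vec_Rn: "j \<in> {1..N} \<Longrightarrow> unit_vec j \<in> Rn N"
  by (auto simp: unit_vec_def Rn_def)

lemma inner_N_unit_vec: "j \<in> {1..N} \<Longrightarrow> inner_N N x (unit_vec j) = x j"
  by (simp add: inner_N_def unit_vec_def if_distrib[of "\<lambda>t. _ * t"] cong: if_cong)

lemma orthonormal_unit_vec: "orthonormal N N (\<lambda>k. unit_vec (Suc k))"
  by (auto simp: orthonormal_def unit_vec_Rn inner_N_unit_vec) (auto simp: unit_vec_def)

lemma unit_vec_expansion:
  assumes "x \<in> Rn N" shows "x = (\<Sum>j=1..N. fscale (x j) (unit_vec j))"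
proof
  fix i
  have "(\<Sum>j=1..N. fscale (x j) (unit_vec j)) i = (\<Sum>j=1..N. x j * unit_vec j i)"
    by (simp add: sum_fun_apply fscale_def)
  also have "\<dots> = x i" using assms
    by (auto simp: unit_vec_def Rn_def if_distrib[of "\<lambda>t. _ * t"] cong: if_cong)
  finally show "x i = (\<Sum>j=1..N. fscale (x j) (unit_vec j)) i" ..
qed

lemma span_unit_vec: "Rn N \<subseteq> fvs.span (unit_vec ` {1..N})"
proof
  fix x assume "x \<in> Rn N"
  then show "x \<in> fvs.span (unit_vec ` {1..N})"
    by (subst unit_vec_expansion, assumption) (intro fvs.span_sum fvs.span_scale fvs.span_base, auto)
qed

lemma independent_card_le:
  assumes "fvs.independent B" "B \<subseteq> Rn N" shows "finite B \<and> card B \<le> N"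
  using fvs.independent_span_bound[of "unit_vec ` {1..N}" B] assms span_unit_vec[of N] card_image_le[of "{1..N}" unit_vec]
  by force

text \<open>Prolongs a given family instead of starting afresh, so that a basis of \<open>E\<close>
  can be continued to one of \<open>Rn N\<close>. As long as fewer than \<open>dim W\<close> vectors
  are present, they do not span \<open>W\<close> and a Gram-Schmidt step applies.\<close>

lemma orthonormal_family_within:
  assumes "orthonormal N d e" "fvs.subspace W" "W \<subseteq> Rn N" "\<And>k. k < d \<Longrightarrow> e k \<in> W"
    and "d \<le> d'" "d' \<le> fvs.dim W"
  shows "\<exists>e'. orthonormal N d' e' \<and> (\<forall>k<d'. e' k \<in> W) \<and> (\<forall>k<d. e' k = e k)"
  using assms(5,6)
proof (induction d' rule: dec_induct)
  case base
  then show ?case using assms by auto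
next
  case (step m)
  then obtain e' where e': "orthonormal N m e'" "\<forall>k<m. e' k \<in> W" "\<forall>k<d. e' k = e k" by auto
  have "\<not> W \<subseteq> fvs.span (e' ` {..<m})"
  proof
    assume "W \<subseteq> fvs.span (e' ` {..<m})"
    then have "fvs.dim W \<le> m" using fvs.dim_le_card[of W "e' ` {..<m}"] card_image_le[of "{..<m}" e'] by fastforce
    then show False using step.prems by simp
  qed
  then obtain x where "x \<in> W" "x \<notin> fvs.span (e' ` {..<m})" by auto
  then obtain v where v: "v \<in> W" "orthonormal N (Suc m) (e'(m := v))"
    using orthonormal_extend[OF e'(1) assms(2,3), of x] e'(2) by blast
  have "\<forall>k<Suc m. (e'(m := v)) k \<in> W" "\<forall>k<d. (e'(m := v)) k = e k"
    using v(1) e' step.hyps by (auto simp: less_Suc_eq)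
  with v(2) show ?case by blast
qed

lemma orthonormal_spans:
  assumes "orthonormal N (fvs.dim W) e" "fvs.subspace W" "W \<subseteq> Rn N" "\<And>k. k < fvs.dim W \<Longrightarrow> e k \<in> W"
  shows "fvs.span (e ` {..<fvs.dim W}) = W"
proof
  let ?d = "fvs.dim W"
  show "fvs.span (e ` {..<?d}) \<subseteq> W" using assms by (intro fvs.span_minimal) auto
  show "W \<subseteq> fvs.span (e ` {..<?d})"
  proof (rule ccontr)
    assume "\<not> W \<subseteq> fvs.span (e ` {..<?d})"
    then obtain x where "x \<in> W" "x \<notin> fvs.span (e ` {..<?d})" by auto
    then obtain v where v: "v \<in> W" "orthonormal N (Suc ?d) (e(?d := v))"
      using orthonormal_extend[OF assms, of x] by blast
    let ?B = "(e(?d := v)) ` {..<Suc ?d}"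
    obtain B where B: "B \<subseteq> W" "fvs.independent B" "W \<subseteq> fvs.span B" "card B = ?d"
      using fvs.basis_exists[of W] by auto
    have "finite B" using independent_card_le[of B N] B assms by auto
    moreover have "?B \<subseteq> fvs.span B" using v B assms(4) by (auto simp: less_Suc_eq)
    ultimately have "card ?B \<le> card B"
      using fvs.independent_span_bound[of B ?B] orthonormal_independent[OF v(2)] by blast
    then show False using orthonormal_independent[OF v(2)] B(4) by simp
  qed
qed

lemma dim_Rn: "fvs.dim (Rn N) = N"
proof (rule fvs.dim_unique)
  have eq: "(\<lambda>k. unit_vec (Suc k)) ` {..<N} = unit_vec ` {1..N}"
    by (auto simp: image_iff) (metis Suc_pred lessI less_le_trans Suc_le_eq atLeastAtMost_iff lessThan_iff One_nat_def)
  show "unit_vec ` {1..N} \<subseteq> Rn N" using unit_vec_Rn by auto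
  show "Rn N \<subseteq> fvs.span (unit_vec ` {1..N})" by (rule span_unit_vec)
  show "fvs.independent (unit_vec ` {1..N})" "card (unit_vec ` {1..N}) = N"
    using orthonormal_independent[OF orthonormal_unit_vec[of N]] unfolding eq by auto
qed

text \<open>The first \<open>N - n\<close> vectors span \<open>E\<close>, so the last
  \<open>n\<close> span its orthogonal complement. The codimension enters the Gaussian integrals
  only through this count.\<close>

lemma adapted_basis:
  assumes "E \<in> grassmannian N n"
  obtains e where "orthonormal N N e" "fvs.span (e ` {..<N - n}) = E" "fvs.span (e ` {..<N}) = Rn N"
proof -
  have E: "E \<subseteq> Rn N" "fvs.subspace E" "fvs.dim E = N - n" "n \<le> N" using assms by (auto simp: grassmannian_def)
  obtain e where e: "orthonormal N (N - n) e" "\<forall>k<N - n. e k \<in> E"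
    using orthonormal_family_within[of N 0 _ E "N - n"] E by (auto simp: orthonormal_def)
  obtain e' where e': "orthonormal N N e'" "\<forall>k<N. e' k \<in> Rn N" "\<forall>k<N - n. e' k = e k"
    using orthonormal_family_within[of N "N - n" e "Rn N" N] e E Rn_subspace dim_Rn by auto
  have *: "orthonormal N (N - n) e'" using e'(1) by (auto simp: orthonormal_def)
  show thesis
  proof
    show "fvs.span (e' ` {..<N - n}) = E" using orthonormal_spans[of N E e'] E * e e' by auto
    show "fvs.span (e' ` {..<N}) = Rn N" using orthonormal_spans[of N "Rn N" e'] dim_Rn Rn_subspace e' by auto
  qed (use e' in auto)
qed

text \<open>\<open>orth_proj\<close> is a definite description, so an explicit candidate must be
  shown unique: the difference of two candidates lies in \<open>E\<close> and is orthogonal to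
  itself.\<close>

lemma orth_proj_unique:
  assumes "fvs.subspace E" "E \<subseteq> Rn N" "y \<in> E" "\<And>z. z \<in> E \<Longrightarrow> inner_N N (x - y) z = 0"
  shows "orth_proj N E x = y"
  unfolding orth_proj_def
proof (rule the_equality)
  fix y' assume y': "y' \<in> E \<and> (\<forall>z\<in>E. inner_N N (x - y') z = 0)"
  then have d: "y' - y \<in> E" using assms by (intro fvs.subspace_diff) auto
  then have "inner_N N (x - y') (y' - y) = 0" "inner_N N (x - y) (y' - y) = 0" using y' assms by auto
  then have "inner_N N (y' - y) (y' - y) = 0" by (simp add: inner_N_simps)
  then show "y' = y" using d assms inner_N_eq_zero_iff[of "y' - y" N] by (auto dest!: subsetD)
qed (use assms in auto)

lemma orth_proj_span:
  assumes "orthonormal N d e" "fvs.span (e ` {..<d}) = E"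
  shows "orth_proj N E x = span_proj N d e x"
  using assms span_proj_in_span[of N d e x] span_orthonormal_subset_Rn[OF assms(1)] span_proj_residual[OF assms(1), of _ x]
  by (intro orth_proj_unique) (auto simp: fvs.subspace_span)

lemma orthonormal_mono: "orthonormal N d e \<Longrightarrow> d' \<le> d \<Longrightarrow> orthonormal N d' e"
  by (auto simp: orthonormal_def)

lemma inner_span_proj:
  assumes "orthonormal N d e" shows "inner_N N (span_proj N d e x) x = (\<Sum>k<d. (inner_N N x (e k))\<^sup>2)"
  unfolding span_proj_def by (simp add: inner_N_simps power2_eq_square inner_N_commute[of N _ x])

context
  fixes N n :: nat and E assumes E: "E \<in> grassmannian N n"
begin

lemma grassmannian_subspace: "fvs.subspace E" and grassmannian_subset_Rn: "E \<subseteq> Rn N"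
  using E by (auto simp: grassmannian_def)

lemma orth_proj_in: "orth_proj N E x \<in> E"
  and orth_proj_residual: "z \<in> E \<Longrightarrow> inner_N N (x - orth_proj N E x) z = 0"
proof -
  obtain e where "orthonormal N N e" "fvs.span (e ` {..<N - n}) = E" using adapted_basis[OF E] by metis
  then have e: "orthonormal N (N - n) e" "fvs.span (e ` {..<N - n}) = E"
    by (auto intro: orthonormal_mono)
  show "orth_proj N E x \<in> E" using span_proj_in_span[of N "N - n" e x] orth_proj_span[OF e] e by simp
  show "z \<in> E \<Longrightarrow> inner_N N (x - orth_proj N E x) z = 0"
    using orth_proj_span[OF e] span_proj_residual[OF e(1)] e(2) by simp
qed

lemma orth_proj_Rn: "orth_proj N E x \<in> Rn N"
  using orth_proj_in grassmannian_subset_Rn by auto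

lemma orth_proj_ident: "x \<in> E \<Longrightarrow> orth_proj N E x = x"
  by (rule orth_proj_unique[OF grassmannian_subspace grassmannian_subset_Rn]) auto

lemma orth_proj_add: "orth_proj N E (x + y) = orth_proj N E x + orth_proj N E y"
proof (rule orth_proj_unique[OF grassmannian_subspace grassmannian_subset_Rn])
  show "orth_proj N E x + orth_proj N E y \<in> E" by (intro fvs.subspace_add grassmannian_subspace orth_proj_in)
  fix z assume "z \<in> E"
  then show "inner_N N (x + y - (orth_proj N E x + orth_proj N E y)) z = 0"
    using orth_proj_residual[of z x] orth_proj_residual[of z y] by (simp add: inner_N_simps)
qed

lemma orth_proj_scale: "orth_proj N E (fscale c x) = fscale c (orth_proj N E x)"
proof (rule orth_proj_unique[OF grassmannian_subspace grassmannian_subset_Rn])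
  show "fscale c (orth_proj N E x) \<in> E" by (intro fvs.subspace_scale grassmannian_subspace orth_proj_in)
  fix z assume "z \<in> E"
  then show "inner_N N (fscale c x - fscale c (orth_proj N E x)) z = 0"
    using orth_proj_residual[of z x] by (simp add: inner_N_simps) 
qed

lemma orth_proj_diff: "orth_proj N E (x - y) = orth_proj N E x - orth_proj N E y"
  using orth_proj_add[of "x - y" y] by simp

lemma orth_proj_zero: "orth_proj N E 0 = 0"
  using orth_proj_diff[of 0 0] by simp

lemma orth_proj_sum: "orth_proj N E (\<Sum>k\<in>A. f k) = (\<Sum>k\<in>A. orth_proj N E (f k))"
  by (induction A rule: infinite_finite_induct) (auto simp: orth_proj_add orth_proj_zero)

text \<open>The residual of \<open>y\<close> is orthogonal to \<open>orth_proj N E x\<close>, an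
  element of \<open>E\<close>. For \<open>y = x\<close> this expresses the norms of projection and
  residual by a quadratic form that is linear in the entries of the projection matrix.\<close>

lemma inner_orth_proj_left: "inner_N N (orth_proj N E x) y = inner_N N (orth_proj N E x) (orth_proj N E y)"
  using orth_proj_residual[OF orth_proj_in, of y x] by (simp add: inner_N_simps inner_N_commute)

lemma norm_orth_proj_residual:
  "(norm_N N (x - orth_proj N E x))\<^sup>2 = inner_N N x x - inner_N N (orth_proj N E x) x"
  unfolding norm_N_power2 using inner_orth_proj_left[of x x] by (simp add: inner_N_simps inner_N_commute)

lemma norm_orth_proj: "(norm_N N (orth_proj N E x))\<^sup>2 = inner_N N (orth_proj N E x) x"
  unfolding norm_N_power2 using inner_orth_proj_left[of x x] by (simp add: inner_N_simps inner_N_commute)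

lemma norm_orth_proj_residual_le: "norm_N N (x - orth_proj N E x) \<le> norm_N N x"
proof (rule power2_le_imp_le)
  show "(norm_N N (x - orth_proj N E x))\<^sup>2 \<le> (norm_N N x)\<^sup>2"
    unfolding norm_orth_proj_residual norm_orth_proj[symmetric] norm_N_power2[of N x] by simp
qed simp

lemma orth_proj_entries:
  assumes "x \<in> Rn N" shows "orth_proj N E x i = (\<Sum>j=1..N. proj_matrix N E (i, j) * x j)"
proof -
  have "orth_proj N E x = (\<Sum>j=1..N. fscale (x j) (orth_proj N E (unit_vec j)))"
    by (subst unit_vec_expansion[OF assms]) (simp add: orth_proj_sum orth_proj_scale)
  then show ?thesis by (simp add: sum_fun_apply fscale_def proj_matrix_def unit_vec_def mult.commute)
qed

end

text \<open>Both quadratic forms become sums of squares in one orthonormal basis, the shape that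
  \<open>gauss_quadratic_mgf\<close> integrates.\<close>

lemma adapted_basis_parseval:
  assumes "E \<in> grassmannian N n"
  obtains e where "orthonormal N N e"
    "\<And>x. inner_N N (orth_proj N E x) x = (\<Sum>k<N - n. (inner_N N x (e k))\<^sup>2)"
    "\<And>x. x \<in> Rn N \<Longrightarrow> inner_N N x x = (\<Sum>k<N. (inner_N N x (e k))\<^sup>2)"
proof -
  obtain e where e: "orthonormal N N e" "fvs.span (e ` {..<N - n}) = E" "fvs.span (e ` {..<N}) = Rn N"
    using adapted_basis[OF assms] by metis
  have e': "orthonormal N (N - n) e" using e(1) by (rule orthonormal_mono) simp
  show thesis
  proof
    show "inner_N N (orth_proj N E x) x = (\<Sum>k<N - n. (inner_N N x (e k))\<^sup>2)" for x
      using orth_proj_span[OF e' e(2)] inner_span_proj[OF e'] by simp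
    show "inner_N N x x = (\<Sum>k<N. (inner_N N x (e k))\<^sup>2)" if "x \<in> Rn N" for x
      using inner_span_proj[OF e(1), of x] span_proj_ident[OF e(1), of x] that e(3) by simp
  qed (rule e)
qed

section \<open>Reflections\<close>

text \<open>The Householder matrix of the reflection in the hyperplane orthogonal to
  \<open>v\<close>. If \<open>inner_N N v v = 0\<close>, division by zero makes it the identity, so
  that degenerate \<open>v\<close> need not be excluded.\<close>

definition reflect_mat :: "nat \<Rightarrow> (nat \<Rightarrow> real) \<Rightarrow> nat \<Rightarrow> nat \<Rightarrow> real" where
  "reflect_mat N v i j = (if i = j then 1 else 0) - 2 * v i * v j / inner_N N v v"

definition reflect :: "nat \<Rightarrow> (nat \<Rightarrow> real) \<Rightarrow> (nat \<Rightarrow> real) \<Rightarrow> nat \<Rightarrow> real" where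
  "reflect N v x = x - fscale (2 * inner_N N x v / inner_N N v v) v"

lemma reflect_Rn: "v \<in> Rn N \<Longrightarrow> x \<in> Rn N \<Longrightarrow> reflect N v x \<in> Rn N"
  by (auto simp: reflect_def Rn_def fscale_def fun_apply)

lemma inner_reflect: "inner_N N (reflect N v x) (reflect N v y) = inner_N N x y"
  by (cases "inner_N N v v = 0") (auto simp: reflect_def inner_N_simps field_simps inner_N_commute)

lemma reflect_reflect: "reflect N v (reflect N v x) = x"
proof (cases "inner_N N v v = 0")
  case False
  then have "inner_N N (reflect N v x) v = - inner_N N x v" by (simp add: reflect_def inner_N_simps)
  then show ?thesis
    by (simp add: reflect_def[of N v "reflect N v x"] fscale_def fun_eq_iff fun_apply) (simp add: reflect_def fscale_def fun_apply)
qed (simp add: reflect_def fun_eq_iff fscale_def fun_apply)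

lemma reflect_add: "reflect N v (x + y) = reflect N v x + reflect N v y"
  by (auto simp: reflect_def fun_eq_iff fscale_def fun_apply inner_N_simps algebra_simps add_divide_distrib)

lemma reflect_scale: "reflect N v (fscale c x) = fscale c (reflect N v x)"
  unfolding reflect_def inner_N_scale_left by (auto simp: fun_eq_iff fscale_def fun_apply algebra_simps)

lemma reflect_diff: "reflect N v (x - y) = reflect N v x - reflect N v y"
  using reflect_add[of N v "x - y" y] by simp

lemma mat_app_reflect:
  assumes "v \<in> Rn N" "x \<in> Rn N" shows "mat_app N (reflect_mat N v) x = reflect N v x"
proof
  fix i
  show "mat_app N (reflect_mat N v) x i = reflect N v x i"
  proof (cases "i \<in> {1..N}")
    case True
    have "(\<Sum>j=1..N. reflect_mat N v i j * x j)
        = (\<Sum>j=1..N. (if i = j then x j else 0)) - (\<Sum>j=1..N. x j * v j) * (2 * v i / inner_N N v v)"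
      unfolding sum_distrib_right sum_subtractf[symmetric] reflect_mat_def
      by (intro sum.cong) (auto simp: algebra_simps)
    then show ?thesis using True by (simp add: mat_app_def reflect_def fscale_def inner_N_def fun_apply)
  qed (use assms in \<open>auto simp: mat_app_def reflect_def Rn_def fscale_def fun_apply\<close>)
qed

lemma orthogonal_reflect_mat:
  assumes "v \<in> Rn N" shows "orthogonal_mat N (reflect_mat N v)"
  unfolding orthogonal_mat_def
proof (intro ballI)
  fix i j assume ij: "i \<in> {1..N}" "j \<in> {1..N}"
  have sym: "reflect_mat N v k i = reflect N v (unit_vec i) k" if "k \<in> {1..N}" "i \<in> {1..N}" for k i
    using that inner_N_unit_vec[of i N v] by (auto simp: reflect_mat_def reflect_def fscale_def unit_vec_def inner_N_commute fun_apply)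
  have "(\<Sum>k=1..N. reflect_mat N v k i * reflect_mat N v k j) = inner_N N (reflect N v (unit_vec i)) (reflect N v (unit_vec j))"
    unfolding inner_N_def using sym ij by (intro sum.cong) auto
  also have "\<dots> = (if i = j then 1 else 0)"
    unfolding inner_reflect using inner_N_unit_vec[OF ij(2)] by (auto simp: unit_vec_def)
  finally show "(\<Sum>k=1..N. reflect_mat N v k i * reflect_mat N v k j) = (if i = j then 1 else 0)" .
qed

text \<open>This is the transitivity of reflections on spheres: the reflection along the difference
  of two vectors of equal length interchanges them.\<close>

lemma reflect_swap:
  assumes "inner_N N x x = inner_N N y y" "x - y \<noteq> 0" "x \<in> Rn N" "y \<in> Rn N"
  shows "reflect N (x - y) x = y"
proof -
  have "x - y \<in> Rn N" using assms Rn_subspace[of N] fvs.subspace_diff by blast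
  then have "inner_N N (x - y) (x - y) \<noteq> 0" using inner_N_eq_zero_iff assms(2) by blast
  moreover have "2 * inner_N N x (x - y) = inner_N N (x - y) (x - y)"
    using assms(1) by (simp add: inner_N_simps inner_N_commute)
  ultimately show ?thesis by (simp add: reflect_def)
qed

lemma reflect_grassmannian:
  assumes "E \<in> grassmannian N n" "v \<in> Rn N"
  shows "reflect N v ` E \<in> grassmannian N n"
proof -
  obtain e where e: "orthonormal N N e" "fvs.span (e ` {..<N - n}) = E" using adapted_basis[OF assms(1)] by metis
  have n: "n \<le> N" using assms(1) by (auto simp: grassmannian_def)
  let ?f = "\<lambda>k. reflect N v (e k)"
  have on: "orthonormal N (N - n) ?f"
    using e(1) reflect_Rn[OF assms(2)] by (auto simp: orthonormal_def inner_reflect)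
  have sub: "fvs.subspace (reflect N v ` E)"
    unfolding fvs.subspace_def
  proof (intro conjI ballI allI)
    have "reflect N v 0 = 0" by (simp add: reflect_def fscale_def fun_eq_iff fun_apply)
    then show "0 \<in> reflect N v ` E" using fvs.subspace_0[OF grassmannian_subspace[OF assms(1)]] by force
    fix x y assume "x \<in> reflect N v ` E" "y \<in> reflect N v ` E"
    then show "x + y \<in> reflect N v ` E" using fvs.subspace_add[OF grassmannian_subspace[OF assms(1)]] by (auto simp flip: reflect_add)
    fix c show "fscale c x \<in> reflect N v ` E" using \<open>x \<in> _\<close> fvs.subspace_scale[OF grassmannian_subspace[OF assms(1)]] by (auto simp flip: reflect_scale)
  qed
  have "reflect N v ` E \<subseteq> fvs.span (?f ` {..<N - n})"
  proof
    fix y assume "y \<in> reflect N v ` E"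
    then obtain x where x: "x \<in> fvs.span (e ` {..<N - n})" "y = reflect N v x" using e(2) by auto
    have "reflect N v x \<in> fvs.span (?f ` {..<N - n})" using x(1)
    proof (induction rule: fvs.span_induct_alt)
      case base
      have "reflect N v 0 = 0" by (simp add: reflect_def fscale_def fun_eq_iff fun_apply)
      then show ?case by (simp add: fvs.span_zero)
    next
      case (step c z w)
      then show ?case unfolding reflect_add reflect_scale by (intro fvs.span_add fvs.span_scale) (auto intro: fvs.span_base)
    qed
    then show "y \<in> fvs.span (?f ` {..<N - n})" using x by simp
  qed
  moreover have "?f ` {..<N - n} \<subseteq> reflect N v ` E" using e(2) fvs.span_base by fastforce
  ultimately have "fvs.dim (reflect N v ` E) = N - n"
    using fvs.dim_unique[of "?f ` {..<N - n}" "reflect N v ` E"] orthonormal_independent[OF on] by blast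
  then show ?thesis
    using sub n reflect_Rn[OF assms(2)] grassmannian_subset_Rn[OF assms(1)] by (auto simp: grassmannian_def)
qed

lemma orth_proj_reflect:
  assumes "E \<in> grassmannian N n" "v \<in> Rn N"
  shows "orth_proj N (reflect N v ` E) (reflect N v x) = reflect N v (orth_proj N E x)"
proof (rule orth_proj_unique)
  note g = reflect_grassmannian[OF assms]
  show "fvs.subspace (reflect N v ` E)" "reflect N v ` E \<subseteq> Rn N"
    using grassmannian_subspace[OF g] grassmannian_subset_Rn[OF g] by auto
  show "reflect N v (orth_proj N E x) \<in> reflect N v ` E" using orth_proj_in[OF assms(1)] by auto
  show "inner_N N (reflect N v x - reflect N v (orth_proj N E x)) z = 0" if "z \<in> reflect N v ` E" for z
    using that orth_proj_residual[OF assms(1)] by (auto simp: inner_reflect simp flip: reflect_diff)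
qed

section \<open>Gaussian measures\<close>

definition std_gauss :: "real measure" where
  "std_gauss = density lborel (\<lambda>x. ennreal (std_normal_density x))"

definition gauss :: "nat set \<Rightarrow> (nat \<Rightarrow> real) measure" where
  "gauss I = Pi\<^sub>M I (\<lambda>_. std_gauss)"

text \<open>Points of a product measure on \<open>I\<close> are \<open>undefined\<close> outside
  \<open>I\<close>; padding by zero turns them into vectors on which \<open>inner_N\<close> and
  \<open>orth_proj\<close> act.\<close>

definition zero_ext :: "nat set \<Rightarrow> (nat \<Rightarrow> real) \<Rightarrow> nat \<Rightarrow> real" where
  "zero_ext I g = (\<lambda>i. if i \<in> I then g i else 0)"

lemma sets_std_gauss [measurable_cong]: "sets std_gauss = sets borel"
  by (simp add: std_gauss_def)

lemma prob_space_std_gauss: "prob_space std_gauss"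
  unfolding std_gauss_def by (rule prob_space_normal_density) simp

lemma product_prob_space_gauss: "product_prob_space (\<lambda>_::nat. std_gauss)"
  unfolding product_prob_space_def product_prob_space_axioms_def product_sigma_finite_def
  using prob_space_std_gauss prob_space_imp_sigma_finite by auto

lemma product_sigma_finite_gauss: "product_sigma_finite (\<lambda>_::nat. std_gauss)"
  using product_prob_space_gauss product_prob_space_def by auto

lemma prob_space_gauss: "prob_space (gauss I)"
  unfolding gauss_def by (intro prob_space_PiM prob_space_std_gauss)

lemma measurable_gauss_component [measurable]: "i \<in> I \<Longrightarrow> (\<lambda>g. g i) \<in> borel_measurable (gauss I)"
  unfolding gauss_def by measurable

text \<open>Completing the square: the integrand times the density is a constant times the normal
  density of variance \<open>1 / (1 + 2 * a)\<close>.\<close>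

lemma nn_integral_std_gauss:
  assumes "1 + 2 * a > 0"
  shows "(\<integral>\<^sup>+x. ennreal (exp (c * x - a * x\<^sup>2)) \<partial>std_gauss)
    = ennreal (exp (c\<^sup>2 / (2 * (1 + 2 * a))) / sqrt (1 + 2 * a))"
proof -
  define s where "s = 1 / sqrt (1 + 2 * a)"
  have s: "s > 0" "s\<^sup>2 = 1 / (1 + 2 * a)" using assms by (auto simp: s_def power_divide)
  define \<mu> where "\<mu> = c * s\<^sup>2"
  have key: "std_normal_density x * exp (c * x - a * x\<^sup>2) = (exp (c\<^sup>2 / (2 * (1 + 2 * a))) * s) * normal_density \<mu> s x" for x
  proof -
    have "- x\<^sup>2 / 2 + (c * x - a * x\<^sup>2) = c\<^sup>2 / (2 * (1 + 2 * a)) + - (x - \<mu>)\<^sup>2 / (2 * s\<^sup>2)"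
    proof -
      define w where "w = 1 + 2 * a"
      have w: "w > 0" "a = (w - 1) / 2" using assms by (auto simp: w_def)
      have sq: "(x - c / w)\<^sup>2 * w = x\<^sup>2 * w - 2 * (x * c) + c\<^sup>2 / w"
        using w(1) by (simp add: power2_eq_square field_simps)
      have "- (x - \<mu>)\<^sup>2 / (2 * s\<^sup>2) = - ((x - c / w)\<^sup>2 * w) / 2"
        unfolding \<mu>_def s(2) w_def[symmetric] by simp
      also have "\<dots> = - x\<^sup>2 / 2 + (c * x - a * x\<^sup>2) - c\<^sup>2 / (2 * (1 + 2 * a))"
        unfolding sq w_def[symmetric] w(2) by (simp add: field_simps)
      finally show ?thesis by simp
    qed
    moreover have "sqrt (2 * pi * s\<^sup>2) = sqrt (2 * pi) * s" using s(1) by (simp add: real_sqrt_mult)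
    ultimately show ?thesis
      using s(1) unfolding std_normal_density_def normal_density_def by (simp add: exp_add[symmetric])
  qed
  have "(\<integral>\<^sup>+x. ennreal (exp (c * x - a * x\<^sup>2)) \<partial>std_gauss)
      = (\<integral>\<^sup>+x. ennreal (exp (c\<^sup>2 / (2 * (1 + 2 * a))) * s) * ennreal (normal_density \<mu> s x) \<partial>lborel)"
    unfolding std_gauss_def using s(1)
    by (subst nn_integral_density) (auto simp: key simp flip: ennreal_mult)
  also have "\<dots> = ennreal (exp (c\<^sup>2 / (2 * (1 + 2 * a))) * s) * (\<integral>\<^sup>+x. ennreal (normal_density \<mu> s x) \<partial>lborel)"
    by (rule nn_integral_cmult) auto
  also have "(\<integral>\<^sup>+x. ennreal (normal_density \<mu> s x) \<partial>lborel) = 1"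
    using s(1) by (subst nn_integral_eq_integral) auto
  finally show ?thesis by (simp add: s_def)
qed

lemma nn_integral_gauss_prod:
  assumes "finite I" "\<And>i. i \<in> I \<Longrightarrow> f i \<in> borel_measurable borel"
  shows "(\<integral>\<^sup>+g. (\<Prod>i\<in>I. f i (g i)) \<partial>gauss I) = (\<Prod>i\<in>I. \<integral>\<^sup>+x. f i x \<partial>std_gauss)"
  unfolding gauss_def
  by (rule product_sigma_finite.product_nn_integral_prod[OF product_sigma_finite_gauss])
     (use assms in \<open>auto simp: measurable_cong_sets[OF sets_std_gauss refl]\<close>)

lemma nn_integral_gauss_linear:
  assumes "finite I" "1 + 2 * a > 0"
  shows "(\<integral>\<^sup>+g. ennreal (exp ((\<Sum>i\<in>I. c i * g i) - a * (\<Sum>i\<in>I. (g i)\<^sup>2))) \<partial>gauss I)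
    = ennreal (exp ((\<Sum>i\<in>I. (c i)\<^sup>2) / (2 * (1 + 2 * a))) * (1 + 2 * a) powr (- real (card I) / 2))"
proof -
  have "(\<integral>\<^sup>+g. ennreal (exp ((\<Sum>i\<in>I. c i * g i) - a * (\<Sum>i\<in>I. (g i)\<^sup>2))) \<partial>gauss I)
      = (\<integral>\<^sup>+g. (\<Prod>i\<in>I. ennreal (exp (c i * g i - a * (g i)\<^sup>2))) \<partial>gauss I)"
    using assms(1)
    by (simp add: prod_ennreal sum_distrib_left sum_subtractf[symmetric] exp_sum)
  also have "\<dots> = (\<Prod>i\<in>I. \<integral>\<^sup>+x. ennreal (exp (c i * x - a * x\<^sup>2)) \<partial>std_gauss)"
    by (rule nn_integral_gauss_prod[OF assms(1)]) auto
  also have "\<dots> = ennreal (\<Prod>i\<in>I. exp ((c i)\<^sup>2 / (2 * (1 + 2 * a))) / sqrt (1 + 2 * a))"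
    unfolding nn_integral_std_gauss[OF assms(2)] by (rule prod_ennreal) (use assms in auto)
  also have "(\<Prod>i\<in>I. exp ((c i)\<^sup>2 / (2 * (1 + 2 * a))) / sqrt (1 + 2 * a))
      = exp ((\<Sum>i\<in>I. (c i)\<^sup>2) / (2 * (1 + 2 * a))) / sqrt (1 + 2 * a) ^ card I"
    using assms(1) by (simp add: prod_dividef exp_sum sum_divide_distrib)
  also have "\<dots> = exp ((\<Sum>i\<in>I. (c i)\<^sup>2) / (2 * (1 + 2 * a))) * (1 + 2 * a) powr (- real (card I) / 2)"
    using assms(2)
    by (simp add: powr_minus_divide powr_half_sqrt[symmetric] powr_powr powr_realpow[symmetric])
  finally show ?thesis .
qed

text \<open>The square \<open>exp (b t\<^sup>2)\<close> is linearised by an independent Gaussian vector \<open>h\<close>, since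
  \<open>exp (b t\<^sup>2)\<close> is the mean of \<open>exp (sqrt (2 b) h t)\<close>.\<close>

lemma gauss_quadratic_mgf:
  fixes v :: "nat \<Rightarrow> nat \<Rightarrow> real"
  assumes I: "finite I" and "finite K" and on: "\<And>k l. k \<in> K \<Longrightarrow> l \<in> K \<Longrightarrow> (\<Sum>i\<in>I. v k i * v l i) = (if k = l then 1 else 0)"
    and b: "b \<ge> 0" and ab: "1 + 2 * a - 2 * b > 0"
  shows "(\<integral>\<^sup>+g. ennreal (exp (b * (\<Sum>k\<in>K. (\<Sum>i\<in>I. v k i * g i)\<^sup>2) - a * (\<Sum>i\<in>I. (g i)\<^sup>2))) \<partial>gauss I)
    = ennreal ((1 + 2 * a) powr (- (real (card I) - real (card K)) / 2) * (1 + 2 * a - 2 * b) powr (- real (card K) / 2))"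
proof -
  define r where "r = sqrt (2 * b)"
  have r: "r\<^sup>2 = 2 * b" using b by (simp add: r_def)
  have a: "1 + 2 * a > 0" using b ab by simp
  interpret G: prob_space "gauss I" by (rule prob_space_gauss)
  interpret H: prob_space "gauss K" by (rule prob_space_gauss)
  interpret P: pair_sigma_finite "gauss K" "gauss I" by unfold_locales
  define T where "T g k = (\<Sum>i\<in>I. v k i * g i)" for g k
  have T_meas [measurable]: "(\<lambda>g. T g k) \<in> borel_measurable (gauss I)" for k unfolding T_def by measurable
  have lin: "ennreal (exp (b * (\<Sum>k\<in>K. (T g k)\<^sup>2)))
      = (\<integral>\<^sup>+h. ennreal (exp (\<Sum>k\<in>K. r * T g k * h k)) \<partial>gauss K)" for g
    using nn_integral_gauss_linear[of K 0 "\<lambda>k. r * T g k"] \<open>finite K\<close>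
    by (simp add: power_mult_distrib r mult.assoc flip: sum_distrib_left)
  have "(\<integral>\<^sup>+g. ennreal (exp (b * (\<Sum>k\<in>K. (T g k)\<^sup>2) - a * (\<Sum>i\<in>I. (g i)\<^sup>2))) \<partial>gauss I)
      = (\<integral>\<^sup>+g. (\<integral>\<^sup>+h. ennreal (exp ((\<Sum>k\<in>K. r * T g k * h k) - a * (\<Sum>i\<in>I. (g i)\<^sup>2))) \<partial>gauss K) \<partial>gauss I)"
  proof (rule nn_integral_cong)
    fix g
    have "ennreal (exp (b * (\<Sum>k\<in>K. (T g k)\<^sup>2) - a * (\<Sum>i\<in>I. (g i)\<^sup>2)))
        = (\<integral>\<^sup>+h. ennreal (exp (\<Sum>k\<in>K. r * T g k * h k)) \<partial>gauss K) * ennreal (exp (- a * (\<Sum>i\<in>I. (g i)\<^sup>2)))"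
      unfolding lin[symmetric] by (simp add: ennreal_mult[symmetric] exp_add[symmetric])
    also have "\<dots> = (\<integral>\<^sup>+h. ennreal (exp (\<Sum>k\<in>K. r * T g k * h k)) * ennreal (exp (- a * (\<Sum>i\<in>I. (g i)\<^sup>2))) \<partial>gauss K)"
      by (rule nn_integral_multc[symmetric]) measurable
    also have "\<dots> = (\<integral>\<^sup>+h. ennreal (exp ((\<Sum>k\<in>K. r * T g k * h k) - a * (\<Sum>i\<in>I. (g i)\<^sup>2))) \<partial>gauss K)"
      by (simp add: ennreal_mult[symmetric] exp_add[symmetric])
    finally show "ennreal (exp (b * (\<Sum>k\<in>K. (T g k)\<^sup>2) - a * (\<Sum>i\<in>I. (g i)\<^sup>2))) = \<dots>" .
  qed
  also have "\<dots> = (\<integral>\<^sup>+h. (\<integral>\<^sup>+g. ennreal (exp ((\<Sum>k\<in>K. r * T g k * h k) - a * (\<Sum>i\<in>I. (g i)\<^sup>2))) \<partial>gauss I) \<partial>gauss K)"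
    by (rule P.Fubini') measurable
  also have "\<dots> = (\<integral>\<^sup>+h. ennreal (exp ((\<Sum>k\<in>K. (h k)\<^sup>2) * (b / (1 + 2 * a))) * (1 + 2 * a) powr (- real (card I) / 2)) \<partial>gauss K)"
  proof (rule nn_integral_cong)
    fix h
    let ?c = "\<lambda>i. r * (\<Sum>k\<in>K. v k i * h k)"
    have 1: "(\<Sum>k\<in>K. r * T g k * h k) = (\<Sum>i\<in>I. ?c i * g i)" for g
      unfolding T_def sum_distrib_left sum_distrib_right by (subst sum.swap) (simp add: ac_simps)
    \<comment> \<open>By orthonormality of the family \<open>v\<close> the squared length of the
      coefficient vector is \<open>2 * b\<close> times that of \<open>h\<close>, so after the
      integral over \<open>g\<close> the integrand in \<open>h\<close> is again an isotropic
      Gaussian weight.\<close>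
    have "(\<Sum>i\<in>I. (\<Sum>k\<in>K. v k i * h k)\<^sup>2) = (\<Sum>k\<in>K. \<Sum>l\<in>K. h k * h l * (\<Sum>i\<in>I. v k i * v l i))"
      unfolding power2_eq_square sum_product sum_distrib_left
      by (subst sum.swap, rule sum.cong[OF refl], subst sum.swap) (simp add: sum_distrib_left ac_simps)
    also have "\<dots> = (\<Sum>k\<in>K. \<Sum>l\<in>K. if l = k then h k * h l else 0)"
      using on by (intro sum.cong) auto
    also have "\<dots> = (\<Sum>k\<in>K. (h k)\<^sup>2)"
      using \<open>finite K\<close> by (simp add: power2_eq_square)
    finally have 2: "(\<Sum>i\<in>I. (?c i)\<^sup>2) = 2 * b * (\<Sum>k\<in>K. (h k)\<^sup>2)"
      by (simp add: power_mult_distrib r sum_distrib_left[symmetric])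
    show "(\<integral>\<^sup>+g. ennreal (exp ((\<Sum>k\<in>K. r * T g k * h k) - a * (\<Sum>i\<in>I. (g i)\<^sup>2))) \<partial>gauss I)
      = ennreal (exp ((\<Sum>k\<in>K. (h k)\<^sup>2) * (b / (1 + 2 * a))) * (1 + 2 * a) powr (- real (card I) / 2))"
      unfolding 1 nn_integral_gauss_linear[OF I a] 2 using a by (simp add: field_simps)
  qed
  also have "\<dots> = ennreal ((1 + 2 * a) powr (- real (card I) / 2)) *
      (\<integral>\<^sup>+h. ennreal (exp ((\<Sum>k\<in>K. 0 * h k) - (- b / (1 + 2 * a)) * (\<Sum>k\<in>K. (h k)\<^sup>2))) \<partial>gauss K)"
    by (subst nn_integral_cmult[symmetric]) (auto simp: ennreal_mult[symmetric] mult_ac)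
  also have "\<dots> = ennreal ((1 + 2 * a) powr (- real (card I) / 2)) *
       ennreal ((1 + 2 * (- b / (1 + 2 * a))) powr (- real (card K) / 2))"
    using a ab by (subst nn_integral_gauss_linear[OF \<open>finite K\<close>]) (auto simp: field_simps)
  also have "1 + 2 * (- b / (1 + 2 * a)) = (1 + 2 * a - 2 * b) / (1 + 2 * a)"
    using a by (simp add: field_simps)
  also have "ennreal ((1 + 2 * a) powr (- real (card I) / 2)) *
       ennreal (((1 + 2 * a - 2 * b) / (1 + 2 * a)) powr (- real (card K) / 2))
     = ennreal ((1 + 2 * a) powr (- (real (card I) - real (card K)) / 2) * (1 + 2 * a - 2 * b) powr (- real (card K) / 2))"
    using a ab by (simp add: ennreal_mult[symmetric] powr_divide powr_diff[symmetric] field_simps)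
      (simp add: powr_add[symmetric] powr_minus_divide field_simps)
  finally show ?thesis unfolding T_def .
qed

section \<open>Averaging over the sphere\<close>

text \<open>\<open>inner_N\<close> does not see coordinates outside \<open>{1..N}\<close>. The
  topology compares all entries of \<open>proj_matrix\<close>, hence also those with such indices
  have to be computed.\<close>

lemma orth_proj_unit_vec_outside:
  assumes "E \<in> grassmannian N n" "j \<notin> {1..N}" shows "orth_proj N E (unit_vec j) = 0"
proof (rule orth_proj_unique[OF grassmannian_subspace[OF assms(1)] grassmannian_subset_Rn[OF assms(1)]])
  show "0 \<in> E" using fvs.subspace_0[OF grassmannian_subspace[OF assms(1)]] .
  show "inner_N N (unit_vec j - 0) z = 0" for z
    unfolding inner_N_def using assms(2) by (intro sum.neutral) (auto simp: unit_vec_def fun_apply)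
qed

lemma inner_orth_proj_entries:
  assumes "E \<in> grassmannian N n" "x \<in> Rn N"
  shows "inner_N N (orth_proj N E x) y = (\<Sum>i=1..N. (\<Sum>j=1..N. proj_matrix N E (i, j) * x j) * y i)"
  unfolding inner_N_def using orth_proj_entries[OF assms] by simp

definition supported :: "nat set \<Rightarrow> (nat \<Rightarrow> real) set" where
  "supported I = {x. \<forall>i. i \<notin> I \<longrightarrow> x i = 0}"

lemma Rn_eq_supported: "Rn N = supported {1..N}"
  by (simp add: Rn_def supported_def)

lemma supported_mono: "I \<subseteq> J \<Longrightarrow> supported I \<subseteq> supported J"
  by (auto simp: supported_def)

lemma zero_ext_supported [simp]: "zero_ext I g \<in> supported I"
  by (simp add: zero_ext_def supported_def)

lemma supported_scale: "x \<in> supported I \<Longrightarrow> fscale c x \<in> supported I"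
  and supported_diff: "x \<in> supported I \<Longrightarrow> y \<in> supported I \<Longrightarrow> x - y \<in> supported I"
  by (auto simp: supported_def fscale_def fun_apply)

lemma inner_zero_ext:
  assumes "I \<subseteq> {1..N}" shows "inner_N N (zero_ext I g) y = (\<Sum>i\<in>I. y i * g i)"
  unfolding inner_N_def zero_ext_def using assms
  by (intro sum.mono_neutral_cong_right) auto

lemma inner_zero_ext_self:
  assumes "I \<subseteq> {1..N}" shows "inner_N N (zero_ext I g) (zero_ext I g) = (\<Sum>i\<in>I. (g i)\<^sup>2)"
  unfolding inner_zero_ext[OF assms] by (intro sum.cong) (auto simp: zero_ext_def power2_eq_square)

text \<open>This is conjugation of the projection matrix by the reflection, written as a linear
  expression in the entries so that its continuity is evident.\<close>

lemma proj_matrix_reflect: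
  assumes E: "E \<in> grassmannian N n" and v: "v \<in> Rn N"
  shows "proj_matrix N (reflect N v ` E) = (\<lambda>(i, j). if i \<in> {1..N} \<and> j \<in> {1..N} then
    (\<Sum>k=1..N. \<Sum>l=1..N. reflect_mat N v i k * (proj_matrix N E (k, l) * reflect N v (unit_vec j) l)) else 0)"
proof (intro ext, clarify)
  fix i j
  note g = reflect_grassmannian[OF E v]
  let ?P = "orth_proj N (reflect N v ` E) (unit_vec j)"
  have m: "proj_matrix N (reflect N v ` E) (i, j) = ?P i" by (simp add: proj_matrix_def unit_vec_def)
  show "proj_matrix N (reflect N v ` E) (i, j) = (if i \<in> {1..N} \<and> j \<in> {1..N} then
    (\<Sum>k=1..N. \<Sum>l=1..N. reflect_mat N v i k * (proj_matrix N E (k, l) * reflect N v (unit_vec j) l)) else 0)"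
  proof (cases "i \<in> {1..N} \<and> j \<in> {1..N}")
    case True
    have R: "reflect N v (unit_vec j) \<in> Rn N" using True v by (intro reflect_Rn unit_vec_Rn) auto
    have "?P = reflect N v (orth_proj N E (reflect N v (unit_vec j)))"
      using orth_proj_reflect[OF E v, of "reflect N v (unit_vec j)"] by (simp add: reflect_reflect)
    also have "\<dots> = mat_app N (reflect_mat N v) (orth_proj N E (reflect N v (unit_vec j)))"
      using mat_app_reflect[OF v orth_proj_Rn[OF E]] by simp
    finally have "?P i = (\<Sum>k=1..N. reflect_mat N v i k * orth_proj N E (reflect N v (unit_vec j)) k)"
      using True by (simp add: mat_app_def)
    then show ?thesis using True m by (simp add: orth_proj_entries[OF E R] sum_distrib_left)
  next
    case False
    then show ?thesis
      using m orth_proj_Rn[OF g, of "unit_vec j"] orth_proj_unit_vec_outside[OF g, of j]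
      by (auto simp: Rn_def fun_apply)
  qed
qed

lemma continuous_on_coordinate: "continuous_on A (\<lambda>x::'a \<Rightarrow> real. x i)"
  by (rule continuous_on_subset[OF continuous_on_product_coordinates]) auto

section \<open>Measurability and invariance of the Haar measure\<close>

locale haar_grassmannian =
  fixes N n :: nat and M
  assumes n_ge_1: "1 \<le> n" and n_less_N: "n < N" and haar: "is_haar_grassmannian N n M"
begin

sublocale prob_space M
  using haar by (simp add: is_haar_grassmannian_def)

lemma space_M: "space M = grassmannian N n"
  using haar sets_eq_imp_space_eq[of M "grassmannian_borel N n"]
  by (simp add: is_haar_grassmannian_def grassmannian_borel_def space_measure_of_conv)

lemma openin_Pow: "{U. openin (grassmannian_topology N n) U} \<subseteq> Pow (grassmannian N n)"
  by (auto simp: grassmannian_topology_def openin_pullback_topology)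

lemma openin_sets: "openin (grassmannian_topology N n) U \<Longrightarrow> U \<in> sets M"
  using haar openin_Pow by (auto simp: is_haar_grassmannian_def grassmannian_borel_def)

lemma openin_vimage: "open V \<Longrightarrow> openin (grassmannian_topology N n) {E \<in> space M. proj_matrix N E \<in> V}"
  unfolding grassmannian_topology_def openin_pullback_topology space_M by (auto intro!: exI[of _ V])

lemma measurable_proj_matrix [measurable]: "(\<lambda>E. proj_matrix N E k) \<in> borel_measurable M"
proof (rule borel_measurableI)
  fix S :: "real set" assume "open S"
  then have "open {m :: nat \<times> nat \<Rightarrow> real. m k \<in> S}"
    using open_vimage[OF _ continuous_on_coordinate[of UNIV k]] by (simp add: vimage_def)
  from openin_sets[OF openin_vimage[OF this]]
  show "(\<lambda>E. proj_matrix N E k) -` S \<inter> space M \<in> sets M"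
    by (simp add: vimage_def Int_def conj_commute)
qed

text \<open>On projection matrices the action of a reflection is the continuous map
  \<open>T\<close>, so preimages of open sets of the Grassmannian are open.\<close>

lemma measurable_reflect:
  assumes v: "v \<in> Rn N" shows "(\<lambda>E. reflect N v ` E) \<in> measurable M M"
proof -
  define T where "T m = (\<lambda>(i, j). if i \<in> {1..N} \<and> j \<in> {1..N} then
    (\<Sum>k=1..N. \<Sum>l=1..N. reflect_mat N v i k * (m (k, l) * reflect N v (unit_vec j) l)) else 0)"
    for m :: "nat \<times> nat \<Rightarrow> real"
  have T: "proj_matrix N (reflect N v ` E) = T (proj_matrix N E)" if "E \<in> space M" for E
    using proj_matrix_reflect[OF _ v] that unfolding T_def space_M by blast
  have "continuous_on UNIV T"
  proof (rule continuous_on_coordinatewise_then_product, clarify)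
    fix i j
    show "continuous_on UNIV (\<lambda>m. T m (i, j))"
      unfolding T_def by (cases "i \<in> {1..N} \<and> j \<in> {1..N}") (auto intro!: continuous_intros continuous_on_coordinate)
  qed
  then have "open (T -` V)" if "open V" for V using that open_vimage by blast
  have "(\<lambda>E. reflect N v ` E) \<in> measurable M (grassmannian_borel N n)"
    unfolding grassmannian_borel_def
  proof (rule measurable_measure_of[OF openin_Pow])
    show "(\<lambda>E. reflect N v ` E) \<in> space M \<rightarrow> grassmannian N n"
      using reflect_grassmannian v by (auto simp: space_M)
    fix U assume "U \<in> {U. openin (grassmannian_topology N n) U}"
    then obtain V where V: "open V" "U = proj_matrix N -` V \<inter> grassmannian N n"
      by (auto simp: grassmannian_topology_def openin_pullback_topology)
    have "(\<lambda>E. reflect N v ` E) -` U \<inter> space M = {E \<in> space M. proj_matrix N E \<in> T -` V}"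
      using T reflect_grassmannian[OF _ v] by (auto simp: V(2) space_M)
    then show "(\<lambda>E. reflect N v ` E) -` U \<inter> space M \<in> sets M"
      using openin_sets[OF openin_vimage[OF \<open>open V \<Longrightarrow> open (T -` V)\<close>[OF V(1)]]] by simp
  qed
  moreover have "sets M = sets (grassmannian_borel N n)" using haar by (simp add: is_haar_grassmannian_def)
  ultimately show ?thesis by (subst measurable_cong_sets[OF refl, of M "grassmannian_borel N n"])
qed

lemma measure_reflect:
  assumes v: "v \<in> Rn N" and A: "A \<in> sets M"
  shows "measure M {E \<in> space M. reflect N v ` E \<in> A} = measure M A"
proof -
  have eq: "mat_app N (reflect_mat N v) ` E = reflect N v ` E" if "E \<in> space M" for E
    using that mat_app_reflect[OF v] grassmannian_subset_Rn[of E N n] by (intro image_cong) (auto simp: space_M)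
  have meas: "(\<lambda>E. mat_app N (reflect_mat N v) ` E) \<in> measurable M M"
    by (subst measurable_cong[OF eq]) (auto intro: measurable_reflect[OF v])
  have "measure M A = measure (distr M M (\<lambda>E. mat_app N (reflect_mat N v) ` E)) A"
    using haar orthogonal_reflect_mat[OF v] by (simp add: is_haar_grassmannian_def)
  also have "\<dots> = measure M ((\<lambda>E. mat_app N (reflect_mat N v) ` E) -` A \<inter> space M)"
    by (rule measure_distr[OF meas A])
  also have "(\<lambda>E. mat_app N (reflect_mat N v) ` E) -` A \<inter> space M = {E \<in> space M. reflect N v ` E \<in> A}"
    using eq by auto
  finally show ?thesis by simp
qed

text \<open>Reflections act transitively on spheres, so \<open>M {E. f E y \<ge> 0}\<close> does not depend on \<open>y\<close>;
  averaging over a Gaussian vector and exchanging the integrals leaves a Chernoff bound for fixed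
  \<open>E\<close>. No random orthogonal matrix has to be constructed.\<close>

lemma spherical_average:
  assumes I: "I \<subseteq> {1..N}"
    and meas: "(\<lambda>(E, g). f E (zero_ext I g)) \<in> borel_measurable (M \<Otimes>\<^sub>M gauss I)"
    and meas1: "\<And>y. y \<in> supported I \<Longrightarrow> (\<lambda>E. f E y) \<in> borel_measurable M"
    and inv: "\<And>E v y. E \<in> space M \<Longrightarrow> v \<in> supported I \<Longrightarrow> y \<in> supported I \<Longrightarrow>
      f (reflect N v ` E) (reflect N v y) = f E y"
    and scale: "\<And>E c y. E \<in> space M \<Longrightarrow> y \<in> supported I \<Longrightarrow> f E (fscale c y) = c\<^sup>2 * f E y"
    and bound: "\<And>E. E \<in> space M \<Longrightarrow> (\<integral>\<^sup>+g. ennreal (exp (s * f E (zero_ext I g))) \<partial>gauss I) \<le> ennreal B"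
    and s: "s \<ge> 0" and B: "B \<ge> 0" and y: "y \<in> supported I" "y \<noteq> 0"
  shows "measure M {E \<in> space M. f E y \<ge> 0} \<le> B"
proof -
  interpret G: prob_space "gauss I" by (rule prob_space_gauss)
  interpret P: pair_sigma_finite M "gauss I" by unfold_locales
  note [measurable] = meas1
  have Rn: "x \<in> Rn N" if "x \<in> supported I" for x
    using that supported_mono[OF I] by (auto simp: Rn_eq_supported)
  have scale_pos: "f E (fscale c y) \<ge> 0 \<longleftrightarrow> f E y \<ge> 0" if "E \<in> space M" "c > 0" for E c
    using scale[OF that(1) y(1), of c] that(2) by (simp add: zero_le_mult_iff)
  \<comment> \<open>An inequality suffices, and it also covers \<open>x = 0\<close>, where
    \<open>f E x = 0\<close> and the right-hand side is 1.\<close>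
  have const: "measure M {E \<in> space M. f E y \<ge> 0} \<le> measure M {E \<in> space M. f E x \<ge> 0}" if x: "x \<in> supported I" for x
  proof (cases "x = 0")
    case True
    have "f E x = 0" if "E \<in> space M" for E
    proof -
      have "x = fscale 0 x" using True by (simp add: fscale_def fun_eq_iff fun_apply)
      then have "f E x = f E (fscale 0 x)" by simp
      then show ?thesis using scale[OF that x, of 0] by simp
    qed
    then have "{E \<in> space M. f E x \<ge> 0} = space M" by auto
    then show ?thesis using prob_space by simp
  next
    case False
    define c where "c = norm_N N x / norm_N N y"
    have c: "c > 0" using False y x Rn norm_N_eq_zero_iff[of x N] norm_N_eq_zero_iff[of y N] norm_N_nonneg[of N]
      unfolding c_def by (metis divide_pos_pos less_eq_real_def)
    have y': "fscale c y \<in> supported I" using y by (intro supported_scale)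
    have "norm_N N (fscale c y) = norm_N N x"
      using c norm_N_eq_zero_iff[OF Rn[OF y(1)]] y(2) by (simp add: norm_N_scale) (simp add: c_def)
    then have nrm: "inner_N N (fscale c y) (fscale c y) = inner_N N x x" by (simp flip: norm_N_power2)
    have eq: "{E \<in> space M. f E y \<ge> 0} = {E \<in> space M. f E (fscale c y) \<ge> 0}"
      using scale_pos[OF _ c] by auto
    show ?thesis
    proof (cases "fscale c y - x = 0")
      case True
      then show ?thesis using eq by simp
    next
      case False
      \<comment> \<open>The reflecting vector is again supported in \<open>I\<close>. Invariance is
        therefore needed only for reflections that fix the coordinates outside \<open>I\<close>,
        which is what makes the case \<open>I = {2..N}\<close> useful.\<close>
      define v where "v = fscale c y - x"
      have v: "v \<in> supported I" unfolding v_def by (intro supported_diff y' x)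
      have "reflect N v (fscale c y) = x" unfolding v_def by (rule reflect_swap[OF nrm False Rn[OF y'] Rn[OF x]])
      then have "f (reflect N v ` E) x = f E (fscale c y)" if "E \<in> space M" for E
        using inv[OF that v y'] by simp
      then have "{E \<in> space M. f E (fscale c y) \<ge> 0}
          = {E \<in> space M. reflect N v ` E \<in> {E \<in> space M. f E x \<ge> 0}}"
        using measurable_reflect[OF Rn[OF v]] by (auto dest: measurable_space)
      also have "measure M \<dots> = measure M {E \<in> space M. f E x \<ge> 0}"
        by (rule measure_reflect[OF Rn[OF v]]) (use x in measurable)
      finally show ?thesis using eq by simp
    qed
  qed
  let ?J = "\<lambda>E g. indicator {0..} (f E (zero_ext I g)) :: ennreal"
  have mJ: "(\<lambda>(E, g). ?J E g) \<in> borel_measurable (M \<Otimes>\<^sub>M gauss I)"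
  proof -
    have "(\<lambda>p. indicator {0..} ((\<lambda>(E, g). f E (zero_ext I g)) p) :: ennreal) \<in> borel_measurable (M \<Otimes>\<^sub>M gauss I)"
      using meas by measurable
    then show ?thesis by (simp add: case_prod_beta')
  qed
  have "ennreal (measure M {E \<in> space M. f E y \<ge> 0})
      = (\<integral>\<^sup>+g. ennreal (measure M {E \<in> space M. f E y \<ge> 0}) \<partial>gauss I)"
    by (simp add: G.emeasure_space_1)
  also have "\<dots> \<le> (\<integral>\<^sup>+g. (\<integral>\<^sup>+E. ?J E g \<partial>M) \<partial>gauss I)"
  proof (rule nn_integral_mono)
    fix g
    have "(\<integral>\<^sup>+E. ?J E g \<partial>M) = (\<integral>\<^sup>+E. indicator {E \<in> space M. f E (zero_ext I g) \<ge> 0} E \<partial>M)"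
      by (rule nn_integral_cong) (auto simp: indicator_def)
    also have "\<dots> = emeasure M {E \<in> space M. f E (zero_ext I g) \<ge> 0}"
      by (rule nn_integral_indicator) measurable
    finally show "ennreal (measure M {E \<in> space M. f E y \<ge> 0}) \<le> (\<integral>\<^sup>+E. ?J E g \<partial>M)"
      using const[of "zero_ext I g"] by (simp add: emeasure_eq_measure ennreal_leI)
  qed
  also have "\<dots> = (\<integral>\<^sup>+E. (\<integral>\<^sup>+g. ?J E g \<partial>gauss I) \<partial>M)"
    by (rule P.Fubini'[OF mJ])
  also have "\<dots> \<le> (\<integral>\<^sup>+E. ennreal B \<partial>M)"
  proof (rule nn_integral_mono)
    fix E assume E: "E \<in> space M"
    have "(\<integral>\<^sup>+g. ?J E g \<partial>gauss I) \<le> (\<integral>\<^sup>+g. ennreal (exp (s * f E (zero_ext I g))) \<partial>gauss I)"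
      using s by (intro nn_integral_mono) (auto simp: indicator_def)
    also note bound[OF E]
    finally show "(\<integral>\<^sup>+g. ?J E g \<partial>gauss I) \<le> ennreal B" .
  qed
  also have "\<dots> = ennreal B" by (simp add: emeasure_space_1)
  finally show ?thesis using B by (simp add: ennreal_le_iff)
qed

lemma measurable_inner_orth_proj:
  assumes "x \<in> Rn N" shows "(\<lambda>E. inner_N N (orth_proj N E x) y) \<in> borel_measurable M"
proof -
  have "(\<lambda>E. (\<Sum>i=1..N. (\<Sum>j=1..N. proj_matrix N E (i, j) * x j) * y i)) \<in> borel_measurable M"
    by measurable
  then show ?thesis
    by (subst measurable_cong[of _ _ "\<lambda>E. (\<Sum>i=1..N. (\<Sum>j=1..N. proj_matrix N E (i, j) * x j) * y i)"])
       (use inner_orth_proj_entries[OF _ assms] in \<open>auto simp: space_M\<close>)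
qed

lemma measurable_zero_ext: "(\<lambda>g. zero_ext I g i) \<in> borel_measurable (gauss I)"
  unfolding zero_ext_def by (cases "i \<in> I") auto

lemma measurable_inner_orth_proj_pair:
  assumes "I \<subseteq> {1..N}"
  shows "(\<lambda>(E, g). inner_N N (orth_proj N E (zero_ext I g)) (zero_ext I g)) \<in> borel_measurable (M \<Otimes>\<^sub>M gauss I)"
proof -
  note [measurable] = measurable_zero_ext
  have "(\<lambda>p. (\<Sum>i=1..N. (\<Sum>j=1..N. proj_matrix N (fst p) (i, j) * zero_ext I (snd p) j) * zero_ext I (snd p) i))
      \<in> borel_measurable (M \<Otimes>\<^sub>M gauss I)"
    by measurable
  moreover have "zero_ext I g \<in> Rn N" for g
    using supported_mono[OF assms] zero_ext_supported unfolding Rn_eq_supported by blast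
  ultimately show ?thesis
    by (subst measurable_cong[of _ _ "\<lambda>p. (\<Sum>i=1..N. (\<Sum>j=1..N. proj_matrix N (fst p) (i, j) * zero_ext I (snd p) j) * zero_ext I (snd p) i)"])
       (use inner_orth_proj_entries in \<open>auto simp: space_M space_pair_measure\<close>)
qed

lemma quadratic_form_tail:
  fixes c d :: real
  defines "f \<equiv> \<lambda>E x. c * inner_N N x x + d * inner_N N (orth_proj N E x) x"
  assumes bound: "\<And>E. E \<in> space M \<Longrightarrow>
      (\<integral>\<^sup>+g. ennreal (exp (s * f E (zero_ext {1..N} g))) \<partial>gauss {1..N}) \<le> ennreal B"
    and s: "s \<ge> 0" and B: "B \<ge> 0" and x: "x \<in> Rn N" "x \<noteq> 0"
  shows "measure M {E \<in> space M. 0 \<le> f E x} \<le> B"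
proof (rule spherical_average[where I = "{1..N}" and s = s])
  have "(\<lambda>g. inner_N N (zero_ext {1..N} g) (zero_ext {1..N} g)) \<in> borel_measurable (gauss {1..N})"
    unfolding inner_zero_ext_self[OF order_refl] by measurable
  then show "(\<lambda>(E, g). f E (zero_ext {1..N} g)) \<in> borel_measurable (M \<Otimes>\<^sub>M gauss {1..N})"
    unfolding f_def using measurable_inner_orth_proj_pair[OF order_refl] unfolding case_prod_beta' by measurable
  show "(\<lambda>E. f E y) \<in> borel_measurable M" if "y \<in> supported {1..N}" for y
    unfolding f_def using that measurable_inner_orth_proj[of y y] by (auto simp: Rn_eq_supported)
  show "f (reflect N v ` E) (reflect N v y) = f E y"
    if "E \<in> space M" "v \<in> supported {1..N}" "y \<in> supported {1..N}" for E v y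
    unfolding f_def using that orth_proj_reflect by (simp add: inner_reflect space_M Rn_eq_supported)
  show "f E (fscale t y) = t\<^sup>2 * f E y" if "E \<in> space M" "y \<in> supported {1..N}" for E t y
    unfolding f_def using that orth_proj_scale[of E N n]
    by (simp add: inner_N_scale_left inner_N_scale_right space_M power2_eq_square algebra_simps)
qed (use bound s B x in \<open>auto simp: Rn_eq_supported\<close>)

text \<open>The functional is the squared residual minus \<open>\<tau>\<close> times the squared
  norm. In an adapted basis the residual collects the \<open>n\<close> last coordinates, so its
  Gaussian exponential moment is exactly the stated product; \<open>s\<close> stays free for later
  choices.\<close>

lemma residual_tail:
  assumes x: "x \<in> Rn N" "x \<noteq> 0" and s: "s \<ge> 0" "1 + 2 * s * \<tau> - 2 * s > 0"
  shows "measure M {E \<in> space M. \<tau> * (norm_N N x)\<^sup>2 \<le> (norm_N N (x - orth_proj N E x))\<^sup>2}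
    \<le> (1 + 2 * s * \<tau>) powr (- (real N - real n) / 2) * (1 + 2 * s * \<tau> - 2 * s) powr (- real n / 2)"
    (is "_ \<le> ?B")
proof -
  let ?f = "\<lambda>E x. (1 - \<tau>) * inner_N N x x + - 1 * inner_N N (orth_proj N E x) x"
  let ?x = "zero_ext {1..N}"
  have "(\<integral>\<^sup>+g. ennreal (exp (s * ?f E (?x g))) \<partial>gauss {1..N}) \<le> ennreal ?B" if E: "E \<in> space M" for E
  proof -
    obtain e where e: "orthonormal N N e"
      "\<And>x. inner_N N (orth_proj N E x) x = (\<Sum>k<N - n. (inner_N N x (e k))\<^sup>2)"
      "\<And>x. x \<in> Rn N \<Longrightarrow> inner_N N x x = (\<Sum>k<N. (inner_N N x (e k))\<^sup>2)"
      using adapted_basis_parseval[OF E[unfolded space_M]] by blast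
    have "s * ?f E (?x g) = s * (\<Sum>k\<in>{N - n..<N}. (\<Sum>i\<in>{1..N}. e k i * g i)\<^sup>2) - (s * \<tau>) * (\<Sum>i\<in>{1..N}. (g i)\<^sup>2)" for g
    proof -
      have "(\<Sum>k<N. (inner_N N (?x g) (e k))\<^sup>2) = (\<Sum>k<N - n. (inner_N N (?x g) (e k))\<^sup>2) + (\<Sum>k\<in>{N - n..<N}. (inner_N N (?x g) (e k))\<^sup>2)"
        using sum.atLeastLessThan_concat[of 0 "N - n" N, symmetric] unfolding lessThan_atLeast0 by simp
      then have "inner_N N (?x g) (?x g) - inner_N N (orth_proj N E (?x g)) (?x g) = (\<Sum>k\<in>{N - n..<N}. (inner_N N (?x g) (e k))\<^sup>2)"
        using e(3)[of "?x g"] unfolding e(2) by (simp add: Rn_eq_supported)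
      then show ?thesis
        unfolding inner_zero_ext_self[OF order_refl, symmetric] inner_zero_ext[OF order_refl, symmetric]
        by (simp flip: right_diff_distrib) (simp add: algebra_simps)
    qed
    then have "(\<integral>\<^sup>+g. ennreal (exp (s * ?f E (?x g))) \<partial>gauss {1..N}) = ennreal ?B"
      using e(1) s n_less_N unfolding orthonormal_def
      by (simp only:) (subst gauss_quadratic_mgf, auto simp: inner_N_def mult.assoc)
    then show ?thesis by simp
  qed
  then have "measure M {E \<in> space M. 0 \<le> ?f E x} \<le> ?B"
    using x s by (intro quadratic_form_tail) auto
  moreover have "?f E x = (norm_N N (x - orth_proj N E x))\<^sup>2 - \<tau> * (norm_N N x)\<^sup>2" if "E \<in> space M" for E
    using norm_orth_proj_residual[OF that[unfolded space_M], of x] norm_N_power2[of N x] by (simp add: algebra_simps)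
  then have "{E \<in> space M. 0 \<le> ?f E x} = {E \<in> space M. \<tau> * (norm_N N x)\<^sup>2 \<le> (norm_N N (x - orth_proj N E x))\<^sup>2}"
    by (intro Collect_cong conj_cong refl) (simp only: diff_ge_0_iff_ge)
  ultimately show ?thesis by simp
qed

text \<open>The same computation with the opposite sign, where now the \<open>N - n\<close>
  coordinates in \<open>E\<close> carry the positive square.\<close>

lemma residual_lower_tail:
  assumes x: "x \<in> Rn N" "x \<noteq> 0" and s: "s \<ge> 0" "1 - 2 * s * \<tau> > 0"
  shows "measure M {E \<in> space M. (norm_N N (x - orth_proj N E x))\<^sup>2 \<le> \<tau> * (norm_N N x)\<^sup>2}
    \<le> (1 + 2 * s * (1 - \<tau>)) powr (- real n / 2) * (1 - 2 * s * \<tau>) powr (- (real N - real n) / 2)"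
    (is "_ \<le> ?B")
proof -
  let ?f = "\<lambda>E x. (\<tau> - 1) * inner_N N x x + 1 * inner_N N (orth_proj N E x) x"
  let ?x = "zero_ext {1..N}"
  have "(\<integral>\<^sup>+g. ennreal (exp (s * ?f E (?x g))) \<partial>gauss {1..N}) \<le> ennreal ?B" if E: "E \<in> space M" for E
  proof -
    obtain e where e: "orthonormal N N e"
      "\<And>x. inner_N N (orth_proj N E x) x = (\<Sum>k<N - n. (inner_N N x (e k))\<^sup>2)"
      using adapted_basis_parseval[OF E[unfolded space_M]] by blast
    have "s * ?f E (?x g) = s * (\<Sum>k\<in>{..<N - n}. (\<Sum>i\<in>{1..N}. e k i * g i)\<^sup>2) - (s * (1 - \<tau>)) * (\<Sum>i\<in>{1..N}. (g i)\<^sup>2)" for g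
      unfolding e(2) inner_zero_ext_self[OF order_refl, symmetric] inner_zero_ext[OF order_refl, symmetric]
      by (simp add: algebra_simps)
    then have "(\<integral>\<^sup>+g. ennreal (exp (s * ?f E (?x g))) \<partial>gauss {1..N})
      = ennreal ((1 + 2 * (s * (1 - \<tau>))) powr (- (real N - real (N - n)) / 2)
        * (1 + 2 * (s * (1 - \<tau>)) - 2 * s) powr (- real (N - n) / 2))"
      using e(1) s unfolding orthonormal_def
      by (simp only:) (subst gauss_quadratic_mgf, auto simp: inner_N_def algebra_simps)
    also have "\<dots> = ennreal ?B" using n_less_N by (simp add: algebra_simps of_nat_diff)
    finally show ?thesis by simp
  qed
  then have "measure M {E \<in> space M. 0 \<le> ?f E x} \<le> ?B"
    using x s by (intro quadratic_form_tail) auto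
  moreover have "?f E x = \<tau> * (norm_N N x)\<^sup>2 - (norm_N N (x - orth_proj N E x))\<^sup>2" if "E \<in> space M" for E
    using norm_orth_proj_residual[OF that[unfolded space_M], of x] norm_N_power2[of N x] by (simp add: algebra_simps)
  then have "{E \<in> space M. 0 \<le> ?f E x} = {E \<in> space M. (norm_N N (x - orth_proj N E x))\<^sup>2 \<le> \<tau> * (norm_N N x)\<^sup>2}"
    by (intro Collect_cong conj_cong refl) (simp only: diff_ge_0_iff_ge)
  ultimately show ?thesis by simp
qed

end

section \<open>Tail bounds for a single vector with explicit constants\<close>

context haar_grassmannian
begin

lemma measurable_residual_set:
  assumes "x \<in> Rn N"
  shows "{E \<in> space M. c < (norm_N N (x - orth_proj N E x))\<^sup>2} \<in> sets M"
    "{E \<in> space M. (norm_N N (x - orth_proj N E x))\<^sup>2 < c} \<in> sets M"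
    "{E \<in> space M. c \<le> (norm_N N (x - orth_proj N E x))\<^sup>2} \<in> sets M"
    "{E \<in> space M. (norm_N N (x - orth_proj N E x))\<^sup>2 \<le> c} \<in> sets M"
proof -
  have [measurable]: "(\<lambda>E. (norm_N N (x - orth_proj N E x))\<^sup>2) \<in> borel_measurable M"
  proof (subst measurable_cong)
    show "(norm_N N (x - orth_proj N E x))\<^sup>2 = inner_N N x x - inner_N N (orth_proj N E x) x" if "E \<in> space M" for E
      using norm_orth_proj_residual that by (auto simp: space_M)
    show "(\<lambda>E. inner_N N x x - inner_N N (orth_proj N E x) x) \<in> borel_measurable M"
      using measurable_inner_orth_proj[OF assms] by measurable
  qed
  show "{E \<in> space M. c < (norm_N N (x - orth_proj N E x))\<^sup>2} \<in> sets M"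
    "{E \<in> space M. (norm_N N (x - orth_proj N E x))\<^sup>2 < c} \<in> sets M"
    "{E \<in> space M. c \<le> (norm_N N (x - orth_proj N E x))\<^sup>2} \<in> sets M"
    "{E \<in> space M. (norm_N N (x - orth_proj N E x))\<^sup>2 \<le> c} \<in> sets M"
    by measurable
qed

text \<open>The Chernoff products at \<open>s = 1/4\<close>. The second base is at least half of the
  first, which costs \<open>2 powr (k / 2)\<close>; the rest is
  \<open>exp (\<tau> / 3) \<le> 1 + \<tau> / 2\<close> on \<open>[0, 1]\<close>.\<close>

lemma chernoff_factor:
  fixes \<tau> k m :: real
  assumes "0 \<le> \<tau>" "\<tau> \<le> 1" "0 \<le> k"  "0 \<le> m"
  shows "(1 + \<tau> / 2) powr (- m / 2) * (1 / 2 + \<tau> / 2) powr (- k / 2) \<le> 2 powr (k / 2) * exp (- \<tau> * (m + k) / 6)"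
proof -
  have "(1 / 2 + \<tau> / 2) powr (- k / 2) \<le> ((1 + \<tau> / 2) / 2) powr (- k / 2)"
    using assms by (intro powr_mono2') auto
  also have "\<dots> = 2 powr (k / 2) * (1 + \<tau> / 2) powr (- k / 2)"
    using assms by (simp add: powr_divide powr_minus_divide)
  finally have "(1 + \<tau> / 2) powr (- m / 2) * (1 / 2 + \<tau> / 2) powr (- k / 2)
      \<le> (1 + \<tau> / 2) powr (- m / 2) * (2 powr (k / 2) * (1 + \<tau> / 2) powr (- k / 2))"
    by (rule mult_left_mono) simp
  then have "(1 + \<tau> / 2) powr (- m / 2) * (1 / 2 + \<tau> / 2) powr (- k / 2)
      \<le> 2 powr (k / 2) * ((1 + \<tau> / 2) powr (- m / 2) * (1 + \<tau> / 2) powr (- k / 2))"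
    by (simp only: mult.left_commute)
  also have "(1 + \<tau> / 2) powr (- m / 2) * (1 + \<tau> / 2) powr (- k / 2) = (1 + \<tau> / 2) powr (- (m + k) / 2)"
    by (simp add: powr_add[symmetric] field_simps)
  also have "\<dots> \<le> exp (\<tau> / 3) powr (- (m + k) / 2)"
  proof (rule powr_mono2')
    have "(\<tau> / 3)\<^sup>2 \<le> \<tau> / 9" using assms mult_left_mono[of \<tau> 1 \<tau>] by (simp add: power2_eq_square)
    then show "exp (\<tau> / 3) \<le> 1 + \<tau> / 2" using exp_bound[of "\<tau> / 3"] assms by simp
  qed (use assms in auto)
  also have "exp (\<tau> / 3) powr (- (m + k) / 2) = exp (- \<tau> * (m + k) / 6)"
    by (simp add: powr_def algebra_simps)
  finally show ?thesis by simp
qed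

lemma residual_upper:
  assumes x: "x \<in> Rn N" and \<tau>: "\<tau> \<ge> 0"
  shows "measure M {E \<in> space M. \<tau> * (norm_N N x)\<^sup>2 < (norm_N N (x - orth_proj N E x))\<^sup>2}
    \<le> 2 powr (real n / 2) * exp (- \<tau> * real N / 6)"
proof (cases "x \<noteq> 0 \<and> \<tau> \<le> 1")
  case True
  have "measure M {E \<in> space M. \<tau> * (norm_N N x)\<^sup>2 < (norm_N N (x - orth_proj N E x))\<^sup>2}
      \<le> measure M {E \<in> space M. \<tau> * (norm_N N x)\<^sup>2 \<le> (norm_N N (x - orth_proj N E x))\<^sup>2}"
    using measurable_residual_set[OF x] by (intro finite_measure_mono) auto
  also have "\<dots> \<le> (1 + 2 * (1 / 4) * \<tau>) powr (- (real N - real n) / 2) * (1 + 2 * (1 / 4) * \<tau> - 2 * (1 / 4)) powr (- real n / 2)"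
    using True \<tau> x by (intro residual_tail) auto
  also have "\<dots> \<le> 2 powr (real n / 2) * exp (- \<tau> * real N / 6)"
    using chernoff_factor[of \<tau> "real n" "real N - real n"] True \<tau> n_less_N by (simp add: mult.commute)
  finally show ?thesis .
next
  case False
  \<comment> \<open>For \<open>\<tau> > 1\<close> the event contradicts that taking residuals is a
    contraction; for \<open>x = 0\<close> it is empty because its inequality is strict.\<close>
  have "{E \<in> space M. \<tau> * (norm_N N x)\<^sup>2 < (norm_N N (x - orth_proj N E x))\<^sup>2} = {}"
  proof safe
    fix E assume E: "E \<in> space M" and less: "\<tau> * (norm_N N x)\<^sup>2 < (norm_N N (x - orth_proj N E x))\<^sup>2"
    have le: "(norm_N N (x - orth_proj N E x))\<^sup>2 \<le> (norm_N N x)\<^sup>2"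
      using norm_orth_proj_residual_le[OF E[unfolded space_M], of x] by (intro power_mono) auto
    have "x = 0 \<or> (norm_N N x)\<^sup>2 \<le> \<tau> * (norm_N N x)\<^sup>2"
      using False mult_right_mono[of 1 \<tau> "(norm_N N x)\<^sup>2"] by auto
    moreover have "x = 0 \<Longrightarrow> norm_N N (x - orth_proj N E x) = 0"
      using orth_proj_zero[OF E[unfolded space_M]] by simp
    ultimately have "(norm_N N (x - orth_proj N E x))\<^sup>2 \<le> \<tau> * (norm_N N x)\<^sup>2"
      using \<tau> order_trans[OF le] by (cases "x = 0") (simp_all only:, simp_all)
    with less show "E \<in> {}" by linarith
  qed
  then show ?thesis by (simp only: measure_empty) simp
qed

text \<open>The choice \<open>s = 1 / (4 * a)\<close> makes
  \<open>2 * s * \<tau> = n / (2 * N)\<close>, so the factor with exponent of order \<open>N\<close>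
  costs only \<open>exp (n / 2)\<close>. The rate per unit of \<open>n\<close> can then be made as
  large as desired by decreasing \<open>a\<close>.\<close>

lemma residual_lower:
  assumes x: "x \<in> Rn N" and a: "0 < a" "a \<le> 1 / 4"
  shows "measure M {E \<in> space M. (norm_N N (x - orth_proj N E x))\<^sup>2 < (a * real n / real N) * (norm_N N x)\<^sup>2}
    \<le> (2 * exp 1 * a) powr (real n / 2)"
proof (cases "x = 0")
  case True
  then show ?thesis by simp
next
  case False
  define u where "u = real n / (2 * real N)"
  have u: "0 \<le> u" "u \<le> 1 / 2" using n_less_N by (auto simp: u_def field_simps)
  define s where "s = 1 / (4 * a)"
  define \<tau> where "\<tau> = a * real n / real N"
  have s\<tau>: "2 * s * \<tau> = u" using a by (simp add: s_def \<tau>_def u_def)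
  have "measure M {E \<in> space M. (norm_N N (x - orth_proj N E x))\<^sup>2 < \<tau> * (norm_N N x)\<^sup>2}
      \<le> measure M {E \<in> space M. (norm_N N (x - orth_proj N E x))\<^sup>2 \<le> \<tau> * (norm_N N x)\<^sup>2}"
    using measurable_residual_set[OF x] by (intro finite_measure_mono) auto
  also have "\<dots> \<le> (1 + 2 * s * (1 - \<tau>)) powr (- real n / 2) * (1 - 2 * s * \<tau>) powr (- (real N - real n) / 2)"
    using False a x u s\<tau> by (intro residual_lower_tail) (auto simp: s_def)
  also have "1 + 2 * s * (1 - \<tau>) = 1 - u + 1 / (2 * a)"
    using s\<tau> a by (simp add: right_diff_distrib) (simp add: s_def)
  also have "(1 - u + 1 / (2 * a)) powr (- real n / 2) * (1 - 2 * s * \<tau>) powr (- (real N - real n) / 2)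
      \<le> (1 / (2 * a)) powr (- real n / 2) * exp (real n / 2)"
  proof (rule mult_mono)
    show "(1 - u + 1 / (2 * a)) powr (- real n / 2) \<le> (1 / (2 * a)) powr (- real n / 2)"
      using a u by (intro powr_mono2') auto
    \<comment> \<open>This identity yields \<open>exp (- 2 * u) \<le> 1 - u\<close> on
      \<open>[0, 1/2]\<close>.\<close>
    have "1 = (1 - u) * (1 + 2 * u) - u * (1 - 2 * u)" by (simp add: algebra_simps)
    also have "\<dots> \<le> (1 - u) * exp (2 * u)"
      using u exp_ge_add_one_self[of "2 * u"] mult_left_mono[of "1 + 2 * u" "exp (2 * u)" "1 - u"]
        mult_nonneg_nonneg[of u "1 - 2 * u"] by linarith
    finally have "exp (- 2 * u) \<le> 1 - u" by (simp add: exp_minus field_simps)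
    then have "(1 - 2 * s * \<tau>) powr (- (real N - real n) / 2) \<le> exp (- 2 * u) powr (- (real N - real n) / 2)"
      unfolding s\<tau> using n_less_N u by (intro powr_mono2') auto
    also have "\<dots> = exp (u * (real N - real n))" by (simp add: powr_def field_simps)
    also have "\<dots> \<le> exp (real n / 2)"
      using n_less_N by (simp add: u_def field_simps)
    finally show "(1 - 2 * s * \<tau>) powr (- (real N - real n) / 2) \<le> exp (real n / 2)" .
  qed auto
  also have "\<dots> = (2 * exp 1 * a) powr (real n / 2)"
    using a by (simp add: powr_mult powr_divide powr_minus field_simps exp_powr_real)
  finally show ?thesis by (simp add: \<tau>_def)
qed

text \<open>A zero projection means that the residual has full norm, which is
  \<open>residual_tail\<close> at \<open>\<tau> = 1\<close>. The bound is then a negative power of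
  \<open>1 + 2 * s\<close>, because \<open>n < N\<close>, and \<open>s\<close> is arbitrary.\<close>

lemma orth_proj_eq_zero_null:
  assumes x: "x \<in> Rn N" "x \<noteq> 0"
  shows "{E \<in> space M. orth_proj N E x = 0} \<in> sets M" "measure M {E \<in> space M. orth_proj N E x = 0} = 0"
proof -
  have eq: "{E \<in> space M. orth_proj N E x = 0} = {E \<in> space M. 1 * (norm_N N x)\<^sup>2 \<le> (norm_N N (x - orth_proj N E x))\<^sup>2}"
  proof -
    have "orth_proj N E x = 0 \<longleftrightarrow> (norm_N N x)\<^sup>2 \<le> (norm_N N (x - orth_proj N E x))\<^sup>2" if "E \<in> space M" for E
      using norm_orth_proj_residual[OF that[unfolded space_M], of x] norm_orth_proj[OF that[unfolded space_M], of x]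
        norm_N_eq_zero_iff[OF orth_proj_Rn[OF that[unfolded space_M], of x]]
      by (simp add: norm_N_power2[of N x]) (metis inner_N_zero(1) norm_N_zero power_zero_numeral zero_eq_power2
          antisym_conv zero_le_power2)
    then show ?thesis by auto
  qed
  show "{E \<in> space M. orth_proj N E x = 0} \<in> sets M"
    unfolding eq by (rule measurable_residual_set[OF x(1)])
  let ?m = "measure M {E \<in> space M. orth_proj N E x = 0}"
  have le: "?m \<le> (1 + 2 * s) powr (- 1 / 2)" if "s \<ge> 0" for s
  proof -
    have "?m \<le> (1 + 2 * s * 1) powr (- (real N - real n) / 2) * (1 + 2 * s * 1 - 2 * s) powr (- real n / 2)"
      unfolding eq using x that by (intro residual_tail) auto
    also have "\<dots> = (1 + 2 * s) powr (- (real N - real n) / 2)" by simp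
    also have "\<dots> \<le> (1 + 2 * s) powr (- 1 / 2)" using that n_less_N by (intro powr_mono) auto
    finally show ?thesis .
  qed
  show "?m = 0"
  proof (rule ccontr)
    assume "?m \<noteq> 0"
    then have m: "0 < ?m" "?m \<le> 1" using measure_nonneg[of M] by (auto simp: less_le)
    \<comment> \<open>With \<open>1 + 2 * s = X\<close> the bound is half of the measure
      itself.\<close>
    define X where "X = (2 / ?m)\<^sup>2"
    have "1 \<le> 2 / ?m" using m by (subst le_divide_eq_1_pos) (linarith+)
    then have "X \<ge> 1" by (simp add: X_def one_le_power)
    then have "?m \<le> X powr (- 1 / 2)" using le[of "(X - 1) / 2"] by (simp add: field_simps)
    also have "\<dots> = ?m / 2" using m unfolding X_def
      by (simp add: powr_minus powr_half_sqrt real_sqrt_divide power_divide flip: minus_divide_left)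
    finally show False using m by simp
  qed
qed

text \<open>Reflections supported in \<open>{2..N}\<close> fix the first unit vector, hence the law
  of its projection is invariant under them, and \<open>y\<close> may be averaged over a Gaussian
  vector on \<open>{2..N}\<close>. For fixed \<open>E\<close> only a rank-one square
  remains.\<close>

lemma coordinate_correlation_tail:
  assumes y: "y \<in> supported {2..N}" and \<tau>: "0 \<le> \<tau>" "\<tau> \<le> 1" and y0: "y \<noteq> 0"
  shows "measure M {E \<in> space M. orth_proj N E (unit_vec 1) \<noteq> 0 \<and>
      \<tau> * (norm_N N (orth_proj N E (unit_vec 1)))\<^sup>2 * (norm_N N y)\<^sup>2 \<le> (inner_N N (orth_proj N E (unit_vec 1)) y)\<^sup>2}
    \<le> sqrt 2 * exp (- \<tau> * (real N - 1) / 6)" (is "measure M ?A \<le> ?B")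
proof -
  let ?z = "\<lambda>E. orth_proj N E (unit_vec 1)"
  let ?I = "{2..N}"
  have N: "2 \<le> N" using n_ge_1 n_less_N by simp
  then have I: "?I \<subseteq> {1..N}" by auto
  have u: "unit_vec 1 \<in> Rn N" using N by (intro unit_vec_Rn) auto
  have Rn: "x \<in> supported ?I \<Longrightarrow> x \<in> Rn N" for x using supported_mono[OF I] by (auto simp: Rn_eq_supported)
  \<comment> \<open>The denominator is the squared norm of \<open>?z E\<close>, in a form that is
    visibly measurable. For \<open>?z E = 0\<close> the quotient is 0 by convention, which is why
    the event demands a nonzero projection.\<close>
  define f where "f E y = (inner_N N (?z E) y)\<^sup>2 / inner_N N (?z E) (unit_vec 1) - \<tau> * inner_N N y y" for E y
  have mz: "(\<lambda>E. inner_N N (?z E) w) \<in> borel_measurable M" for w by (rule measurable_inner_orth_proj[OF u])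
  have inner_zz: "inner_N N (?z E) (unit_vec 1) = (norm_N N (?z E))\<^sup>2" if "E \<in> space M" for E
    using norm_orth_proj that by (simp add: space_M)
  have "measure M {E \<in> space M. f E y \<ge> 0} \<le> ?B"
  proof (rule spherical_average[where I = ?I and s = "1 / 4"])
    have mi: "(\<lambda>g. inner_N N (zero_ext ?I g) (zero_ext ?I g)) \<in> borel_measurable (gauss ?I)"
      unfolding inner_zero_ext_self[OF I] by measurable
    have "inner_N N (?z E) (zero_ext ?I g) = (\<Sum>i\<in>?I. inner_N N (?z E) (unit_vec i) * g i)" for E g
      unfolding inner_N_commute[of N "?z E" "zero_ext ?I g"] inner_zero_ext[OF I]
      using I by (intro sum.cong) (auto simp: inner_N_unit_vec)
    then have mj: "(\<lambda>p. inner_N N (?z (fst p)) (zero_ext ?I (snd p))) \<in> borel_measurable (M \<Otimes>\<^sub>M gauss ?I)"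
      using mz n_ge_1
      by (simp only:) (intro borel_measurable_sum borel_measurable_times, auto intro: measurable_compose[OF measurable_fst mz]
          measurable_compose[OF measurable_snd measurable_gauss_component])
    show "(\<lambda>(E, g). f E (zero_ext ?I g)) \<in> borel_measurable (M \<Otimes>\<^sub>M gauss ?I)"
      unfolding f_def case_prod_beta' using mi mj mz by measurable
    show "(\<lambda>E. f E y) \<in> borel_measurable M" for y
      unfolding f_def using mz by measurable
    show "f (reflect N v ` E) (reflect N v y) = f E y"
      if E: "E \<in> space M" and v: "v \<in> supported ?I" and "y \<in> supported ?I" for E v y
    proof -
      have "inner_N N (unit_vec 1) v = 0"
        using v N inner_N_unit_vec[of 1 N v] by (simp add: inner_N_commute supported_def)
      then have fix1: "reflect N v (unit_vec 1) = unit_vec 1" by (simp add: reflect_def fscale_def fun_eq_iff fun_apply)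
      have "?z (reflect N v ` E) = reflect N v (?z E)"
        using orth_proj_reflect[OF E[unfolded space_M] Rn[OF v], of "unit_vec 1"] fix1 by simp
      then have "inner_N N (?z (reflect N v ` E)) (reflect N v y) = inner_N N (?z E) y"
        "inner_N N (?z (reflect N v ` E)) (unit_vec 1) = inner_N N (?z E) (unit_vec 1)"
        using inner_reflect[of N v "?z E" "unit_vec 1"] unfolding fix1 by (simp_all add: inner_reflect)
      then show ?thesis by (simp add: f_def inner_reflect)
    qed
    show "f E (fscale c y) = c\<^sup>2 * f E y" for E c y
      by (simp add: f_def inner_N_scale_left inner_N_scale_right power2_eq_square algebra_simps)
    show "(\<integral>\<^sup>+g. ennreal (exp (1 / 4 * f E (zero_ext ?I g))) \<partial>gauss ?I) \<le> ennreal ?B" if E: "E \<in> space M" for E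
    proof -
      \<comment> \<open>Only the part of the projection on \<open>{2..N}\<close> meets the Gaussian
        vector. Its unit direction \<open>v\<close> below is arbitrary when this part
        vanishes.\<close>
      define z where "z = zero_ext ?I (?z E)"
      have zz: "inner_N N z z \<le> inner_N N (?z E) (unit_vec 1)"
        unfolding z_def inner_zero_ext_self[OF I] inner_zz[OF E] unfolding norm_N_power2
        unfolding inner_N_def power2_eq_square using I by (intro sum_mono2) auto
      obtain v where v: "v \<in> supported ?I" "inner_N N v v = 1" "z = fscale (norm_N N z) v"
      proof (cases "z = 0")
        case True
        show thesis using N by (intro that[of "unit_vec 2"])
          (auto simp: True supported_def inner_N_unit_vec, auto simp: unit_vec_def fscale_def fun_eq_iff fun_apply)
      next
        case False
        then have nz: "norm_N N z \<noteq> 0" using norm_N_eq_zero_iff[of z N] Rn[of z] by (simp add: z_def)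
        show thesis
        proof (rule that[of "fscale (1 / norm_N N z) z"])
          show "fscale (1 / norm_N N z) z \<in> supported ?I" by (intro supported_scale) (simp add: z_def)
          show "inner_N N (fscale (1 / norm_N N z) z) (fscale (1 / norm_N N z) z) = 1"
            using nz by (simp add: inner_N_scale_left inner_N_scale_right norm_N_power2[of N z, symmetric] power2_eq_square)
          show "z = fscale (norm_N N z) (fscale (1 / norm_N N z) z)"
            using nz by (simp add: fscale_def)
        qed
      qed
      have f_le: "f E (zero_ext ?I g) \<le> (\<Sum>k\<in>{0::nat}. (\<Sum>i\<in>?I. v i * g i)\<^sup>2) - \<tau> * (\<Sum>i\<in>?I. (g i)\<^sup>2)" for g
      proof -
        have "inner_N N (?z E) (zero_ext ?I g) = inner_N N z (zero_ext ?I g)"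
          unfolding inner_N_commute[of N _ "zero_ext ?I g"] inner_zero_ext[OF I] z_def
          by (intro sum.cong) (auto simp: zero_ext_def)
        also have "\<dots> = norm_N N z * (\<Sum>i\<in>?I. v i * g i)"
          by (subst v(3)) (simp add: inner_N_scale_left inner_N_commute[of N v] inner_zero_ext[OF I])
        finally have "(inner_N N (?z E) (zero_ext ?I g))\<^sup>2 = inner_N N z z * (\<Sum>i\<in>?I. v i * g i)\<^sup>2"
          by (simp add: power_mult_distrib norm_N_power2)
        also have "\<dots> \<le> inner_N N (?z E) (unit_vec 1) * (\<Sum>i\<in>?I. v i * g i)\<^sup>2"
          by (intro mult_right_mono zz) auto
        finally have "(inner_N N (?z E) (zero_ext ?I g))\<^sup>2 / inner_N N (?z E) (unit_vec 1) \<le> (\<Sum>i\<in>?I. v i * g i)\<^sup>2"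
          using inner_zz[OF E] by (cases "inner_N N (?z E) (unit_vec 1) = 0") (auto simp: field_simps divide_le_eq)
        then show ?thesis unfolding f_def inner_zero_ext_self[OF I] by simp
      qed
      have vv: "(\<Sum>i\<in>?I. v i * v i) = 1"
        using v(1,2) I unfolding inner_N_def supported_def
        by (subst sum.mono_neutral_left[of "{1..N}"]) auto
      have "(\<integral>\<^sup>+g. ennreal (exp (1 / 4 * f E (zero_ext ?I g))) \<partial>gauss ?I)
        \<le> (\<integral>\<^sup>+g. ennreal (exp (1 / 4 * (\<Sum>k\<in>{0::nat}. (\<Sum>i\<in>?I. v i * g i)\<^sup>2) - (\<tau> / 4) * (\<Sum>i\<in>?I. (g i)\<^sup>2))) \<partial>gauss ?I)"
      proof (intro nn_integral_mono ennreal_leI iffD2[OF exp_le_cancel_iff])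
        show "1 / 4 * f E (zero_ext ?I g) \<le> 1 / 4 * (\<Sum>k\<in>{0::nat}. (\<Sum>i\<in>?I. v i * g i)\<^sup>2) - (\<tau> / 4) * (\<Sum>i\<in>?I. (g i)\<^sup>2)" for g
          using f_le[of g] by simp
      qed
      also have "\<dots> = ennreal ((1 + 2 * (\<tau> / 4)) powr (- (real (card ?I) - real (card {0::nat})) / 2)
          * (1 + 2 * (\<tau> / 4) - 2 * (1 / 4)) powr (- real (card {0::nat}) / 2))"
        using \<tau> vv by (intro gauss_quadratic_mgf) auto
      also have "\<dots> \<le> ennreal ?B"
      proof (rule ennreal_leI)
        have e: "1 + 2 * (\<tau> / 4) - 2 * (1 / 4) = 1 / 2 + \<tau> / 2" "1 + 2 * (\<tau> / 4) = 1 + \<tau> / 2"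
          "real (card ?I) - real (card {0::nat}) = real N - 2" "real (card {0::nat}) = 1"
          using N by auto
        have "sqrt 2 * exp (- \<tau> * ((real N - 2) + 1) / 6) = ?B" by simp
        then show "(1 + 2 * (\<tau> / 4)) powr (- (real (card ?I) - real (card {0::nat})) / 2)
            * (1 + 2 * (\<tau> / 4) - 2 * (1 / 4)) powr (- real (card {0::nat}) / 2) \<le> ?B"
          unfolding e using chernoff_factor[of \<tau> 1 "real N - 2"] \<tau> N by (simp add: powr_half_sqrt)
      qed
      finally show ?thesis .
    qed
  qed (use y y0 in auto)
  moreover have "measure M ?A \<le> measure M {E \<in> space M. f E y \<ge> 0}"
  proof (rule finite_measure_mono)
    show "?A \<subseteq> {E \<in> space M. f E y \<ge> 0}"
    proof safe
      fix E assume E: "E \<in> space M" "?z E \<noteq> 0"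
        and le: "\<tau> * (norm_N N (?z E))\<^sup>2 * (norm_N N y)\<^sup>2 \<le> (inner_N N (?z E) y)\<^sup>2"
      have "norm_N N (?z E) > 0"
        using norm_N_eq_zero_iff[OF orth_proj_Rn[OF E(1)[unfolded space_M]], of "unit_vec 1"] E(2) norm_N_nonneg[of N "?z E"] by linarith
      then show "0 \<le> f E y" using le unfolding f_def inner_zz[OF E(1)] norm_N_power2[of N y] by (simp add: field_simps)
    qed
    show "{E \<in> space M. f E y \<ge> 0} \<in> sets M" unfolding f_def using mz by measurable
  qed
  ultimately show ?thesis by simp
qed

end

section \<open>Nets and operator norms\<close>

lemma sum_half_power_abs:
  "(\<Sum>y\<in>{- int L..int L}. (1 / 2 :: real) ^ nat \<bar>y\<bar>) = 3 - 2 * (1 / 2) ^ L"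
proof (induction L)
  case (Suc L)
  have "{- int (Suc L)..int (Suc L)} = insert (int (Suc L)) (insert (- int (Suc L)) {- int L..int L})" by auto
  moreover have "nat \<bar>- int (Suc L)\<bar> = Suc L" "nat \<bar>int (Suc L)\<bar> = Suc L" by linarith+
  ultimately show ?case using Suc by (simp only: sum.insert finite_insert finite_atLeastAtMost_int) simp
qed simp

text \<open>Counting lattice points by a Chernoff bound: each point of the set has weight at least
  \<open>2\<^sup>-\<^sup>L\<close> under the product weight \<open>2 ^ - \<bar>m i\<bar>\<close>, whose total mass is at most \<open>3\<close> per coordinate.\<close>

lemma card_lattice_points:
  assumes "finite S"
  shows "real (card {m \<in> PiE S (\<lambda>_. {- int L..int L}). (\<Sum>i\<in>S. \<bar>m i\<bar>) \<le> int L}) \<le> 2 ^ L * 3 ^ card S"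
proof -
  let ?P = "PiE S (\<lambda>_. {- int L..int L})"
  let ?A = "{m \<in> ?P. (\<Sum>i\<in>S. \<bar>m i\<bar>) \<le> int L}"
  let ?w = "\<lambda>m. \<Prod>i\<in>S. (1 / 2 :: real) ^ nat \<bar>m i\<bar>"
  have fin: "finite ?P" using assms by (intro finite_PiE) auto
  have "(1 / 2) ^ L \<le> ?w m" if "m \<in> ?A" for m
  proof -
    have "int (\<Sum>i\<in>S. nat \<bar>m i\<bar>) = (\<Sum>i\<in>S. \<bar>m i\<bar>)" by (simp add: of_nat_sum)
    moreover have "(\<Sum>i\<in>S. \<bar>m i\<bar>) \<le> int L" using that by blast
    ultimately have "(\<Sum>i\<in>S. nat \<bar>m i\<bar>) \<le> L" by (metis of_nat_le_iff)
    then have "(1 / 2 :: real) ^ L \<le> (1 / 2) ^ (\<Sum>i\<in>S. nat \<bar>m i\<bar>)" by (intro power_decreasing) auto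
    then show ?thesis by (simp only: power_sum)
  qed
  then have "(\<Sum>m\<in>?A. (1 / 2 :: real) ^ L) \<le> (\<Sum>m\<in>?A. ?w m)" by (intro sum_mono) auto
  then have "real (card ?A) * (1 / 2) ^ L \<le> (\<Sum>m\<in>?A. ?w m)" by simp
  also have "\<dots> \<le> (\<Sum>m\<in>?P. ?w m)" using fin by (intro sum_mono2) (auto intro: prod_nonneg)
  also have "\<dots> = (\<Prod>i\<in>S. \<Sum>y\<in>{- int L..int L}. (1 / 2 :: real) ^ nat \<bar>y\<bar>)"
    using assms by (subst prod_sum_PiE) auto
  also have "\<dots> = (3 - 2 * (1 / 2) ^ L) ^ card S" unfolding sum_half_power_abs by simp
  also have "\<dots> \<le> 3 ^ card S"
  proof (rule power_mono)
    have "(1 / 2 :: real) ^ L \<le> 1" by (rule power_le_one) auto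
    then show "0 \<le> 3 - 2 * (1 / 2 :: real) ^ L" by simp
  qed simp
  finally show ?thesis by (simp add: field_simps power_divide)
qed

lemma norm_N_supported:
  assumes "S \<subseteq> {1..N}" "x \<in> supported S"
  shows "norm_N N x = L2_set x S"
  unfolding norm_N_def L2_set_def using assms
  by (intro arg_cong[of _ _ sqrt] sum.mono_neutral_right) (auto simp: supported_def)

lemma sum_abs_le_norm_N:
  assumes "S \<subseteq> {1..N}" "x \<in> supported S"
  shows "(\<Sum>i\<in>S. \<bar>x i\<bar>) \<le> sqrt (card S) * norm_N N x"
proof -
  have "(\<Sum>i\<in>S. \<bar>x i\<bar> * \<bar>1\<bar>) \<le> L2_set x S * L2_set (\<lambda>_. 1) S" by (rule L2_set_mult_ineq)
  then show ?thesis using norm_N_supported[OF assms] by (simp add: L2_set_def mult.commute)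
qed

text \<open>The net is the part in the unit ball of a grid of mesh \<open>1 / q\<close>, where
  \<open>q = j * sqrt k\<close> and \<open>k = card S\<close>. In grid units a unit vector has l1
  norm at most \<open>q * sqrt k = j * k\<close>, which is the \<open>L\<close> in
  \<open>card_lattice_points\<close>.\<close>

lemma lattice_net:
  assumes S: "S \<subseteq> {1..N}" and j: "j \<ge> (1 :: nat)"
  obtains Z where "finite Z" "real (card Z) \<le> (3 * 2 ^ j) ^ card S" "Z \<subseteq> supported S"
    "\<And>z. z \<in> Z \<Longrightarrow> norm_N N z \<le> 1"
    "\<And>x. x \<in> supported S \<Longrightarrow> norm_N N x \<le> 1 \<Longrightarrow> \<exists>z\<in>Z. norm_N N (x - z) \<le> 1 / j"
proof (cases "S = {}")
  case True
  then have "supported S = {0}" by (auto simp: supported_def fun_eq_iff fun_apply)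
  then show thesis using True by (intro that[of "{0}"]) auto
next
  case False
  have finS: "finite S" using S finite_subset by blast
  define k where "k = card S"
  have k: "k \<ge> 1" using False finS by (simp add: k_def Suc_le_eq card_gt_0_iff)
  define q where "q = real j * sqrt k"
  have q: "q > 0" using j k by (simp add: q_def)
  define L where "L = j * k"
  let ?A = "{m \<in> PiE S (\<lambda>_. {- int L..int L}). (\<Sum>i\<in>S. \<bar>m i\<bar>) \<le> int L}"
  have finA: "finite ?A" using finS by (intro finite_subset[OF _ finite_PiE[of S "\<lambda>_. {- int L..int L}"]]) auto
  define enc where "enc m = (\<lambda>i. if i \<in> S then real_of_int (m i) / q else 0)" for m :: "nat \<Rightarrow> int"
  define Z where "Z = {z \<in> enc ` ?A. norm_N N z \<le> 1}"
  show thesis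
  proof (rule that[of Z])
    show "finite Z" using finA by (simp add: Z_def)
    have "card Z \<le> card (enc ` ?A)" unfolding Z_def using finA by (intro card_mono) auto
    also have "\<dots> \<le> card ?A" using finA by (rule card_image_le)
    finally have "real (card Z) \<le> 2 ^ L * 3 ^ card S" using card_lattice_points[OF finS, of L] by linarith
    then show "real (card Z) \<le> (3 * 2 ^ j) ^ card S"
      by (simp add: L_def k_def power_mult power_mult_distrib mult.commute)
    show "Z \<subseteq> supported S" by (auto simp: Z_def enc_def supported_def)
    show "norm_N N z \<le> 1" if "z \<in> Z" for z using that by (simp add: Z_def)
    show "\<exists>z\<in>Z. norm_N N (x - z) \<le> 1 / j" if x: "x \<in> supported S" "norm_N N x \<le> 1" for x
    proof -
      \<comment> \<open>Rounding toward zero increases neither the norm nor the l1 norm, so the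
        rounded point stays in the net. Errors of \<open>1 / q\<close> in \<open>k\<close>
        coordinates add up to \<open>1 / j\<close>.\<close>
      define m where "m = (\<lambda>i\<in>S. if x i \<ge> 0 then \<lfloor>q * x i\<rfloor> else \<lceil>q * x i\<rceil>)"
      have m_le: "\<bar>real_of_int (m i)\<bar> \<le> q * \<bar>x i\<bar>" and m_near: "\<bar>q * x i - m i\<bar> \<le> 1" if "i \<in> S" for i
      proof -
        have "\<bar>real_of_int (m i)\<bar> \<le> q * \<bar>x i\<bar> \<and> \<bar>q * x i - m i\<bar> \<le> 1"
        proof (cases "x i \<ge> 0")
          case True
          then have "0 \<le> \<lfloor>q * x i\<rfloor>" using q by simp
          then show ?thesis using True that by (simp add: m_def) linarith
        next
          case False
          then have "q * x i < 0" using q by (simp add: mult_pos_neg)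
          then have "\<lceil>q * x i\<rceil> \<le> 0" by simp
          then show ?thesis using False that by (simp add: m_def) linarith
        qed
        then show "\<bar>real_of_int (m i)\<bar> \<le> q * \<bar>x i\<bar>" "\<bar>q * x i - m i\<bar> \<le> 1" by auto
      qed
      have "real_of_int (\<Sum>i\<in>S. \<bar>m i\<bar>) \<le> (\<Sum>i\<in>S. q * \<bar>x i\<bar>)" using m_le by (simp add: sum_mono)
      also have "\<dots> = q * (\<Sum>i\<in>S. \<bar>x i\<bar>)" by (simp add: sum_distrib_left)
      also have "\<dots> \<le> q * (sqrt k * 1)"
        using sum_abs_le_norm_N[OF S x(1)] x(2) q mult_left_mono[OF x(2), of "sqrt k"]
        by (intro mult_left_mono) (auto simp: k_def)
      also have "\<dots> = real_of_int (int L)" by (simp add: q_def L_def)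
      finally have m_sum: "(\<Sum>i\<in>S. \<bar>m i\<bar>) \<le> int L" by (simp only: of_int_le_iff)
      have "\<bar>m i\<bar> \<le> int L" if "i \<in> S" for i
        using member_le_sum[of i S "\<lambda>i. \<bar>m i\<bar>"] that finS m_sum by auto
      then have mA: "m \<in> ?A" using m_sum by (auto simp: m_def abs_le_iff minus_le_iff)
      define z where "z = enc m"
      have z: "z \<in> supported S" by (auto simp: z_def enc_def supported_def)
      have "norm_N N z \<le> norm_N N x"
        unfolding norm_N_supported[OF S z] norm_N_supported[OF S x(1)]
        unfolding L2_set_def
      proof (intro real_sqrt_le_mono sum_mono)
        fix i assume "i \<in> S"
        then have "\<bar>z i\<bar> \<le> \<bar>x i\<bar>" using m_le[of i] q by (simp add: z_def enc_def abs_divide field_simps)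
        then show "(z i)\<^sup>2 \<le> (x i)\<^sup>2" by (simp add: abs_le_square_iff)
      qed
      then have "z \<in> Z" using mA x(2) by (auto simp: Z_def z_def)
      moreover have "norm_N N (x - z) \<le> 1 / j"
        unfolding norm_N_supported[OF S supported_diff[OF x(1) z]] L2_set_def
      proof (rule real_le_lsqrt)
        have "(\<Sum>i\<in>S. ((x - z) i)\<^sup>2) \<le> (\<Sum>i\<in>S. 1 / q\<^sup>2)"
        proof (intro sum_mono)
          fix i assume "i \<in> S"
          then have "\<bar>(x - z) i\<bar> = \<bar>q * x i - m i\<bar> / q"
            using q by (simp add: z_def enc_def fun_apply abs_divide[symmetric] diff_divide_distrib abs_of_pos flip: abs_divide)
              (metis abs_divide abs_of_pos diff_divide_distrib nonzero_mult_div_cancel_left less_irrefl)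
          also have "\<dots> \<le> 1 / q" using m_near[OF \<open>i \<in> S\<close>] q by (simp add: divide_right_mono)
          finally have "\<bar>(x - z) i\<bar>\<^sup>2 \<le> (1 / q)\<^sup>2" by (intro power_mono) auto
          then show "((x - z) i)\<^sup>2 \<le> 1 / q\<^sup>2" by (simp add: power_divide)
        qed
        also have "\<dots> = (1 / j)\<^sup>2" using k j by (simp add: q_def k_def power_mult_distrib power_divide)
        finally show "(\<Sum>i\<in>S. ((x - z) i)\<^sup>2) \<le> (1 / j)\<^sup>2" .
      qed (auto intro: sum_nonneg)
      ultimately show ?thesis by blast
    qed
  qed
qed

context haar_grassmannian
begin

lemma residual_triangle:
  assumes "E \<in> space M"
  shows "norm_N N (x - orth_proj N E x) \<le> norm_N N (y - orth_proj N E y) + norm_N N ((x - y) - orth_proj N E (x - y))"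
proof -
  have "x - orth_proj N E x = (y - orth_proj N E y) + ((x - y) - orth_proj N E (x - y))"
    using orth_proj_diff[OF assms[unfolded space_M], of x y] by simp
  then show ?thesis using norm_N_triangle[of N] by metis
qed

lemma residual_scale:
  assumes "E \<in> space M"
  shows "norm_N N (fscale c x - orth_proj N E (fscale c x)) = \<bar>c\<bar> * norm_N N (x - orth_proj N E x)"
proof -
  have "fscale c x - orth_proj N E (fscale c x) = fscale c (x - orth_proj N E x)"
    using orth_proj_scale[OF assms[unfolded space_M], of c x] by (simp add: fscale_def fun_eq_iff fun_apply algebra_simps)
  then show ?thesis by (simp add: norm_N_scale)
qed

lemma normalise:
  assumes "x \<in> Rn N" "x \<noteq> 0"
  obtains u where "norm_N N u = 1" "x = fscale (norm_N N x) u" "u = fscale (1 / norm_N N x) x"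
proof -
  have "norm_N N x \<noteq> 0" using norm_N_eq_zero_iff assms by blast
  then have "norm_N N (fscale (1 / norm_N N x) x) = 1" by (simp add: norm_N_scale)
  moreover have "x = fscale (norm_N N x) (fscale (1 / norm_N N x) x)"
    using \<open>norm_N N x \<noteq> 0\<close> by (simp add: fscale_def)
  ultimately show thesis using that by blast
qed

text \<open>A net of mesh \<open>1/2\<close> (whence \<open>12 = 3 * 2 ^ 2\<close>) determines the
  operator norm up to the factor 2, and the union bound over it multiplies the single-vector tail by
  the size of the net.\<close>

lemma residual_operator_norm:
  assumes S: "S \<subseteq> {1..N}" and \<tau>: "\<tau> \<ge> 0"
  obtains A where "A \<in> sets M" "measure M A \<le> 12 ^ card S * (2 powr (real n / 2) * exp (- \<tau> * real N / 6))"
    "\<And>E x. E \<in> space M \<Longrightarrow> E \<notin> A \<Longrightarrow> x \<in> supported S \<Longrightarrow>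
      norm_N N (x - orth_proj N E x) \<le> 2 * sqrt \<tau> * norm_N N x"
proof -
  have Rn: "x \<in> Rn N" if "x \<in> supported S" for x using supported_mono[OF S] that by (auto simp: Rn_eq_supported)
  obtain Z where Z: "finite Z" "real (card Z) \<le> (3 * 2 ^ 2) ^ card S" "Z \<subseteq> supported S"
    "\<And>z. z \<in> Z \<Longrightarrow> norm_N N z \<le> 1"
    "\<And>x. x \<in> supported S \<Longrightarrow> norm_N N x \<le> 1 \<Longrightarrow> \<exists>z\<in>Z. norm_N N (x - z) \<le> 1 / real 2"
    using lattice_net[OF S, of 2] by auto
  define B where "B z = {E \<in> space M. \<tau> * (norm_N N z)\<^sup>2 < (norm_N N (z - orth_proj N E z))\<^sup>2}" for z
  have B: "B z \<in> sets M" if "z \<in> Z" for z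
    unfolding B_def using that Z(3) by (intro measurable_residual_set Rn) auto
  show thesis
  proof (rule that[of "\<Union>z\<in>Z. B z"])
    show "(\<Union>z\<in>Z. B z) \<in> sets M" using B Z(1) by auto
    have "measure M (\<Union>z\<in>Z. B z) \<le> (\<Sum>z\<in>Z. measure M (B z))"
      using B Z(1) by (intro finite_measure_subadditive_finite) auto
    also have "\<dots> \<le> (\<Sum>z\<in>Z. 2 powr (real n / 2) * exp (- \<tau> * real N / 6))"
      unfolding B_def using Z(3) \<tau> by (intro sum_mono residual_upper Rn) auto
    also have "\<dots> \<le> 12 ^ card S * (2 powr (real n / 2) * exp (- \<tau> * real N / 6))"
      using Z(2) by (simp add: mult_right_mono)
    finally show "measure M (\<Union>z\<in>Z. B z) \<le> \<dots>" .
    fix E x assume E: "E \<in> space M" "E \<notin> (\<Union>z\<in>Z. B z)" and x: "x \<in> supported S"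
    let ?r = "\<lambda>x. norm_N N (x - orth_proj N E x)"
    have net: "?r z \<le> sqrt \<tau>" if "z \<in> Z" for z
    proof (rule power2_le_imp_le)
      have "(?r z)\<^sup>2 \<le> \<tau> * (norm_N N z)\<^sup>2" using E that by (auto simp: B_def)
      also have "\<dots> \<le> \<tau> * 1" using Z(4)[OF that] \<tau> by (intro mult_left_mono power_le_one) auto
      finally show "(?r z)\<^sup>2 \<le> (sqrt \<tau>)\<^sup>2" using \<tau> by simp
    qed (use \<tau> in auto)
    \<comment> \<open>Instead of a supremum over the sphere, the trivial bound 1 is improved
      repeatedly: approximation by a net point halves the excess over
      \<open>2 * sqrt \<tau>\<close>.\<close>
    have "\<forall>x\<in>supported S. ?r x \<le> (2 * sqrt \<tau> + (1 / 2) ^ l) * norm_N N x" for l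
    proof (induction l)
      case 0
      have "?r x \<le> norm_N N x" for x using norm_orth_proj_residual_le E by (simp add: space_M)
      then show ?case using \<tau> by (auto simp: distrib_right intro!: add_increasing)
    next
      case (Suc l)
      show ?case
      proof
        fix x assume x: "x \<in> supported S"
        show "?r x \<le> (2 * sqrt \<tau> + (1 / 2) ^ Suc l) * norm_N N x"
        proof (cases "x = 0")
          case True
          then show ?thesis using norm_orth_proj_residual_le[of E N n x] E by (simp add: space_M)
        next
          case False
          obtain u where u: "norm_N N u = 1" "x = fscale (norm_N N x) u" "u = fscale (1 / norm_N N x) x"
            using normalise[OF Rn[OF x] False] by metis
          have us: "u \<in> supported S" unfolding u(3) by (intro supported_scale x)
          obtain z where z: "z \<in> Z" "norm_N N (u - z) \<le> 1 / 2" using Z(5)[OF us] u(1) by auto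
          have "u - z \<in> supported S" using us z(1) Z(3) by (intro supported_diff) auto
          then have "?r (u - z) \<le> (2 * sqrt \<tau> + (1 / 2) ^ l) * norm_N N (u - z)" using Suc by blast
          also have "\<dots> \<le> (2 * sqrt \<tau> + (1 / 2) ^ l) * (1 / 2)"
            using z(2) \<tau> by (intro mult_left_mono) auto
          finally have "?r u \<le> 2 * sqrt \<tau> + (1 / 2) ^ Suc l"
            using residual_triangle[OF E(1), of u z] net[OF z(1)] by (simp add: algebra_simps)
          then have "norm_N N x * ?r u \<le> norm_N N x * (2 * sqrt \<tau> + (1 / 2) ^ Suc l)"
            by (intro mult_left_mono) auto
          moreover have "?r x = norm_N N x * ?r u"
            using residual_scale[OF E(1), of "norm_N N x" u] u(2) by simp
          ultimately show ?thesis by (simp add: mult.commute)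
        qed
      qed
    qed
    then have le: "?r x \<le> (2 * sqrt \<tau> + (1 / 2) ^ l) * norm_N N x" for l using x by blast
    have "(\<lambda>l. (2 * sqrt \<tau> + (1 / 2) ^ l) * norm_N N x) \<longlonglongrightarrow> (2 * sqrt \<tau> + 0) * norm_N N x"
      by (intro tendsto_intros LIMSEQ_power_zero) auto
    then show "?r x \<le> 2 * sqrt \<tau> * norm_N N x"
      using LIMSEQ_le_const[of _ "2 * sqrt \<tau> * norm_N N x" "?r x"] le by auto
  qed
qed

text \<open>A lower bound does not pass from a net to the sphere by itself: the error term needs an
  upper bound \<open>K\<close>, and \<open>K / j\<close> is lost. \<open>K\<close> is quantified
  after the event, so that any upper bound valid for the given \<open>E\<close> can be
  inserted.\<close>

lemma residual_lower_operator_bound: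
  fixes a :: real
  assumes S: "S \<subseteq> {1..N}" and a: "0 < a" "a \<le> 1 / 4" and j: "j \<ge> 1"
  obtains A where "A \<in> sets M" "measure M A \<le> (3 * 2 ^ j) ^ card S * (2 * exp 1 * a) powr (real n / 2)"
    "\<And>E K x. E \<in> space M \<Longrightarrow> E \<notin> A \<Longrightarrow>
      \<forall>x\<in>supported S. norm_N N (x - orth_proj N E x) \<le> K * norm_N N x \<Longrightarrow> K \<ge> 0 \<Longrightarrow> x \<in> supported S \<Longrightarrow>
      (sqrt (a * n / N) * (1 - 1 / j) - K / j) * norm_N N x \<le> norm_N N (x - orth_proj N E x)"
proof -
  have Rn: "x \<in> Rn N" if "x \<in> supported S" for x using supported_mono[OF S] that by (auto simp: Rn_eq_supported)
  obtain Z where Z: "finite Z" "real (card Z) \<le> (3 * 2 ^ j) ^ card S" "Z \<subseteq> supported S"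
    "\<And>z. z \<in> Z \<Longrightarrow> norm_N N z \<le> 1"
    "\<And>x. x \<in> supported S \<Longrightarrow> norm_N N x \<le> 1 \<Longrightarrow> \<exists>z\<in>Z. norm_N N (x - z) \<le> 1 / real j"
    using lattice_net[OF S j] by auto
  let ?t = "a * real n / real N"
  define B where "B z = {E \<in> space M. (norm_N N (z - orth_proj N E z))\<^sup>2 < ?t * (norm_N N z)\<^sup>2}" for z
  have B: "B z \<in> sets M" if "z \<in> Z" for z
    unfolding B_def using that Z(3) by (intro measurable_residual_set Rn) auto
  show thesis
  proof (rule that[of "\<Union>z\<in>Z. B z"])
    show "(\<Union>z\<in>Z. B z) \<in> sets M" using B Z(1) by auto
    have "measure M (\<Union>z\<in>Z. B z) \<le> (\<Sum>z\<in>Z. measure M (B z))"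
      using B Z(1) by (intro finite_measure_subadditive_finite) auto
    also have "\<dots> \<le> (\<Sum>z\<in>Z. (2 * exp 1 * a) powr (real n / 2))"
      unfolding B_def using Z(3) a by (intro sum_mono residual_lower Rn) auto
    also have "\<dots> \<le> (3 * 2 ^ j) ^ card S * (2 * exp 1 * a) powr (real n / 2)"
      using Z(2) by (simp add: mult_right_mono)
    finally show "measure M (\<Union>z\<in>Z. B z) \<le> \<dots>" .
    fix E K x assume E: "E \<in> space M" "E \<notin> (\<Union>z\<in>Z. B z)" and x: "x \<in> supported S" and K: "K \<ge> 0"
      and up: "\<forall>x\<in>supported S. norm_N N (x - orth_proj N E x) \<le> K * norm_N N x"
    let ?r = "\<lambda>x. norm_N N (x - orth_proj N E x)"
    show "(sqrt (a * n / N) * (1 - 1 / j) - K / j) * norm_N N x \<le> ?r x"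
    proof (cases "x = 0")
      case True
      then show ?thesis by simp
    next
      case False
      obtain u where u: "norm_N N u = 1" "x = fscale (norm_N N x) u" "u = fscale (1 / norm_N N x) x"
        using normalise[OF Rn[OF x] False] by metis
      have us: "u \<in> supported S" unfolding u(3) by (intro supported_scale x)
      obtain z where z: "z \<in> Z" "norm_N N (u - z) \<le> 1 / j" using Z(5)[OF us] u(1) by auto
      have uz: "z - u \<in> supported S" using us z(1) Z(3) by (intro supported_diff) auto
      have "?t * (norm_N N z)\<^sup>2 \<le> (?r z)\<^sup>2" using E z(1) by (auto simp: B_def)
      then have "sqrt (?t * (norm_N N z)\<^sup>2) \<le> sqrt ((?r z)\<^sup>2)" by (rule real_sqrt_le_mono)
      then have "sqrt ?t * norm_N N z \<le> ?r z"
        by (simp only: real_sqrt_mult real_sqrt_abs abs_of_nonneg norm_N_nonneg)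
      moreover have "1 - 1 / j \<le> norm_N N z"
        using norm_N_triangle_le[of N u z] z(2) u(1) by simp
      then have "sqrt ?t * (1 - 1 / j) \<le> sqrt ?t * norm_N N z" using a by (intro mult_left_mono) auto
      moreover have "?r (z - u) \<le> K / j"
        using bspec[OF up uz] mult_left_mono[OF z(2) K] by (simp add: norm_N_minus_commute[of N z u])
      ultimately have "sqrt ?t * (1 - 1 / j) - K / j \<le> ?r u"
        using residual_triangle[OF E(1), of z u] by simp
      then have "norm_N N x * (sqrt ?t * (1 - 1 / j) - K / j) \<le> norm_N N x * ?r u" by (intro mult_left_mono) auto
      moreover have "?r x = norm_N N x * ?r u"
        using residual_scale[OF E(1), of "norm_N N x" u] u(2) by simp
      ultimately show ?thesis by (simp only: mult.commute)
    qed
  qed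
qed

end

section \<open>Exceptional events\<close>

lemma exp_1_ge: "exp (1 :: real) \<ge> 5 / 2"
  using exp_lower_Taylor_quadratic[of 1] by simp

lemma exp_of_nat_ge: "(5 / 2) ^ m \<le> exp (real m)"
  using power_mono[OF exp_1_ge, of m] by (simp flip: exp_of_nat_mult)

lemma geometric_tail_le:
  fixes r :: real
  assumes "0 \<le> r" "r \<le> 1 / 2"
  shows "(\<Sum>b=n..N. r ^ b) \<le> 2 * r ^ n"
proof (cases "n \<le> N")
  case True
  have "(\<Sum>b=n..N. r ^ b) * (1 - r) = r ^ n - r ^ Suc N"
    using sum_gp_multiplied[OF True, of r] by (simp add: mult.commute)
  also have "\<dots> \<le> r ^ n" using assms by simp
  finally have "(\<Sum>b=n..N. r ^ b) * (1 - r) \<le> r ^ n" .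
  moreover have "(\<Sum>b=n..N. r ^ b) * (1 / 2) \<le> (\<Sum>b=n..N. r ^ b) * (1 - r)"
    using assms by (intro mult_left_mono) (auto intro: sum_nonneg)
  ultimately show ?thesis by simp
qed (use assms in auto)

text \<open>A single term of the expansion of \<open>(1 + x) ^ N\<close>. The free \<open>x\<close>
  balances the two factors: a fixed \<open>x\<close> serves for sets of proportional size, and
  \<open>x = k / N\<close> gives the usual \<open>(exp 1 * N / k) ^ k\<close>.\<close>

lemma binomial_le_exp:
  fixes x :: real
  assumes "0 < x" shows "real (N choose k) \<le> exp (x * N) * (1 / x) ^ k"
proof (cases "k \<le> N")
  case True
  have "real (N choose k) * x ^ k \<le> (\<Sum>i\<le>N. real (N choose i) * x ^ i)"
    using True assms by (intro member_le_sum) auto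
  also have "\<dots> = (1 + x) ^ N" using binomial_ring[of x 1 N] by (simp add: add.commute)
  also have "\<dots> \<le> exp x ^ N" using assms by (intro power_mono) auto
  also have "\<dots> = exp (x * N)" by (rule exp_of_nat2_mult[symmetric])
  finally show ?thesis using assms by (simp add: field_simps power_divide)
qed (use assms in \<open>auto simp: binomial_eq_0\<close>)

context haar_grassmannian
begin

lemma initial_segment_event:
  obtains A where "A \<in> sets M" "measure M A \<le> 2 * exp (- 2 * real n)"
    "\<And>E b x. E \<in> space M \<Longrightarrow> E \<notin> A \<Longrightarrow> b \<in> {n..N} \<Longrightarrow> x \<in> supported {1..b} \<Longrightarrow>
      norm_N N (x - orth_proj N E x) \<le> 12 * sqrt (b / N) * norm_N N x"
proof -
  \<comment> \<open>This makes the tail \<open>exp (- 6 * b)\<close>, enough against the net of size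
    \<open>12 ^ b\<close> and the factor \<open>2 powr (n / 2) \<le> 2 ^ b\<close>, as
    \<open>24 * exp (- 6) \<le> exp (- 2)\<close>. The lengths \<open>b \<ge> n\<close> then sum to
    a geometric series.\<close>
  define \<tau> where "\<tau> b = 36 * real b / real N" for b :: nat
  have "\<exists>A. A \<in> sets M \<and> measure M A \<le> 12 ^ b * (2 powr (real n / 2) * exp (- \<tau> b * real N / 6)) \<and>
    (\<forall>E x. E \<in> space M \<longrightarrow> E \<notin> A \<longrightarrow> x \<in> supported {1..b} \<longrightarrow>
      norm_N N (x - orth_proj N E x) \<le> 2 * sqrt (\<tau> b) * norm_N N x)" if b: "b \<in> {n..N}" for b
  proof -
    have "{1..b} \<subseteq> {1..N}" "0 \<le> \<tau> b" using b by (auto simp: \<tau>_def)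
    then obtain A where "A \<in> sets M" "measure M A \<le> 12 ^ card {1..b} * (2 powr (real n / 2) * exp (- \<tau> b * real N / 6))"
      "\<And>E x. E \<in> space M \<Longrightarrow> E \<notin> A \<Longrightarrow> x \<in> supported {1..b} \<Longrightarrow>
        norm_N N (x - orth_proj N E x) \<le> 2 * sqrt (\<tau> b) * norm_N N x"
      using residual_operator_norm by blast
    then show ?thesis by (intro exI[of _ A]) auto
  qed
  then obtain A where A: "\<And>b. b \<in> {n..N} \<Longrightarrow> A b \<in> sets M"
    "\<And>b. b \<in> {n..N} \<Longrightarrow> measure M (A b) \<le> 12 ^ b * (2 powr (real n / 2) * exp (- \<tau> b * real N / 6))"
    "\<And>b E x. b \<in> {n..N} \<Longrightarrow> E \<in> space M \<Longrightarrow> E \<notin> A b \<Longrightarrow> x \<in> supported {1..b} \<Longrightarrow>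
      norm_N N (x - orth_proj N E x) \<le> 2 * sqrt (\<tau> b) * norm_N N x"
    by metis
  show thesis
  proof (rule that[of "\<Union>b\<in>{n..N}. A b"])
    show "(\<Union>b\<in>{n..N}. A b) \<in> sets M" using A(1) by auto
    have "measure M (\<Union>b\<in>{n..N}. A b) \<le> (\<Sum>b=n..N. measure M (A b))"
      using A(1) by (intro finite_measure_subadditive_finite) auto
    also have "\<dots> \<le> (\<Sum>b=n..N. exp (- 2) ^ b)"
    proof (rule sum_mono)
      fix b assume b: "b \<in> {n..N}"
      have e: "exp (- \<tau> b * real N / 6) = exp (- 6) ^ b"
        using n_less_N by (simp add: \<tau>_def exp_of_nat_mult[symmetric])
      have "(2 :: real) powr (real n / 2) \<le> 2 powr real b" using b by (intro powr_mono) auto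
      then have "12 ^ b * (2 powr (real n / 2) * exp (- \<tau> b * real N / 6)) \<le> 12 ^ b * (2 ^ b * exp (- 6) ^ b)"
        unfolding e by (intro mult_left_mono mult_right_mono) (auto simp: powr_realpow)
      also have "\<dots> = (12 * (2 * exp (- 6))) ^ b" by (simp only: power_mult_distrib)
      also have "\<dots> \<le> exp (- 2) ^ b"
      proof (rule power_mono)
        have "24 \<le> exp (4 :: real)" using exp_of_nat_ge[of 4] by (simp add: power_divide)
        then have "12 * (2 * exp (- 6)) \<le> exp 4 * exp (- 6 :: real)" by simp
        also have "\<dots> = exp (- 2)" by (simp flip: exp_add)
        finally show "12 * (2 * exp (- 6)) \<le> exp (- 2 :: real)" .
      qed simp
      finally show "measure M (A b) \<le> exp (- 2) ^ b" using A(2)[OF b] by linarith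
    qed
    also have "\<dots> \<le> 2 * exp (- 2) ^ n"
    proof (rule geometric_tail_le)
      have "2 \<le> exp (2 :: real)" using exp_ge_add_one_self[of "2 :: real"] by linarith
      then show "exp (- 2 :: real) \<le> 1 / 2" by (simp add: exp_minus field_simps)
    qed simp
    also have "\<dots> = 2 * exp (- 2 * real n)" by (simp add: exp_of_nat_mult[symmetric] mult.commute)
    finally show "measure M (\<Union>b\<in>{n..N}. A b) \<le> 2 * exp (- 2 * real n)" .
    fix E b x assume *: "E \<in> space M" "E \<notin> (\<Union>b\<in>{n..N}. A b)" "b \<in> {n..N}" "x \<in> supported {1..b}"
    have "sqrt (\<tau> b) = 6 * sqrt (b / N)"
      using real_sqrt_mult[of "6\<^sup>2" "b / N"] by (simp add: \<tau>_def)
    then show "norm_N N (x - orth_proj N E x) \<le> 12 * sqrt (b / N) * norm_N N x"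
      using A(3)[OF *(3,1) _ *(4)] *(2,3) by auto
  qed
qed

lemma head_event:
  obtains A where "A \<in> sets M" "measure M A \<le> 3 * exp (- 2 * real n)"
    "\<And>E b x. E \<in> space M \<Longrightarrow> E \<notin> A \<Longrightarrow> b \<in> {n..N} \<Longrightarrow> x \<in> supported {1..b} \<Longrightarrow>
      norm_N N (x - orth_proj N E x) \<le> 12 * sqrt (b / N) * norm_N N x"
    "\<And>E x. E \<in> space M \<Longrightarrow> E \<notin> A \<Longrightarrow> x \<in> supported {1..n div 2402} \<Longrightarrow>
      sqrt (n / N) / 250 * norm_N N x \<le> norm_N N (x - orth_proj N E x)"
proof -
  obtain A1 where A1: "A1 \<in> sets M" "measure M A1 \<le> 2 * exp (- 2 * real n)"
    "\<And>E b x. E \<in> space M \<Longrightarrow> E \<notin> A1 \<Longrightarrow> b \<in> {n..N} \<Longrightarrow> x \<in> supported {1..b} \<Longrightarrow>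
      norm_N N (x - orth_proj N E x) \<le> 12 * sqrt (b / N) * norm_N N x"
    using initial_segment_event by blast
  \<comment> \<open>A net of mesh \<open>1 / j\<close> has at most \<open>exp (j + 2)\<close> points
    per coordinate, so a head of length \<open>n div (j + 2)\<close> costs at most
    \<open>exp n\<close>, while \<open>a\<close> is chosen to give a tail
    \<open>exp (- 3 * n)\<close>. The mesh must be so fine because the loss \<open>12 / j\<close>
    has to stay below \<open>sqrt a \<ge> 1 / 100\<close>.\<close>
  define j :: nat where "j = 2400"
  define a where "a = exp (- 7) / (2 :: real)"
  have e7: "exp (7 :: real) \<le> 3 ^ 7" using power_mono[OF exp_le, of 7] by (simp flip: exp_of_nat_mult)
  have a: "0 < a" "a \<le> 1 / 4" "1 / 100 \<le> sqrt a"
  proof -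
    have "2 \<le> exp (7 :: real)" using exp_ge_add_one_self[of "7 :: real"] by linarith
    then show "0 < a" "a \<le> 1 / 4" by (auto simp: a_def exp_minus field_simps)
    show "1 / 100 \<le> sqrt a" using e7 by (intro real_le_rsqrt) (auto simp: a_def exp_minus field_simps power2_eq_square)
  qed
  have sub: "{1..n div (j + 2)} \<subseteq> {1..N}" and j1: "j \<ge> 1"
    using n_less_N by (auto simp: j_def intro: order_trans[OF _ order_trans[OF div_le_dividend]])
  obtain A2 where A2: "A2 \<in> sets M"
    "measure M A2 \<le> (3 * 2 ^ j) ^ card {1..n div (j + 2)} * (2 * exp 1 * a) powr (real n / 2)"
    "\<And>E K x. E \<in> space M \<Longrightarrow> E \<notin> A2 \<Longrightarrow>
      \<forall>x\<in>supported {1..n div (j + 2)}. norm_N N (x - orth_proj N E x) \<le> K * norm_N N x \<Longrightarrow> K \<ge> 0 \<Longrightarrow>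
      x \<in> supported {1..n div (j + 2)} \<Longrightarrow>
      (sqrt (a * n / N) * (1 - 1 / j) - K / j) * norm_N N x \<le> norm_N N (x - orth_proj N E x)"
    using residual_lower_operator_bound[OF sub a(1,2) j1] by blast
  show thesis
  proof (rule that[of "A1 \<union> A2"])
    show "A1 \<union> A2 \<in> sets M" using A1 A2 by auto
    have "(3 * 2 ^ j :: real) \<le> exp 1 ^ 2 * exp 1 ^ j"
    proof (rule mult_mono)
      have "(3 :: real) \<le> (5 / 2) ^ 2" by (simp add: power2_eq_square)
      also have "\<dots> \<le> exp 1 ^ 2" by (intro power_mono exp_1_ge) auto
      finally show "(3 :: real) \<le> exp 1 ^ 2" .
      show "(2 :: real) ^ j \<le> exp 1 ^ j" using exp_1_ge by (intro power_mono) auto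
    qed auto
    also have "\<dots> = exp (real (j + 2))" by (simp add: exp_add mult.commute flip: exp_of_nat_mult)
    finally have "(3 * 2 ^ j :: real) ^ (n div (j + 2)) \<le> exp (real (j + 2)) ^ (n div (j + 2))"
      by (intro power_mono) auto
    also have "\<dots> = exp (real ((n div (j + 2)) * (j + 2)))" by (simp only: exp_of_nat_mult of_nat_mult)
    also have "\<dots> \<le> exp (real n)" by (simp only: exp_le_cancel_iff of_nat_le_iff div_times_less_eq_dividend)
    finally have "(3 * 2 ^ j :: real) ^ (n div (j + 2)) \<le> exp (real n)" .
    moreover have "(2 * exp 1 * a) powr (real n / 2) = exp (- 3 * real n)"
    proof -
      have "2 * exp 1 * a = exp (- 6)" by (simp add: a_def flip: exp_add)
      then show ?thesis by (simp add: powr_def)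
    qed
    ultimately have "measure M A2 \<le> exp (real n) * exp (- 3 * real n)"
      using A2(2) mult_right_mono[of _ "exp (real n)" "exp (- 3 * real n)"] by (auto intro: order_trans)
    then have "measure M A2 \<le> exp (- 2 * real n)" by (simp flip: exp_add)
    then show "measure M (A1 \<union> A2) \<le> 3 * exp (- 2 * real n)"
      using A1(1,2) A2(1) measure_Un_le[of A1 M A2] by linarith
    show up: "norm_N N (x - orth_proj N E x) \<le> 12 * sqrt (b / N) * norm_N N x"
      if "E \<in> space M" "E \<notin> A1 \<union> A2" "b \<in> {n..N}" "x \<in> supported {1..b}" for E b x
      using A1(3) that by blast
    fix E x assume E: "E \<in> space M" "E \<notin> A1 \<union> A2" and x: "x \<in> supported {1..n div 2402}"
    have sub: "supported {1..n div (j + 2)} \<subseteq> supported {1..n}"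
      by (intro supported_mono) (auto intro: order_trans[OF _ div_le_dividend])
    have "\<forall>x\<in>supported {1..n div (j + 2)}. norm_N N (x - orth_proj N E x) \<le> (12 * sqrt (n / N)) * norm_N N x"
      using up[OF E, of n] sub n_less_N by auto
    then have low: "(sqrt (a * n / N) * (1 - 1 / j) - (12 * sqrt (n / N)) / j) * norm_N N x \<le> norm_N N (x - orth_proj N E x)"
      using A2(3)[of E "12 * sqrt (n / N)" x] E x by (auto simp: j_def)
    have "sqrt (n / N) / 250 \<le> sqrt (n / N) * (1 / 100 * (1 - 1 / j) - 12 / j)"
      by (simp add: j_def)
    also have "\<dots> \<le> sqrt (n / N) * (sqrt a * (1 - 1 / j) - 12 / j)"
      using a(3) by (intro mult_left_mono diff_right_mono mult_right_mono) (auto simp: j_def)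
    also have "\<dots> = sqrt (a * n / N) * (1 - 1 / j) - (12 * sqrt (n / N)) / j"
    proof -
      have "sqrt (a * n / N) = sqrt a * sqrt (n / N)" by (simp flip: real_sqrt_mult)
      then show ?thesis by (simp only:) (simp add: algebra_simps)
    qed
    finally have le: "sqrt (n / N) / 250 \<le> sqrt (a * n / N) * (1 - 1 / j) - (12 * sqrt (n / N)) / j" .
    show "sqrt (n / N) / 250 * norm_N N x \<le> norm_N N (x - orth_proj N E x)"
      by (rule order_trans[OF mult_right_mono[OF le] low]) simp
  qed
qed

text \<open>At \<open>\<tau> = 1/16\<close> the operator bound is \<open>1/2\<close>. The tail
  \<open>exp (- N / 96)\<close> has to pay for the choice of the set, its net and the factor in
  \<open>n\<close>; with \<open>n\<close> and \<open>k\<close> at most \<open>N / 2000\<close> a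
  rate \<open>1 / 400\<close> is left.\<close>

lemma sparse_event:
  assumes n: "2000 * n \<le> N" and k: "2000 * k \<le> N"
  obtains A where "A \<in> sets M" "measure M A \<le> exp (- real N / 400)"
    "\<And>E S x. E \<in> space M \<Longrightarrow> E \<notin> A \<Longrightarrow> S \<subseteq> {1..N} \<Longrightarrow> card S = k \<Longrightarrow> x \<in> supported S \<Longrightarrow>
      norm_N N (x - orth_proj N E x) \<le> norm_N N x / 2"
proof -
  define \<S> where "\<S> = {S. S \<subseteq> {1..N} \<and> card S = k}"
  have fin: "finite \<S>" by (simp add: \<S>_def)
  have sq: "sqrt (1 / 16) = (1 / 4 :: real)" by (rule real_sqrt_unique) (auto simp: power2_eq_square)
  have "\<exists>A. A \<in> sets M \<and> measure M A \<le> 12 ^ k * (2 powr (real n / 2) * exp (- (1 / 16) * real N / 6)) \<and>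
    (\<forall>E x. E \<in> space M \<longrightarrow> E \<notin> A \<longrightarrow> x \<in> supported S \<longrightarrow>
      norm_N N (x - orth_proj N E x) \<le> norm_N N x / 2)" if S: "S \<in> \<S>" for S
  proof -
    have "S \<subseteq> {1..N}" "card S = k" using S by (auto simp: \<S>_def)
    then obtain A where "A \<in> sets M" "measure M A \<le> 12 ^ k * (2 powr (real n / 2) * exp (- (1 / 16) * real N / 6))"
      "\<And>E x. E \<in> space M \<Longrightarrow> E \<notin> A \<Longrightarrow> x \<in> supported S \<Longrightarrow>
        norm_N N (x - orth_proj N E x) \<le> 2 * sqrt (1 / 16) * norm_N N x"
      using residual_operator_norm[of S "1 / 16"] by (metis zero_le_divide_1_iff zero_le_numeral)
    then show ?thesis unfolding sq by (intro exI[of _ A]) auto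
  qed
  then obtain A where A: "\<And>S. S \<in> \<S> \<Longrightarrow> A S \<in> sets M"
    "\<And>S. S \<in> \<S> \<Longrightarrow> measure M (A S) \<le> 12 ^ k * (2 powr (real n / 2) * exp (- (1 / 16) * real N / 6))"
    "\<And>S E x. S \<in> \<S> \<Longrightarrow> E \<in> space M \<Longrightarrow> E \<notin> A S \<Longrightarrow> x \<in> supported S \<Longrightarrow>
      norm_N N (x - orth_proj N E x) \<le> norm_N N x / 2"
    by metis
  show thesis
  proof (rule that[of "\<Union>S\<in>\<S>. A S"])
    show "(\<Union>S\<in>\<S>. A S) \<in> sets M" using A(1) fin by auto
    have "measure M (\<Union>S\<in>\<S>. A S) \<le> (\<Sum>S\<in>\<S>. measure M (A S))"
      using A(1) fin by (intro finite_measure_subadditive_finite) auto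
    also have "\<dots> \<le> (\<Sum>S\<in>\<S>. 12 ^ k * (2 powr (real n / 2) * exp (- (1 / 16) * real N / 6)))"
      using A(2) by (intro sum_mono)
    also have "\<dots> = real (N choose k) * (12 ^ k * (2 powr (real n / 2) * exp (- (1 / 16) * real N / 6)))"
      using n_subsets[of "{1..N}" k] by (simp add: \<S>_def)
    also have "\<dots> \<le> (exp (1 / 400 * N) * (1 / (1 / 400)) ^ k) * (12 ^ k * (exp (real n / 2) * exp (- (1 / 16) * real N / 6)))"
    proof (intro mult_mono binomial_le_exp)
      have "(2 :: real) powr (real n / 2) \<le> exp 1 powr (real n / 2)"
        using exp_1_ge by (intro powr_mono2) auto
      then show "(2 :: real) powr (real n / 2) \<le> exp (real n / 2)" by (simp add: exp_powr_real)
    qed auto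
    also have "\<dots> = 4800 ^ k * exp (real N / 400 + real n / 2 - real N / 96)"
    proof -
      have "exp (1 / 400 * N) * (exp (real n / 2) * exp (- (1 / 16) * real N / 6)) = exp (real N / 400 + real n / 2 - real N / 96)"
        by (simp flip: exp_add)
      moreover have "(1 / (1 / 400)) ^ k * 12 ^ k = (4800 :: real) ^ k" by (simp flip: power_mult_distrib)
      moreover have "x * y * (z * u) = (y * z) * (x * u)" for x y z u :: real by simp
      ultimately show ?thesis by (simp only:)
    qed
    also have "\<dots> \<le> exp (10 * real k) * exp (real N / 400 + real n / 2 - real N / 96)"
    proof (rule mult_right_mono)
      have "(4800 :: real) \<le> exp 10" using exp_of_nat_ge[of 10] by (simp add: power_divide)
      then have "(4800 :: real) ^ k \<le> exp 10 ^ k" by (intro power_mono) auto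
      then show "(4800 :: real) ^ k \<le> exp (10 * real k)" by (simp add: exp_of_nat_mult[symmetric] mult.commute)
    qed simp
    also have "\<dots> = exp (10 * real k + (real N / 400 + real n / 2 - real N / 96))" by (simp only: exp_add)
    also have "\<dots> \<le> exp (- real N / 400)"
    proof -
      have "2000 * real n \<le> real N" "2000 * real k \<le> real N"
        using of_nat_mono[OF n, where ?'a = real] of_nat_mono[OF k, where ?'a = real] by simp_all
      then show ?thesis by simp
    qed
    finally show "measure M (\<Union>S\<in>\<S>. A S) \<le> exp (- real N / 400)" .
  qed (use A(3) in \<open>auto simp: \<S>_def\<close>)
qed

text \<open>Lyubarskii--Vershynin truncation: the residual of \<open>x\<close> is cut off at a height that leaves at most
  \<open>k\<close> large coordinates, and the projection of the remaining sparse part has at most half the norm.\<close>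

lemma approximate_in_sup_norm:
  assumes E: "E \<in> space M" and k: "1 \<le> k" "k \<le> N"
    and sparse: "\<And>S x. S \<subseteq> {1..N} \<Longrightarrow> card S = k \<Longrightarrow> x \<in> supported S \<Longrightarrow>
      norm_N N (x - orth_proj N E x) \<le> norm_N N x / 2"
    and x: "x \<in> Rn N"
  obtains y where "y \<in> E" "\<And>i. \<bar>x i - y i\<bar> \<le> 3 * norm_N N (x - orth_proj N E x) / sqrt k"
proof -
  note g = E[unfolded space_M]
  let ?R = "\<lambda>x. x - orth_proj N E x"
  have R_Rn: "?R x \<in> Rn N" if "x \<in> Rn N" for x
    using that orth_proj_Rn[OF g] Rn_subspace fvs.subspace_diff by blast
  have R_idem: "?R (?R x) = ?R x" for x
    using orth_proj_diff[OF g, of x "orth_proj N E x"] orth_proj_ident[OF g orth_proj_in[OF g, of x]]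
    by (simp add: fun_eq_iff fun_apply)
  define r where "r = norm_N N (?R x) / sqrt k"
  \<comment> \<open>Invariant of the iteration: \<open>w\<close> is what has been cut off so far.
    Its sup norm is bounded by a partial sum of \<open>r + r / 2 + ...\<close>, while the residual
    of \<open>x - w\<close> halves each time.\<close>
  have "\<exists>w. w \<in> Rn N \<and> (\<forall>i. \<bar>w i\<bar> \<le> (2 - 2 * (1 / 2) ^ l) * r) \<and> norm_N N (?R (x - w)) \<le> (1 / 2) ^ l * norm_N N (?R x)" for l
  proof (induction l)
    case 0
    show ?case by (intro exI[of _ 0]) (auto simp: Rn_def fun_apply)
  next
    case (Suc l)
    then obtain w where w: "w \<in> Rn N" "\<And>i. \<bar>w i\<bar> \<le> (2 - 2 * (1 / 2) ^ l) * r"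
      "norm_N N (?R (x - w)) \<le> (1 / 2) ^ l * norm_N N (?R x)" by auto
    define v where "v = ?R (x - w)"
    define \<theta> where "\<theta> = (1 / 2) ^ l * r"
    have v: "v \<in> Rn N" unfolding v_def using x w(1) Rn_subspace fvs.subspace_diff by (intro R_Rn) blast
    have \<theta>: "\<theta> \<ge> 0" "\<theta> * sqrt k = (1 / 2) ^ l * norm_N N (?R x)" using k by (auto simp: \<theta>_def r_def)
    \<comment> \<open>The large coordinates number at most \<open>k\<close> by Chebyshev's
      inequality; for \<open>\<theta> = 0\<close> the residual itself is zero. \<open>B\<close> is
      then padded to exactly \<open>k\<close> elements, as \<open>sparse\<close> requires.\<close>
    define B where "B = {i \<in> {1..N}. \<theta> < \<bar>v i\<bar>}"
    have B_sub: "B \<subseteq> {1..N}" by (auto simp: B_def)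
    have "card B \<le> k"
    proof (cases "\<theta> = 0")
      case True
      then have "norm_N N v \<le> 0" using w(3) \<theta>(2) by (simp add: v_def)
      then have "v = 0" using norm_N_eq_zero_iff[OF v] norm_N_nonneg[of N v] by linarith
      then have "B = {}" using True by (auto simp: B_def fun_apply)
      then show ?thesis by simp
    next
      case False
      have "real (card B) * \<theta>\<^sup>2 = (\<Sum>i\<in>B. \<theta>\<^sup>2)" by simp
      also have "\<dots> \<le> (\<Sum>i\<in>B. (v i)\<^sup>2)"
        using \<theta>(1) by (intro sum_mono) (auto simp: B_def abs_le_square_iff[symmetric])
      also have "\<dots> \<le> (\<Sum>i\<in>{1..N}. (v i)\<^sup>2)" by (intro sum_mono2) (auto simp: B_def)
      also have "\<dots> = (norm_N N v)\<^sup>2" unfolding norm_N_power2 inner_N_def by (simp add: power2_eq_square)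
      also have "\<dots> \<le> (\<theta> * sqrt k)\<^sup>2" unfolding \<theta>(2) using w(3) by (intro power_mono) (auto simp: v_def)
      also have "\<dots> = real k * \<theta>\<^sup>2" by (simp add: power_mult_distrib)
      finally show ?thesis using False by simp
    qed
    then obtain S where S: "B \<subseteq> S" "S \<subseteq> {1..N}" "card S = k"
      using exists_subset_between[of B k "{1..N}"] k B_sub by auto
    define u where "u = (\<lambda>i. if i \<in> B then v i else 0)"
    define t where "t = v - u"
    have u: "u \<in> supported S" using S by (auto simp: u_def supported_def)
    have t: "t \<in> Rn N" using v by (auto simp: t_def u_def Rn_def fun_apply)
    have t_le: "\<bar>t i\<bar> \<le> \<theta>" for i
      using v \<theta>(1) by (auto simp: t_def u_def fun_apply B_def Rn_def)
    have "norm_N N u \<le> norm_N N v"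
      unfolding norm_N_def L2_set_def by (intro real_sqrt_le_mono sum_mono) (auto simp: u_def)
    then have "norm_N N (?R u) \<le> norm_N N v / 2" using sparse[OF S(2,3) u] by linarith
    moreover have "?R (x - (w + t)) = ?R u"
    proof -
      have "?R (x - (w + t)) = ?R ((x - w) - t)" by (simp add: diff_diff_eq)
      also have "\<dots> = v - ?R t" using orth_proj_diff[OF g, of "x - w" t] by (simp add: v_def fun_eq_iff fun_apply)
      also have "\<dots> = ?R (v - t)" using R_idem[of "x - w"] orth_proj_diff[OF g, of v t] by (simp add: v_def fun_eq_iff fun_apply)
      also have "v - t = u" by (simp add: t_def)
      finally show ?thesis .
    qed
    ultimately have "norm_N N (?R (x - (w + t))) \<le> (1 / 2) ^ Suc l * norm_N N (?R x)"
      using w(3) by (simp add: v_def)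
    moreover have "\<bar>(w + t) i\<bar> \<le> (2 - 2 * (1 / 2) ^ Suc l) * r" for i
    proof -
      have "\<bar>(w + t) i\<bar> \<le> \<bar>w i\<bar> + \<bar>t i\<bar>" by (simp add: fun_apply)
      also have "\<dots> \<le> (2 - 2 * (1 / 2) ^ l) * r + (1 / 2) ^ l * r" using w(2)[of i] t_le[of i] by (simp add: \<theta>_def)
      finally show ?thesis by (simp add: algebra_simps)
    qed
    moreover have "w + t \<in> Rn N" using w(1) t Rn_subspace fvs.subspace_add by blast
    ultimately show ?case by blast
  qed
  note approx = this
  \<comment> \<open>The iteration stops once the residual norm is below \<open>r\<close>. Then the
    sup norm of the error is at most \<open>2 * r\<close> from \<open>w\<close> and \<open>r\<close>
    from the remaining residual, whence the factor 3.\<close>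
  obtain l where l: "(1 / 2 :: real) ^ l < 1 / sqrt k" using real_arch_pow_inv[of "1 / sqrt k" "1 / 2"] k by auto
  obtain w where w: "w \<in> Rn N" "\<And>i. \<bar>w i\<bar> \<le> (2 - 2 * (1 / 2) ^ l) * r"
      "norm_N N (?R (x - w)) \<le> (1 / 2) ^ l * norm_N N (?R x)" using approx[of l] by auto
  show thesis
  proof (rule that[of "orth_proj N E (x - w)"])
    show "orth_proj N E (x - w) \<in> E" by (rule orth_proj_in[OF g])
    fix i
    have r0: "r \<ge> 0" by (simp add: r_def)
    have "x i - orth_proj N E (x - w) i = w i + ?R (x - w) i" by (simp add: fun_apply)
    moreover have "\<bar>?R (x - w) i\<bar> \<le> norm_N N (?R (x - w))"
      using x w(1) Rn_subspace fvs.subspace_diff by (intro abs_le_norm_N R_Rn) blast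
    moreover have "(1 / 2) ^ l * norm_N N (?R x) \<le> r"
      using mult_right_mono[OF less_imp_le[OF l], of "norm_N N (?R x)"] by (simp add: r_def)
    moreover have "\<bar>w i\<bar> \<le> 2 * r" using w(2)[of i] mult_right_mono[OF _ r0, of "2 - 2 * (1 / 2) ^ l" 2] by simp
    ultimately show "\<bar>x i - orth_proj N E (x - w) i\<bar> \<le> 3 * norm_N N (?R x) / sqrt k"
      using w(3) by (simp add: r_def)
  qed
qed

end

section \<open>Geometry of the ellipsoid\<close>

lemma bernoulli_powr_nonpos:
  fixes x r :: real
  assumes "x > 0" "r \<le> 0" shows "1 + r * (x - 1) \<le> x powr r"
proof -
  have "1 + r * (x - 1) \<le> 1 + r * ln x"
    using assms ln_le_minus_one[of x] by (simp add: mult_left_mono_neg)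
  also have "\<dots> \<le> x powr r" using assms exp_ge_add_one_self[of "r * ln x"] by (simp add: powr_def)
  finally show ?thesis .
qed

text \<open>The p-th power of the Minkowski functional of the ellipsoid: homogeneous of degree
  \<open>p\<close>, so membership after rescaling is read off directly.\<close>

definition gauge :: "nat \<Rightarrow> real \<Rightarrow> (nat \<Rightarrow> real) \<Rightarrow> (nat \<Rightarrow> real) \<Rightarrow> real" where
  "gauge N p \<sigma> x = (\<Sum>i=1..N. (\<bar>x i\<bar> / \<sigma> i) powr p)"

lemma ellipsoid_gauge: "x \<in> ellipsoid N p \<sigma> \<longleftrightarrow> x \<in> Rn N \<and> gauge N p \<sigma> x \<le> 1"
  by (simp add: ellipsoid_def gauge_def)

lemma norm_N_sum: "(norm_N N x)\<^sup>2 = (\<Sum>i=1..N. (x i)\<^sup>2)"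
  unfolding norm_N_power2 inner_N_def by (simp add: power2_eq_square)

locale log_ellipsoid =
  fixes p \<alpha> \<beta> :: real and N :: nat
  assumes p_gt_1: "p > 1" and \<alpha>_pos: "\<alpha> > 0" and \<alpha>_eq: "\<alpha> = 1/2 - 1/p" and \<beta>_gt: "\<beta> > \<alpha>" and N_ge_2: "N \<ge> 2"
begin

abbreviation \<sigma> where "\<sigma> \<equiv> log_semiaxes \<alpha> \<beta>"

abbreviation K where "K \<equiv> ellipsoid N p \<sigma>"

abbreviation LN :: real where "LN \<equiv> ln (real N + 1)"

lemma p_gt_2: "p > 2"
  using \<alpha>_pos p_gt_1 by (simp add: \<alpha>_eq field_simps)

lemma \<alpha>_less_half: "\<alpha> < 1 / 2"
  using p_gt_1 by (simp add: \<alpha>_eq)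

lemma \<beta>_pos: "\<beta> > 0"
  using \<alpha>_pos \<beta>_gt by simp

lemma log_ge_1: "1 \<le> LN"
proof -
  have "exp 1 \<le> (3 :: real)" by (rule exp_le)
  also have "\<dots> \<le> real N + 1" using N_ge_2 by simp
  finally show ?thesis by (subst ln_ge_iff) auto
qed

lemma \<sigma>_pos: "1 \<le> i \<Longrightarrow> 0 < \<sigma> i"
  by (simp add: log_semiaxes_def)

lemma \<sigma>_antimono: "1 \<le> i \<Longrightarrow> i \<le> j \<Longrightarrow> \<sigma> j \<le> \<sigma> i"
  unfolding log_semiaxes_def using \<alpha>_pos \<beta>_pos
  by (intro mult_mono powr_mono2') auto

text \<open>Since \<open>ln 2 < 1\<close>, the ellipsoid contains the first unit vector; the lower
  bounds rest on this.\<close>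

lemma \<sigma>_1: "1 \<le> \<sigma> 1"
  unfolding log_semiaxes_def using \<beta>_pos ln_2_less_1 ge_one_powr_ge_zero[of "1 / ln 2" \<beta>]
  by (simp add: powr_divide powr_minus_divide)

lemma gauge_scale: "gauge N p \<sigma> (fscale c x) = \<bar>c\<bar> powr p * gauge N p \<sigma> x"
proof -
  have "(\<bar>fscale c x i\<bar> / \<sigma> i) powr p = \<bar>c\<bar> powr p * (\<bar>x i\<bar> / \<sigma> i) powr p" if "i \<in> {1..N}" for i
    using \<sigma>_pos[of i] that by (simp add: fscale_def abs_mult flip: powr_mult)
  then show ?thesis by (simp add: gauge_def sum_distrib_left)
qed

text \<open>A form of Young's inequality. If the first term does not dominate, then \<open>t\<close>
  is at most \<open>s powr (2 / (p - 2))\<close>, and the resulting exponent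
  \<open>2 * p / (p - 2)\<close> of \<open>s\<close> is \<open>1 / \<alpha>\<close>.\<close>

lemma coordinate_le:
  assumes "t \<ge> 0" "s > 0" shows "(t * s)\<^sup>2 \<le> t powr p + s powr (1 / \<alpha>)"
proof (cases "t = 0")
  case True
  then show ?thesis by simp
next
  case False
  then have t: "t > 0" using assms by simp
  show ?thesis
  proof (cases "s\<^sup>2 \<le> t powr (p - 2)")
    case True
    have "(t * s)\<^sup>2 \<le> t\<^sup>2 * t powr (p - 2)" using True by (simp add: power_mult_distrib mult_left_mono)
    also have "\<dots> = t powr p" using t powr_add[of t 2 "p - 2"] by simp
    finally show ?thesis by (simp add: add_increasing2)
  next
    case False
    have p: "p - 2 > 0" using p_gt_2 by simp
    have "t = (t powr (p - 2)) powr (1 / (p - 2))" using t p by (simp add: powr_powr)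
    also have "\<dots> \<le> (s powr 2) powr (1 / (p - 2))"
      using False p assms by (intro powr_mono2) auto
    also have "\<dots> = s powr (2 / (p - 2))" by (simp add: powr_powr)
    finally have "(t * s)\<^sup>2 \<le> (s powr (2 / (p - 2)) * s)\<^sup>2" using assms t by (intro power_mono mult_right_mono) auto
    also have "\<dots> = (s powr (2 / (p - 2)) * s powr 1) powr 2"
      using assms by simp
    also have "\<dots> = s powr ((2 / (p - 2) + 1) * 2)" by (simp only: powr_add[symmetric] powr_powr)
    also have "(2 / (p - 2) + 1) * 2 = 1 / \<alpha>"
      using p p_gt_1 by (simp add: \<alpha>_eq field_simps)
    finally show ?thesis by (simp add: add_increasing)
  qed
qed

text \<open>The first term of the series of
  \<open>1 / (i * ln (i + 1) powr (\<beta> / \<alpha>))\<close>, plus a bound for its tail from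
  \<open>i = 2\<close>. It does not depend on \<open>N\<close>.\<close>

definition axis_sum_bound :: real where
  "axis_sum_bound = ln 2 powr (- (\<beta> / \<alpha>)) + 2 / (\<beta> / \<alpha> - 1) * ln 2 powr (1 - \<beta> / \<alpha>)"

text \<open>Telescoping against \<open>ln i powr (1 - s)\<close>, a multiple of the primitive of \<open>1 / (x * ln x powr s)\<close>.\<close>

lemma axis_sum_le: "(\<Sum>i=1..N. \<sigma> i powr (1 / \<alpha>)) \<le> axis_sum_bound"
proof -
  define s where "s = \<beta> / \<alpha>"
  have s: "s > 1" using \<beta>_gt \<alpha>_pos by (simp add: s_def)
  define c where "c = 2 / (s - 1)"
  have c: "c > 0" using s by (simp add: c_def)
  define \<phi> where "\<phi> i = c * ln (real i) powr (1 - s)" for i :: nat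
  have axis_term: "\<sigma> i powr (1 / \<alpha>) = ln (real i + 1) powr (- s) / real i" if "i \<ge> 1" for i
    unfolding log_semiaxes_def powr_mult powr_powr using that \<alpha>_pos
    by (simp add: s_def powr_minus_divide)
  have step: "\<sigma> i powr (1 / \<alpha>) \<le> \<phi> i - \<phi> (Suc i)" if i: "i \<ge> 2" for i
  proof -
    define a where "a = ln (real i)"
    define b where "b = ln (real i + 1)"
    have a: "a > 0" and ab: "a \<le> b" using i by (auto simp: a_def b_def)
    have "1 / (2 * real i) \<le> b - a"
    proof -
      have "ln (real i / (real i + 1)) \<le> real i / (real i + 1) - 1" using i by (intro ln_le_minus_one) auto
      moreover have "ln (real i / (real i + 1)) = a - b" using i by (simp add: a_def b_def ln_div)
      moreover have "real i / (real i + 1) - 1 = - (1 / (real i + 1))" by (simp add: field_simps)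
      moreover have "1 / (2 * real i) \<le> 1 / (real i + 1)" using i by (intro divide_left_mono) auto
      ultimately show ?thesis by linarith
    qed
    then have "b powr (- s) * (1 / (2 * real i)) \<le> b powr (- s) * (b - a)" by (intro mult_left_mono) auto
    also have "\<dots> = b powr (- s) * b * (1 - a / b)" using a ab by (simp add: field_simps)
    also have "b powr (- s) * b = b powr (1 - s)"
      using a ab powr_add[of b "- s" 1] by simp
    also have "b powr (1 - s) * (1 - a / b) \<le> b powr (1 - s) * (((a / b) powr (1 - s) - 1) / (s - 1))"
      using bernoulli_powr_nonpos[of "a / b" "1 - s"] a ab s
      by (intro mult_left_mono) (auto simp: field_simps)
    also have "\<dots> = (a powr (1 - s) - b powr (1 - s)) / (s - 1)"
    proof -
      have "b powr (1 - s) * (a / b) powr (1 - s) = a powr (1 - s)" using a ab by (simp add: powr_divide)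
      then show ?thesis by (simp add: right_diff_distrib)
    qed
    finally have le: "b powr (- s) * (1 / (2 * real i)) \<le> (a powr (1 - s) - b powr (1 - s)) / (s - 1)" .
    have "\<sigma> i powr (1 / \<alpha>) = 2 * (b powr (- s) * (1 / (2 * real i)))" using axis_term[of i] i by (simp add: b_def)
    also have "\<dots> \<le> 2 * ((a powr (1 - s) - b powr (1 - s)) / (s - 1))" using le by linarith
    also have "\<dots> = \<phi> i - \<phi> (Suc i)"
      by (simp add: \<phi>_def c_def a_def b_def right_diff_distrib diff_divide_distrib add.commute)
    finally show ?thesis .
  qed
  have "(\<Sum>i=1..N. \<sigma> i powr (1 / \<alpha>)) = \<sigma> 1 powr (1 / \<alpha>) + (\<Sum>i=2..N. \<sigma> i powr (1 / \<alpha>))"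
    using N_ge_2 by (simp add: sum.atLeast_Suc_atMost numeral_2_eq_2)
  also have "(\<Sum>i=2..N. \<sigma> i powr (1 / \<alpha>)) \<le> (\<Sum>i=2..N. \<phi> i - \<phi> (Suc i))"
    using step by (intro sum_mono) auto
  also have "\<dots> = \<phi> 2 - \<phi> (Suc N)"
    using sum_Suc_diff[of 2 N "\<lambda>i. - \<phi> i"] N_ge_2 by simp
  also have "\<dots> \<le> \<phi> 2" using c by (simp add: \<phi>_def)
  finally show ?thesis using axis_term[of 1] by (simp add: axis_sum_bound_def s_def[symmetric] \<phi>_def c_def)
qed

lemma norm_le_in_ellipsoid:
  assumes "y \<in> K" shows "norm_N N y \<le> sqrt (1 + axis_sum_bound)"
proof (rule real_le_rsqrt)
  have "(norm_N N y)\<^sup>2 \<le> (\<Sum>i=1..N. (\<bar>y i\<bar> / \<sigma> i) powr p + \<sigma> i powr (1 / \<alpha>))"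
    unfolding norm_N_sum
  proof (rule sum_mono)
    fix i assume "i \<in> {1..N}"
    then have "\<sigma> i > 0" using \<sigma>_pos by auto
    then show "(y i)\<^sup>2 \<le> (\<bar>y i\<bar> / \<sigma> i) powr p + \<sigma> i powr (1 / \<alpha>)"
      using coordinate_le[of "\<bar>y i\<bar> / \<sigma> i" "\<sigma> i"] by simp
  qed
  also have "\<dots> \<le> 1 + axis_sum_bound"
    using assms axis_sum_le by (simp add: sum.distrib ellipsoid_gauge gauge_def add_mono)
  finally show "(norm_N N y)\<^sup>2 \<le> 1 + axis_sum_bound" .
qed

lemma axis_sum_bound_nonneg: "0 \<le> axis_sum_bound"
  using axis_sum_le sum_nonneg[of "{1..N}" "\<lambda>i. \<sigma> i powr (1 / \<alpha>)"] by simp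

text \<open>Hoelder's inequality up to a factor 2: \<open>x\<^sup>2 \<le> x powr p + 1\<close> is
  applied to the normalised coordinates scaled by \<open>b powr (1 / p)\<close>, which makes both
  terms contribute at most \<open>b\<close>.\<close>

lemma block_sum_le:
  assumes y: "y \<in> K" and B: "B \<subseteq> {1..N}" "\<And>i. i \<in> B \<Longrightarrow> r < i" and b: "real (card B) \<le> b" "b > 0"
  shows "(\<Sum>i\<in>B. (y i)\<^sup>2) \<le> 2 * b powr (2 * \<alpha>) * (\<sigma> (Suc r))\<^sup>2"
proof -
  define t where "t i = \<bar>y i\<bar> / \<sigma> i" for i
  have t: "t i \<ge> 0" if "i \<in> B" for i
    using that B \<sigma>_pos[of i] by (auto simp: t_def intro!: divide_nonneg_pos)
  have finB: "finite B" using B finite_subset by blast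
  have sq: "x\<^sup>2 \<le> x powr p + 1" if "x \<ge> 0" for x :: real
  proof (cases "x \<le> 1")
    case True
    then show ?thesis using that by (intro add_increasing) (auto intro: power_le_one)
  next
    case False
    then have "x powr 2 \<le> x powr p" using p_gt_2 by (intro powr_mono) auto
    then show ?thesis using False by simp
  qed
  have b2: "(b powr (1 / p))\<^sup>2 = b powr (2 / p)" by (simp add: power2_eq_square flip: powr_add)
  have "b powr (2 / p) * (\<Sum>i\<in>B. (t i)\<^sup>2) = (\<Sum>i\<in>B. (b powr (1 / p) * t i)\<^sup>2)"
    by (simp add: power_mult_distrib sum_distrib_left b2)
  also have "\<dots> \<le> (\<Sum>i\<in>B. (b powr (1 / p) * t i) powr p + 1)"
    using t by (intro sum_mono sq) auto
  also have "\<dots> = b * (\<Sum>i\<in>B. t i powr p) + real (card B)"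
    using b t p_gt_1 by (simp add: sum.distrib powr_mult powr_powr sum_distrib_left)
  also have "\<dots> \<le> b * 1 + b"
  proof (intro add_mono mult_left_mono)
    have "(\<Sum>i\<in>B. t i powr p) \<le> gauge N p \<sigma> y"
      unfolding gauge_def t_def using B by (intro sum_mono2) auto
    then show "(\<Sum>i\<in>B. t i powr p) \<le> 1" using y by (simp add: ellipsoid_gauge)
  qed (use b in auto)
  finally have "b powr (2 / p) * (\<Sum>i\<in>B. (t i)\<^sup>2) \<le> 2 * b" by simp
  also have "2 * b = b powr (2 / p) * (2 * b powr (2 * \<alpha>))"
    using b by (simp add: powr_add[symmetric] \<alpha>_eq field_simps) 
  finally have *: "(\<Sum>i\<in>B. (t i)\<^sup>2) \<le> 2 * b powr (2 * \<alpha>)" using b by simp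
  have "(\<Sum>i\<in>B. (y i)\<^sup>2) \<le> (\<Sum>i\<in>B. (t i)\<^sup>2 * (\<sigma> (Suc r))\<^sup>2)"
  proof (rule sum_mono)
    fix i assume i: "i \<in> B"
    have pos: "\<sigma> i > 0" using i B \<sigma>_pos by auto
    have "(y i)\<^sup>2 = (t i)\<^sup>2 * (\<sigma> i)\<^sup>2" using pos by (simp add: t_def power_divide)
    also have "\<dots> \<le> (t i)\<^sup>2 * (\<sigma> (Suc r))\<^sup>2"
      using \<sigma>_antimono[of "Suc r" i] B(2)[OF i] pos by (intro mult_left_mono power_mono) auto
    finally show "(y i)\<^sup>2 \<le> (t i)\<^sup>2 * (\<sigma> (Suc r))\<^sup>2" .
  qed
  also have "\<dots> = (\<Sum>i\<in>B. (t i)\<^sup>2) * (\<sigma> (Suc r))\<^sup>2" by (simp add: sum_distrib_right)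
  also have "\<dots> \<le> 2 * b powr (2 * \<alpha>) * (\<sigma> (Suc r))\<^sup>2" using * by (intro mult_right_mono) auto
  finally show ?thesis .
qed

text \<open>All semiaxes but the first are replaced by the smallest one. The factor
  \<open>N powr (1 / p)\<close> from the number of coordinates and \<open>N powr \<alpha>\<close>
  from that semiaxis combine to \<open>sqrt N\<close>, again by the critical relation.\<close>

lemma gauge_flat_le:
  assumes "\<bar>y 1\<bar> \<le> 3 / 2" "\<And>i. i \<in> {2..N} \<Longrightarrow> \<bar>y i\<bar> \<le> \<eta>" "\<eta> \<ge> 0"
  shows "gauge N p \<sigma> y \<le> (3 + 2 * sqrt N * LN powr \<beta> * \<eta>) powr p"
proof -
  define b where "b = sqrt N * LN powr \<beta> * \<eta>"
  have b: "b \<ge> 0" using assms(3) by (simp add: b_def)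
  have pos: "\<sigma> N > 0" using \<sigma>_pos N_ge_2 by simp
  have "gauge N p \<sigma> y = (\<bar>y 1\<bar> / \<sigma> 1) powr p + (\<Sum>i=2..N. (\<bar>y i\<bar> / \<sigma> i) powr p)"
    unfolding gauge_def using N_ge_2 by (simp add: sum.atLeast_Suc_atMost numeral_2_eq_2)
  also have "(\<bar>y 1\<bar> / \<sigma> 1) powr p \<le> (3 / 2 + b) powr p"
  proof (rule powr_mono2)
    have "\<bar>y 1\<bar> / \<sigma> 1 \<le> \<bar>y 1\<bar>" using \<sigma>_1 by (simp add: divide_le_eq mult_le_cancel_left1)
    then show "\<bar>y 1\<bar> / \<sigma> 1 \<le> 3 / 2 + b" using assms(1) b by simp
  qed (use \<sigma>_1 p_gt_1 in auto)
  also have "(\<Sum>i=2..N. (\<bar>y i\<bar> / \<sigma> i) powr p) \<le> (\<Sum>i=2..N. (\<eta> / \<sigma> N) powr p)"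
  proof (intro sum_mono powr_mono2)
    fix i assume i: "i \<in> {2..N}"
    then have "\<sigma> i > 0" "\<sigma> N \<le> \<sigma> i" using \<sigma>_pos \<sigma>_antimono by auto
    then show "0 \<le> \<bar>y i\<bar> / \<sigma> i" "\<bar>y i\<bar> / \<sigma> i \<le> \<eta> / \<sigma> N"
      using assms(2)[OF i] assms(3) pos by (auto intro: frac_le)
  qed (use p_gt_1 in auto)
  also have "\<dots> \<le> real N * (\<eta> / \<sigma> N) powr p"
    by (simp add: mult_right_mono)
  also have "\<dots> = (real N powr (1 / p) * (\<eta> / \<sigma> N)) powr p"
    using p_gt_1 N_ge_2 by (subst powr_mult) (simp_all add: powr_powr)
  also have "real N powr (1 / p) * (\<eta> / \<sigma> N) = b"
  proof -
    have "1 / \<sigma> N = real N powr \<alpha> * LN powr \<beta>"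
      using N_ge_2 by (simp add: log_semiaxes_def powr_minus_divide)
    then have "real N powr (1 / p) * (\<eta> / \<sigma> N) = (real N powr (1 / p) * real N powr \<alpha>) * LN powr \<beta> * \<eta>"
      by (metis (no_types, opaque_lifting) divide_inverse mult.assoc mult.commute inverse_eq_divide)
    also have "real N powr (1 / p) * real N powr \<alpha> = sqrt N"
      by (simp add: powr_add[symmetric] \<alpha>_eq powr_half_sqrt)
    finally show ?thesis by (simp add: b_def)
  qed
  also have "b powr p \<le> (3 / 2 + b) powr p" using b p_gt_1 by (intro powr_mono2) auto
  also have "(3 / 2 + b) powr p + (3 / 2 + b) powr p \<le> 2 powr p * (3 / 2 + b) powr p"
  proof -
    have "(2 :: real) powr 1 \<le> 2 powr p" using p_gt_1 by (intro powr_mono) auto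
    then show ?thesis using mult_right_mono[of 2 "2 powr p" "(3 / 2 + b) powr p"] by simp
  qed
  also have "\<dots> = (3 + 2 * b) powr p" using b by (simp flip: powr_mult)
  finally show ?thesis by (simp add: b_def mult.assoc)
qed

text \<open>The supremum in the definition of \<open>radius\<close> is over a bounded set containing \<open>0\<close>, which
  excludes the junk values of \<open>SUP\<close>.\<close>

lemma zero_in_ellipsoid: "0 \<in> K"
  by (simp add: ellipsoid_gauge gauge_def Rn_def fun_apply)

lemma bdd_above_norms: "bdd_above (norm_N N ` (E \<inter> K))"
  using norm_le_in_ellipsoid by (intro bdd_aboveI2) auto

lemma radius_ge: "y \<in> E \<Longrightarrow> y \<in> K \<Longrightarrow> norm_N N y \<le> radius N K E"
  unfolding radius_def by (rule cSUP_upper[OF _ bdd_above_norms]) auto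

lemma radius_le:
  assumes "E \<in> grassmannian N n" "\<And>y. y \<in> E \<Longrightarrow> y \<in> K \<Longrightarrow> norm_N N y \<le> c"
  shows "radius N K E \<le> c"
  unfolding radius_def
  using assms fvs.subspace_0[OF grassmannian_subspace[OF assms(1)]] zero_in_ellipsoid by (intro cSUP_least) auto

lemma radius_ge_gauge:
  assumes E: "E \<in> grassmannian N n" and y: "y \<in> E" "gauge N p \<sigma> y \<le> D powr p" and D: "D > 0"
  shows "norm_N N y / D \<le> radius N K E"
proof -
  let ?y = "fscale (1 / D) y"
  have "gauge N p \<sigma> ?y \<le> (1 / D) powr p * D powr p"
    using D y(2) by (simp add: gauge_scale mult_left_mono)
  also have "\<dots> = 1" using D by (simp add: powr_mult[symmetric])
  finally have g: "gauge N p \<sigma> ?y \<le> 1" .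
  have yE: "?y \<in> E" using y(1) grassmannian_subspace[OF E] by (intro fvs.subspace_scale) auto
  then have "?y \<in> K" using g grassmannian_subset_Rn[OF E] by (auto simp: ellipsoid_gauge)
  from radius_ge[OF yE this] show ?thesis using D by (simp add: norm_N_scale)
qed

lemma radius_nonneg: "E \<in> grassmannian N n \<Longrightarrow> 0 \<le> radius N K E"
  using radius_ge[of 0 E] zero_in_ellipsoid fvs.subspace_0[OF grassmannian_subspace] by simp

lemma radius_le_const: "E \<in> grassmannian N n \<Longrightarrow> radius N K E \<le> sqrt (1 + axis_sum_bound)"
  by (erule radius_le) (rule norm_le_in_ellipsoid)

text \<open>A deterministic bound from an arbitrary unit vector of \<open>E\<close>. It is far too
  weak for large \<open>N\<close> and serves only for bounded dimensions.\<close>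

lemma radius_ge_const:
  assumes E: "E \<in> grassmannian N n" and n: "n < N"
  shows "1 / (3 + 2 * sqrt N * LN powr \<beta>) \<le> radius N K E"
proof -
  have "fvs.dim E \<noteq> 0" using E n by (auto simp: grassmannian_def)
  have "\<exists>y\<in>E. y \<noteq> 0"
  proof (rule ccontr)
    assume "\<not> (\<exists>y\<in>E. y \<noteq> 0)"
    then have "E \<subseteq> fvs.span {}" by auto
    then have "fvs.dim E \<le> 0" using fvs.dim_le_card[of E "{}"] by simp
    then show False using \<open>fvs.dim E \<noteq> 0\<close> by simp
  qed
  then obtain y where y: "y \<in> E" "y \<noteq> 0" by blast
  have Rn: "y \<in> Rn N" using y grassmannian_subset_Rn[OF E] by auto
  then have nz: "norm_N N y > 0" using norm_N_eq_zero_iff[of y N] y(2) norm_N_nonneg[of N y] by linarith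
  define u where "u = fscale (1 / norm_N N y) y"
  have u: "norm_N N u = 1" "u \<in> E" "u \<in> Rn N"
  proof -
    show "norm_N N u = 1" using nz by (simp add: u_def norm_N_scale)
    show "u \<in> E" unfolding u_def using y grassmannian_subspace[OF E] by (intro fvs.subspace_scale) auto
    then show "u \<in> Rn N" using grassmannian_subset_Rn[OF E] by auto
  qed
  have u_le: "\<bar>u i\<bar> \<le> 1" for i using abs_le_norm_N[OF u(3), of i] u(1) by simp
  have "gauge N p \<sigma> u \<le> (3 + 2 * sqrt N * LN powr \<beta> * 1) powr p"
    using u_le by (intro gauge_flat_le order_trans[OF u_le]) auto
  then show ?thesis
    using radius_ge_gauge[OF E u(2), of "3 + 2 * sqrt N * LN powr \<beta>"] u(1) by (simp add: add_pos_nonneg)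
qed

lemma radius_ge_of_near_unit:
  assumes E: "E \<in> grassmannian N n" and y: "y \<in> E" "\<And>i. \<bar>unit_vec 1 i - y i\<bar> \<le> \<eta>" and \<eta>: "0 \<le> \<eta>" "\<eta> \<le> 1 / 2"
  shows "1 / (2 * (3 + 2 * sqrt N * LN powr \<beta> * \<eta>)) \<le> radius N K E"
proof -
  have y1: "\<bar>y 1\<bar> \<le> 3 / 2" "1 / 2 \<le> y 1" using y(2)[of 1] \<eta> by (auto simp: unit_vec_def)
  have "\<bar>y i\<bar> \<le> \<eta>" if "i \<in> {2..N}" for i using y(2)[of i] that by (auto simp: unit_vec_def)
  then have g: "gauge N p \<sigma> y \<le> (3 + 2 * sqrt N * LN powr \<beta> * \<eta>) powr p"
    using y1 \<eta> by (intro gauge_flat_le) auto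
  have pos: "3 + 2 * sqrt N * LN powr \<beta> * \<eta> > 0" using \<eta> by (simp add: add_pos_nonneg)
  have "1 / 2 \<le> norm_N N y"
    using abs_le_norm_N[of y N 1] y1 y(1) grassmannian_subset_Rn[OF E] by auto
  then have "(1 / 2) / (3 + 2 * sqrt N * LN powr \<beta> * \<eta>) \<le> norm_N N y / (3 + 2 * sqrt N * LN powr \<beta> * \<eta>)"
    using pos by (intro divide_right_mono) auto
  also have "\<dots> \<le> radius N K E" by (rule radius_ge_gauge[OF E y(1) g pos])
  finally show ?thesis by simp
qed

end

locale random_section = haar_grassmannian N n M + log_ellipsoid p \<alpha> \<beta> N
  for N n :: nat and M and p \<alpha> \<beta> :: real
begin

text \<open>\<open>radius\<close> is lower semicontinuous: \<open>t < radius N K E\<close> holds iff \<open>P\<^sub>E x\<close> lies in the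
  interior of \<open>K\<close> and has norm larger than \<open>t\<close> for some \<open>x\<close>.\<close>

lemma measurable_radius: "radius N K \<in> borel_measurable M"
proof (rule borel_measurableI_greater)
  fix t :: real
  show "{E \<in> space M. t < radius N K E} \<in> sets M"
  proof (cases "t < 0")
    case True
    then have "{E \<in> space M. t < radius N K E} = space M"
      using radius_nonneg by (auto simp: space_M intro: less_le_trans)
    then show ?thesis by simp
  next
    case False
    define ev where "ev m x = (\<lambda>i. \<Sum>j=1..N. m (i, j) * x j)" for m :: "nat \<times> nat \<Rightarrow> real" and x :: "nat \<Rightarrow> real"
    define V where "V x = {m. gauge N p \<sigma> (ev m x) < 1} \<inter> {m. t < norm_N N (ev m x)}" for x
    have evc: "continuous_on UNIV (\<lambda>m. ev m x i)" for x i
      unfolding ev_def by (intro continuous_intros continuous_on_coordinate)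
    have open_V: "open (V x)" for x
      unfolding V_def
    proof (intro open_Int open_Collect_less)
      show "continuous_on UNIV (\<lambda>m. gauge N p \<sigma> (ev m x))"
        unfolding gauge_def using p_gt_1 \<sigma>_pos
        by (intro continuous_on_sum continuous_on_powr' continuous_on_divide continuous_intros evc) 
           (fastforce intro: divide_nonneg_pos)+
      show "continuous_on UNIV (\<lambda>m. norm_N N (ev m x))"
        unfolding norm_N_def L2_set_def by (intro continuous_intros evc)
    qed (auto intro: continuous_intros)
    have ev: "ev (proj_matrix N E) x = orth_proj N E x" if "E \<in> space M" "x \<in> Rn N" for E x
      unfolding ev_def using orth_proj_entries[OF that(1)[unfolded space_M] that(2)] by auto
    have "{E \<in> space M. t < radius N K E} = (\<Union>x\<in>Rn N. {E \<in> space M. proj_matrix N E \<in> V x})"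
    proof safe
      fix E assume E: "E \<in> space M" and t: "t < radius N K E"
      note g = E[unfolded space_M]
      have "norm_N N ` (E \<inter> K) \<noteq> {}"
        using fvs.subspace_0[OF grassmannian_subspace[OF g]] zero_in_ellipsoid by auto
      then obtain y where y: "y \<in> E" "y \<in> K" "t < norm_N N y"
        using t less_cSUP_iff[of "E \<inter> K" "norm_N N" t] bdd_above_norms unfolding radius_def by auto
      have pos: "norm_N N y > 0" using y(3) False by simp
      \<comment> \<open>Shrinking \<open>y\<close> slightly moves it into the interior of the
        ellipsoid while its norm still exceeds \<open>t\<close>; this makes the condition
        open.\<close>
      obtain c where c: "t / norm_N N y < c" "c < 1"
        using dense[of "t / norm_N N y" 1] y(3) pos by auto
      have c0: "0 \<le> c" using c(1) False pos by (meson divide_nonneg_pos less_imp_le linorder_not_less order_trans)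
      define x where "x = fscale c y"
      have x: "x \<in> E" unfolding x_def using y grassmannian_subspace[OF g] by (intro fvs.subspace_scale) auto
      then have xR: "x \<in> Rn N" using grassmannian_subset_Rn[OF g] by auto
      have "c powr p < 1" using c0 c(2) p_gt_1 powr_less_mono2[of p c 1] by simp
      moreover have "c powr p * gauge N p \<sigma> y \<le> c powr p * 1"
        using y(2) by (intro mult_left_mono) (auto simp: ellipsoid_gauge)
      ultimately have "gauge N p \<sigma> x < 1" using c0 by (simp add: x_def gauge_scale)
      moreover have "t < norm_N N x" using c(1) c0 pos by (simp add: x_def norm_N_scale divide_less_eq)
      ultimately have "proj_matrix N E \<in> V x" using ev[OF E xR] orth_proj_ident[OF g x] by (simp add: V_def)
      then show "E \<in> (\<Union>x\<in>Rn N. {E \<in> space M. proj_matrix N E \<in> V x})" using E xR by auto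
    next
      fix E x assume E: "E \<in> space M" and x: "x \<in> Rn N" and V: "proj_matrix N E \<in> V x"
      note g = E[unfolded space_M]
      have "orth_proj N E x \<in> K" "t < norm_N N (orth_proj N E x)"
        using V ev[OF E x] orth_proj_Rn[OF g] by (auto simp: V_def ellipsoid_gauge)
      then show "t < radius N K E" using radius_ge[OF orth_proj_in[OF g], of x] by linarith
    qed
    moreover have "openin (grassmannian_topology N n) (\<Union>x\<in>Rn N. {E \<in> space M. proj_matrix N E \<in> V x})"
      using openin_vimage[OF open_V] by (intro openin_Union) auto
    ultimately show ?thesis using openin_sets by simp
  qed
qed

text \<open>The final estimates pass to complements of exceptional sets, and \<open>measure\<close>
  is 0 on nonmeasurable sets, so this cannot be dispensed with.\<close>

lemma measurable_approx_eq: "{E \<in> space M. approx_eq C (radius N K E) b} \<in> sets M"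
  unfolding approx_eq_def using measurable_radius by measurable

end

section \<open>Upper bound for the radius\<close>

definition segment :: "nat \<Rightarrow> nat \<Rightarrow> (nat \<Rightarrow> real) \<Rightarrow> nat \<Rightarrow> real" where
  "segment r s y = (\<lambda>i. if r < i \<and> i \<le> s then y i else 0)"

lemma segment_add: "r \<le> s \<Longrightarrow> s \<le> t \<Longrightarrow> segment r t y = segment r s y + segment s t y"
  by (auto simp: segment_def fun_eq_iff fun_apply)

lemma segment_supported: "segment r s y \<in> supported {1..s}"
  by (auto simp: segment_def supported_def)

lemma sqrt_2_bounds: "7 / 5 \<le> sqrt (2 :: real)" "sqrt (2 :: real) \<le> 3 / 2"
  by (rule real_le_rsqrt, simp add: power2_eq_square) (rule real_le_lsqrt, simp_all add: power2_eq_square)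

lemma powr_square: "(x powr u)\<^sup>2 = x powr (2 * u)" for x u :: real
  by (simp add: power2_eq_square flip: powr_add)

context random_section
begin

text \<open>For a block whose length is at most \<open>q\<close> times its starting index, the
  powers of the index in \<open>block_sum_le\<close> cancel and only the logarithm remains;
  \<open>log\<close> makes that logarithm comparable to \<open>LN\<close>.\<close>

lemma norm_segment_le:
  assumes y: "y \<in> K" and q: "q \<ge> 1" and s: "real s - real r \<le> b" "0 < b" "b \<le> q * real (Suc r)"
    and log: "LN / 2 \<le> ln (real r + 2)"
  shows "norm_N N (segment r s y) \<le> sqrt (2 * q) * (2 powr \<beta> * LN powr (- \<beta>))"
proof (rule power2_le_imp_le)
  let ?B = "{i \<in> {1..N}. r < i \<and> i \<le> s}"
  have "(norm_N N (segment r s y))\<^sup>2 = (\<Sum>i\<in>?B. (y i)\<^sup>2)"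
    unfolding norm_N_sum segment_def by (intro sum.mono_neutral_cong_right) auto
  also have "\<dots> \<le> 2 * b powr (2 * \<alpha>) * (\<sigma> (Suc r))\<^sup>2"
  proof (rule block_sum_le[OF y])
    have "card ?B \<le> card {Suc r..s}" by (intro card_mono) auto
    then have "real (card ?B) \<le> real (s - r)" by simp
    also have "real (s - r) \<le> b" using s(1,2) by (cases "r \<le> s") (simp_all add: of_nat_diff)
    finally show "real (card ?B) \<le> b" .
  qed (use s in auto)
  also have "(\<sigma> (Suc r))\<^sup>2 = real (Suc r) powr (- (2 * \<alpha>)) * ln (real r + 2) powr (- (2 * \<beta>))"
    unfolding log_semiaxes_def power_mult_distrib powr_square by (simp add: add.commute)
  also have "2 * b powr (2 * \<alpha>) * (real (Suc r) powr (- (2 * \<alpha>)) * ln (real r + 2) powr (- (2 * \<beta>)))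
      \<le> 2 * (q * real (Suc r)) powr (2 * \<alpha>) * (real (Suc r) powr (- (2 * \<alpha>)) * (LN / 2) powr (- (2 * \<beta>)))"
  proof (intro mult_mono order_refl)
    show "b powr (2 * \<alpha>) \<le> (q * real (Suc r)) powr (2 * \<alpha>)" using s \<alpha>_pos by (intro powr_mono2) auto
    show "ln (real r + 2) powr (- (2 * \<beta>)) \<le> (LN / 2) powr (- (2 * \<beta>))"
      using \<beta>_pos log log_ge_1 N_ge_2 by (intro powr_mono2') auto
  qed auto
  also have "\<dots> = 2 * q powr (2 * \<alpha>) * (LN / 2) powr (- (2 * \<beta>))"
  proof -
    have "real (Suc r) powr (2 * \<alpha>) * real (Suc r) powr (- (2 * \<alpha>)) = 1" by (simp flip: powr_add)
    moreover have "2 * (x * u) * (v * w) = 2 * x * w * (u * v)" for x u v w :: real by simp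
    ultimately show ?thesis by (simp only: powr_mult mult_1_right)
  qed
  also have "\<dots> \<le> 2 * q * (LN / 2) powr (- (2 * \<beta>))"
    using powr_mono[of "2 * \<alpha>" 1 q] q \<alpha>_less_half by (intro mult_right_mono) auto
  also have "\<dots> = (sqrt (2 * q) * (2 powr \<beta> * LN powr (- \<beta>)))\<^sup>2"
  proof -
    have "(2 powr \<beta> * LN powr (- \<beta>))\<^sup>2 = (LN / 2) powr (- (2 * \<beta>))"
      by (simp add: power_divide powr_square powr_divide powr_minus_divide)
    then show ?thesis using q by (simp add: power_mult_distrib)
  qed
  finally show "(norm_N N (segment r s y))\<^sup>2 \<le> \<dots>" .
qed (use q in auto)

lemma norm_le_of_head_event:
  assumes E: "E \<in> space M" and y: "y \<in> E" "y \<in> K" and q: "q \<ge> 1"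
    and log: "LN / 2 \<le> ln (real (n div q) + 2)"
    and up: "\<And>b x. b \<in> {n..N} \<Longrightarrow> x \<in> supported {1..b} \<Longrightarrow>
      norm_N N (x - orth_proj N E x) \<le> 12 * sqrt (b / N) * norm_N N x"
    and low: "\<And>x. x \<in> supported {1..n div q} \<Longrightarrow>
      sqrt (n / N) / 250 * norm_N N x \<le> norm_N N (x - orth_proj N E x)"
  shows "norm_N N y \<le> 30006 * sqrt (2 * real q) * 2 powr \<beta> * (sqrt (N / n) * LN powr (- \<beta>))"
proof -
  note g = E[unfolded space_M]
  let ?res = "\<lambda>x. norm_N N (x - orth_proj N E x)"
  define m where "m = n div q"
  define V where "V = sqrt (2 * real q) * (2 powr \<beta> * LN powr (- \<beta>))"
  have V: "V \<ge> 0" by (simp add: V_def)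
  have mn: "m \<le> n" by (simp add: m_def)
  have yR: "y \<in> Rn N" using y by (simp add: ellipsoid_gauge)
  have block0: "norm_N N (segment m n y) \<le> V"
    unfolding V_def
  proof (rule norm_segment_le[OF y(2), where b = "real n"])
    have "n < q * Suc m" using q unfolding m_def by (metis dividend_less_times_div less_le_trans mult_Suc_right add.commute zero_less_one)
    then have "real n \<le> real (q * Suc m)" by (simp only: of_nat_le_iff)
    then show "real n \<le> real q * real (Suc m)" by (simp only: of_nat_mult)
  qed (use q n_ge_1 log in \<open>auto simp: m_def\<close>)
  have block: "norm_N N (segment (2 ^ k * n) (2 ^ Suc k * n) y) \<le> V" for k
    unfolding V_def
  proof (rule norm_segment_le[OF y(2), where b = "2 ^ k * real n"])
    have "2 ^ k * real n \<le> 1 * real (Suc (2 ^ k * n))" by simp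
    also have "\<dots> \<le> real q * real (Suc (2 ^ k * n))" using q by (intro mult_right_mono) auto
    finally show "2 ^ k * real n \<le> real q * real (Suc (2 ^ k * n))" .
    have "n div q \<le> 2 ^ k * n" using mult_le_mono[of 1 "2 ^ k" "n div q" n] by simp
    then have "ln (real (n div q) + 2) \<le> ln (real (2 ^ k * n) + 2)"
      by (subst ln_le_cancel_iff) (auto simp del: of_nat_mult of_nat_power)
    then show "LN / 2 \<le> ln (real (2 ^ k * n) + 2)" using log by linarith
  qed (use q n_ge_1 in auto)
  \<comment> \<open>The last dyadic block may extend beyond \<open>N\<close>, where the event says
    nothing; there the trivial contraction bound suffices.\<close>
  have res_segment: "?res (segment r s y) \<le> 12 * sqrt (s / N) * norm_N N (segment r s y)" if "n \<le> s" for r s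
  proof (cases "s \<le> N")
    case True
    then show ?thesis using up[of s "segment r s y"] that segment_supported by auto
  next
    case False
    then have "1 \<le> real s / real N" using N_ge_2 by (simp add: le_divide_eq)
    then have "1 \<le> 12 * sqrt (s / N)" using real_sqrt_ge_one[of "s / N"] by linarith
    then have "1 * norm_N N (segment r s y) \<le> 12 * sqrt (s / N) * norm_N N (segment r s y)" by (intro mult_right_mono) auto
    then show ?thesis using norm_orth_proj_residual_le[OF g, of "segment r s y"] by linarith
  qed
  \<comment> \<open>All blocks have norm at most \<open>V\<close>, so both sums are dominated by
    geometric series with ratio \<open>sqrt 2\<close>. The constants 60 and 3 are large enough for
    the induction: \<open>60 + 12 * sqrt 2 \<le> 60 * sqrt 2\<close> and
    \<open>4 \<le> 3 * sqrt 2\<close>.\<close>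
  have res: "?res (segment m (2 ^ k * n) y) \<le> 60 * sqrt (real (2 ^ k * n) / N) * V \<and>
      norm_N N (segment m (2 ^ k * n) y) \<le> 3 * sqrt (2 ^ k) * V" for k
  proof (induction k)
    case 0
    have "?res (segment m n y) \<le> 12 * sqrt (n / N) * V"
      using res_segment[of n m] mult_left_mono[OF block0, of "12 * sqrt (n / N)"] by auto
    also have "\<dots> \<le> 60 * sqrt (n / N) * V" using V by (intro mult_right_mono) auto
    finally show ?case using block0 V by simp
  next
    case (Suc k)
    let ?s = "2 ^ k * n"
    let ?t = "2 ^ Suc k * n"
    have ms: "m \<le> ?s" using mn mult_le_mono[of 1 "2 ^ k" m n] by simp
    have split: "segment m ?t y = segment m ?s y + segment ?s ?t y" using ms by (intro segment_add) auto
    have t_eq: "sqrt (real ?t / N) = sqrt 2 * sqrt (real ?s / N)" by (simp flip: real_sqrt_mult)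
    have "n \<le> ?t" using mult_le_mono[of 1 "2 ^ Suc k" n n] by simp
    then have "?res (segment ?s ?t y) \<le> 12 * sqrt (real ?t / N) * V"
      using res_segment[of ?t ?s] mult_left_mono[OF block[of k], of "12 * sqrt (real ?t / N)"] by simp
    moreover have "?res (segment m ?t y) \<le> ?res (segment m ?s y) + ?res (segment ?s ?t y)"
      using residual_triangle[OF E, of "segment m ?t y" "segment m ?s y"] unfolding split by simp
    ultimately have "?res (segment m ?t y) \<le> 60 * sqrt (real ?s / N) * V + 12 * sqrt (real ?t / N) * V"
      using Suc by linarith
    also have "\<dots> = (60 + 12 * sqrt 2) * (sqrt (real ?s / N) * V)" unfolding t_eq by (simp add: algebra_simps)
    also have "\<dots> \<le> (60 * sqrt 2) * (sqrt (real ?s / N) * V)"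
      using V sqrt_2_bounds by (intro mult_right_mono) auto
    also have "\<dots> = 60 * sqrt (real ?t / N) * V" unfolding t_eq by (simp add: algebra_simps)
    finally have 1: "?res (segment m ?t y) \<le> 60 * sqrt (real ?t / N) * V" .
    have "norm_N N (segment m ?t y) \<le> norm_N N (segment m ?s y) + norm_N N (segment ?s ?t y)"
      unfolding split by (rule norm_N_triangle)
    also have "\<dots> \<le> 3 * sqrt (2 ^ k) * V + V" using Suc block[of k] by linarith
    also have "\<dots> \<le> 3 * sqrt (2 ^ k) * V + sqrt (2 ^ k) * V"
      using mult_right_mono[OF real_sqrt_ge_one[OF one_le_power[of "2 :: real" k]] V] by (simp add: mult.commute)
    also have "\<dots> = 4 * (sqrt (2 ^ k) * V)" by simp
    also have "\<dots> \<le> (3 * sqrt 2) * (sqrt (2 ^ k) * V)"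
      using V sqrt_2_bounds by (intro mult_right_mono) auto
    also have "\<dots> = 3 * sqrt (2 ^ Suc k) * V" by (simp add: real_sqrt_mult)
    finally show ?case using 1 by blast
  qed
  obtain k where k: "N \<le> 2 ^ Suc k * n" "2 ^ k * n < N"
  proof -
    define P where "P k \<longleftrightarrow> N \<le> 2 ^ k * n" for k
    have "N < 2 ^ N" by (rule less_exp)
    also have "(2 :: nat) ^ N \<le> 2 ^ N * n" using n_ge_1 by simp
    finally have "P N" by (simp add: P_def)
    moreover have "\<not> P 0" using n_less_N by (simp add: P_def)
    ultimately obtain k where "\<not> P k" "P (Suc k)" using ex_least_nat_less[of P N] by auto
    then show thesis using that[of k] by (simp add: P_def)
  qed
  let ?t = "2 ^ Suc k * n"
  define h where "h = segment 0 m y"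
  define t where "t = segment m ?t y"
  have "m \<le> ?t" using mn mult_le_mono[of 1 "2 ^ Suc k" m n] by simp
  then have y_split: "y = h + t"
    using k(1) yR unfolding h_def t_def by (auto simp: segment_def fun_eq_iff fun_apply Rn_def)
  have t_le: "real ?t \<le> 2 * real N" using k(2) of_nat_mono[of "2 ^ k * n" N, where ?'a = real] by simp
  have "?res t \<le> 60 * sqrt (real ?t / N) * V" using res[of "Suc k"] by (simp add: t_def)
  also have "\<dots> \<le> 60 * 2 * V"
  proof -
    have "real ?t \<le> 4 * real N" using t_le by linarith
    then have "real ?t / N \<le> 2\<^sup>2" using N_ge_2 by (intro mult_imp_div_pos_le) auto
    then have "sqrt (real ?t / N) \<le> 2" by (intro real_le_lsqrt) auto
    then show ?thesis using V by (intro mult_right_mono) auto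
  qed
  finally have rt: "?res t \<le> 120 * V" by simp
  \<comment> \<open>Here \<open>y \<in> E\<close> is used: the residuals of head and tail cancel.
    With \<open>low\<close> the bound \<open>120 * V\<close> for the tail becomes
    \<open>250 * 120 * V\<close> for the head, up to \<open>sqrt (N / n)\<close>.\<close>
  have "?res h = ?res t"
  proof -
    have "y - orth_proj N E y = 0" using orth_proj_ident[OF g y(1)] by simp
    then have "h - orth_proj N E h = - (t - orth_proj N E t)"
      using orth_proj_add[OF g, of h t] y_split by (simp add: algebra_simps)
    then show ?thesis by (simp only: norm_N_minus)
  qed
  moreover have "sqrt (n / N) / 250 * norm_N N h \<le> ?res h"
    using low[of h] segment_supported[of 0 m y] by (simp add: h_def m_def)
  ultimately have "sqrt (n / N) * norm_N N h \<le> 30000 * V" using rt by simp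
  then have "sqrt (N / n) * (sqrt (n / N) * norm_N N h) \<le> sqrt (N / n) * (30000 * V)" by (intro mult_left_mono) auto
  moreover have "sqrt (N / n) * sqrt (n / N) = 1" using n_ge_1 n_less_N by (simp flip: real_sqrt_mult)
  ultimately have nh: "norm_N N h \<le> 30000 * (sqrt (N / n) * V)" by (simp add: mult.assoc[symmetric])
  have "norm_N N t \<le> 3 * sqrt (2 ^ Suc k) * V" using res[of "Suc k"] by (simp only: t_def)
  also have "\<dots> \<le> 3 * (2 * sqrt (N / n)) * V"
  proof -
    have "2 ^ Suc k \<le> 2\<^sup>2 * (real N / real n)" using t_le n_ge_1 by (simp add: field_simps)
    then have "sqrt (2 ^ Suc k) \<le> sqrt (2\<^sup>2 * (real N / real n))" by (rule real_sqrt_le_mono)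
    also have "\<dots> = 2 * sqrt (N / n)" by (simp only: real_sqrt_mult real_sqrt_abs)
    finally show ?thesis using V by (intro mult_right_mono mult_left_mono) auto
  qed
  finally have "norm_N N t \<le> 6 * (sqrt (N / n) * V)" by simp
  then have "norm_N N y \<le> 30006 * (sqrt (N / n) * V)"
    using nh norm_N_triangle[of N h t] y_split by simp
  then show ?thesis by (simp add: V_def mult_ac)
qed

end

section \<open>Spread vectors\<close>

text \<open>The hypothesis says that the k-th largest value is at most \<open>\<phi> k\<close>,
  without sorting. Removing a small element of the whole set and recursing gives the sum.\<close>

lemma sum_powr_le_of_min:
  fixes y :: "nat \<Rightarrow> real" and \<phi> :: "nat \<Rightarrow> real"
  assumes "finite I" "\<And>S. S \<subseteq> I \<Longrightarrow> S \<noteq> {} \<Longrightarrow> \<exists>i\<in>S. f i \<le> \<phi> (card S)"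
  shows "(\<Sum>i\<in>I. f i) \<le> (\<Sum>k=1..card I. \<phi> k :: real)"
  using assms
proof (induction "card I" arbitrary: I)
  case 0
  then show ?case by simp
next
  case (Suc d)
  then have "I \<noteq> {}" by auto
  then obtain i where i: "i \<in> I" "f i \<le> \<phi> (card I)" using Suc.prems(2)[of I] by auto
  have card: "card (I - {i}) = d" using i Suc by simp
  have "(\<Sum>i\<in>I. f i) = f i + (\<Sum>i\<in>I - {i}. f i)" using Suc.prems(1) i(1) by (rule sum.remove)
  also have "(\<Sum>i\<in>I - {i}. f i) \<le> (\<Sum>k=1..card (I - {i}). \<phi> k)"
    using Suc.prems card by (intro Suc.hyps(1)) auto
  finally have "(\<Sum>i\<in>I. f i) \<le> f i + (\<Sum>k=1..d. \<phi> k)" by (simp only: card)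
  also have "\<dots> \<le> (\<Sum>k=1..Suc d. \<phi> k)" using i(2) unfolding Suc.hyps(2)[symmetric] by simp
  finally show ?case unfolding Suc.hyps(2) .
qed

context haar_grassmannian
begin

text \<open>If all \<open>k\<close> coordinates of \<open>P\<^sub>E e\<^sub>1\<close> in \<open>S\<close> are large, then it correlates with one of the \<open>2\<^sup>k\<close> sign
  vectors on \<open>S\<close>.\<close>

lemma all_coordinates_large_tail:
  assumes S: "S \<subseteq> {2..N}" "S \<noteq> {}" and \<phi>: "\<phi> \<ge> 0"
  obtains A where "A \<in> sets M" "measure M A \<le> 2 ^ card S * (sqrt 2 * exp (- (real (card S) * \<phi>) * (real N - 1) / 6))"
    "\<And>E. E \<in> space M \<Longrightarrow> E \<notin> A \<Longrightarrow> orth_proj N E (unit_vec 1) \<noteq> 0 \<Longrightarrow>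
      \<exists>i\<in>S. (orth_proj N E (unit_vec 1) i)\<^sup>2 \<le> \<phi> * (norm_N N (orth_proj N E (unit_vec 1)))\<^sup>2"
proof (cases "real (card S) * \<phi> \<le> 1")
  \<comment> \<open>The tail bound for correlations needs its parameter
    \<open>card S * \<phi>\<close> to be at most 1. Otherwise the claim holds for every
    \<open>E\<close>, since the coordinates in \<open>S\<close> would have too large a total
    square.\<close>
  case True
  have finS: "finite S" using S finite_subset by blast
  have card: "card S > 0" using S finS by (simp add: card_gt_0_iff)
  have sub: "S \<subseteq> {1..N}" using S by auto
  let ?z = "\<lambda>E. orth_proj N E (unit_vec 1)"
  \<comment> \<open>The sign vector that is \<open>+1\<close> on \<open>T\<close> and
    \<open>-1\<close> on the rest of \<open>S\<close>; for the right \<open>T\<close> its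
    correlation with the projection is the l1 norm on \<open>S\<close>.\<close>
  define sv where "sv T = (\<lambda>i. if i \<in> T then 1 else if i \<in> S then - 1 else 0 :: real)" for T
  define \<tau> where "\<tau> = real (card S) * \<phi>"
  define B where "B T = {E \<in> space M. ?z E \<noteq> 0 \<and> \<tau> * (norm_N N (?z E))\<^sup>2 * (norm_N N (sv T))\<^sup>2 \<le> (inner_N N (?z E) (sv T))\<^sup>2}" for T
  have u: "unit_vec 1 \<in> Rn N" using n_ge_1 n_less_N by (intro unit_vec_Rn) auto
  have B: "B T \<in> sets M" for T
  proof -
    have [measurable]: "(\<lambda>E. inner_N N (?z E) y) \<in> borel_measurable M" for y by (rule measurable_inner_orth_proj[OF u])
    have "(norm_N N (?z E))\<^sup>2 = inner_N N (?z E) (unit_vec 1)" if "E \<in> space M" for E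
      using norm_orth_proj that by (simp add: space_M)
    then have "B T = (space M - {E \<in> space M. ?z E = 0}) \<inter>
      {E \<in> space M. \<tau> * inner_N N (?z E) (unit_vec 1) * (norm_N N (sv T))\<^sup>2 \<le> (inner_N N (?z E) (sv T))\<^sup>2}"
      by (auto simp: B_def)
    moreover have "{E \<in> space M. ?z E = 0} \<in> sets M"
      using u by (intro orth_proj_eq_zero_null) (auto simp: unit_vec_def fun_eq_iff fun_apply)
    moreover have "{E \<in> space M. \<tau> * inner_N N (?z E) (unit_vec 1) * (norm_N N (sv T))\<^sup>2 \<le> (inner_N N (?z E) (sv T))\<^sup>2} \<in> sets M"
      by measurable
    ultimately show ?thesis by (simp only: sets.Int sets.Diff sets.top)
  qed
  have sv_supp: "sv T \<in> supported S" if "T \<subseteq> S" for T using that by (auto simp: sv_def supported_def)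
  have sv_norm: "(norm_N N (sv T))\<^sup>2 = real (card S)" if "T \<subseteq> S" for T
  proof -
    have "(norm_N N (sv T))\<^sup>2 = (\<Sum>i\<in>S. 1)"
      unfolding norm_N_sum using sub that by (intro sum.mono_neutral_cong_right) (auto simp: sv_def)
    then show ?thesis by simp
  qed
  show thesis
  proof (rule that[of "\<Union>T\<in>Pow S. B T"])
    show "(\<Union>T\<in>Pow S. B T) \<in> sets M" using B finS by auto
    have "measure M (\<Union>T\<in>Pow S. B T) \<le> (\<Sum>T\<in>Pow S. measure M (B T))"
      using B finS by (intro finite_measure_subadditive_finite) auto
    also have "\<dots> \<le> (\<Sum>T\<in>Pow S. sqrt 2 * exp (- \<tau> * (real N - 1) / 6))"
    proof (rule sum_mono)
      fix T assume T: "T \<in> Pow S"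
      then have "norm_N N (sv T) \<noteq> 0" using sv_norm[of T] card by auto
      then have "sv T \<noteq> 0" by auto
      then show "measure M (B T) \<le> sqrt 2 * exp (- \<tau> * (real N - 1) / 6)"
        unfolding B_def using T sv_supp[of T] supported_mono[OF S(1)] True \<phi>
        by (intro coordinate_correlation_tail) (auto simp: \<tau>_def)
    qed
    also have "\<dots> = 2 ^ card S * (sqrt 2 * exp (- \<tau> * (real N - 1) / 6))"
      using finS by (simp add: card_Pow)
    finally show "measure M (\<Union>T\<in>Pow S. B T) \<le> 2 ^ card S * (sqrt 2 * exp (- (real (card S) * \<phi>) * (real N - 1) / 6))"
      by (simp add: \<tau>_def)
    fix E assume E: "E \<in> space M" "E \<notin> (\<Union>T\<in>Pow S. B T)" and z0: "?z E \<noteq> 0"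
    let ?n = "norm_N N (?z E)"
    show "\<exists>i\<in>S. (?z E i)\<^sup>2 \<le> \<phi> * ?n\<^sup>2"
    proof (rule ccontr)
      assume "\<not> ?thesis"
      then have large: "\<phi> * ?n\<^sup>2 < (?z E i)\<^sup>2" if "i \<in> S" for i using that by force
      have large': "sqrt \<phi> * ?n \<le> \<bar>?z E i\<bar>" if "i \<in> S" for i
        using real_sqrt_le_mono[OF less_imp_le[OF large[OF that]]] by (simp add: real_sqrt_mult)
      define T where "T = {i \<in> S. 0 \<le> ?z E i}"
      have T: "T \<subseteq> S" by (auto simp: T_def)
      have "inner_N N (?z E) (sv T) = (\<Sum>i\<in>S. \<bar>?z E i\<bar>)"
        unfolding inner_N_def using sub by (intro sum.mono_neutral_cong_right) (auto simp: sv_def T_def)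
      moreover have "real (card S) * (sqrt \<phi> * ?n) \<le> (\<Sum>i\<in>S. \<bar>?z E i\<bar>)"
        using sum_mono[of S "\<lambda>_. sqrt \<phi> * ?n"] large' by simp
      ultimately have "(real (card S) * (sqrt \<phi> * ?n))\<^sup>2 \<le> (inner_N N (?z E) (sv T))\<^sup>2"
        using \<phi> by (intro power_mono) auto
      moreover have "(real (card S) * (sqrt \<phi> * ?n))\<^sup>2 = \<tau> * ?n\<^sup>2 * (norm_N N (sv T))\<^sup>2"
        unfolding sv_norm[OF T] \<tau>_def power_mult_distrib using \<phi> by (simp add: power2_eq_square)
      ultimately have "E \<in> B T" using E(1) z0 by (simp add: B_def)
      then show False using E(2) T by auto
    qed
  qed
next
  case False
  show thesis
  proof (rule that[of "{}"])
    fix E assume E: "E \<in> space M"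
    let ?z = "orth_proj N E (unit_vec 1)"
    let ?n = "norm_N N ?z"
    show "\<exists>i\<in>S. (?z i)\<^sup>2 \<le> \<phi> * ?n\<^sup>2"
    proof (rule ccontr)
      assume "\<not> ?thesis"
      then have large: "\<phi> * ?n\<^sup>2 < (?z i)\<^sup>2" if "i \<in> S" for i using that by force
      have finS: "finite S" using S finite_subset by blast
      have "(\<Sum>i\<in>S. \<phi> * ?n\<^sup>2) < (\<Sum>i\<in>S. (?z i)\<^sup>2)" using large S finS by (intro sum_strict_mono) auto
      also have "\<dots> \<le> ?n\<^sup>2" unfolding norm_N_sum using S by (intro sum_mono2) auto
      finally have "real (card S) * \<phi> * ?n\<^sup>2 < 1 * ?n\<^sup>2" by simp
      then have "real (card S) * \<phi> < 1" by (rule mult_right_less_imp_less) simp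
      then show False using False by simp
    qed
  qed auto
qed

end

lemma sum_inverse_sqrt_le: "(\<Sum>k=1..m. 1 / sqrt (real k)) \<le> 2 * sqrt (real m)"
proof (induction m)
  case (Suc m)
  define a where "a = sqrt (real m)"
  define b where "b = sqrt (real (Suc m))"
  have ab: "0 \<le> a" "0 < b" "a\<^sup>2 = real m" "b\<^sup>2 = real m + 1" by (auto simp: a_def b_def)
  have "2 * a * b \<le> a\<^sup>2 + b\<^sup>2" using sum_squares_bound[of a b] by simp
  then have "2 * a * b + 1 \<le> 2 * b * b" using ab by (simp add: power2_eq_square)
  then have "2 * a + 1 / b \<le> 2 * b" using ab(2) by (simp add: field_simps)
  then show ?case using Suc by (simp add: a_def b_def)
qed simp

lemma powr_add_le:
  fixes a b q :: real
  assumes "a \<ge> 0" "b \<ge> 0" "q \<ge> 0" shows "(a + b) powr q \<le> 2 powr q * (a powr q + b powr q)"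
proof -
  have "(a + b) powr q \<le> (2 * max a b) powr q" using assms by (intro powr_mono2) auto
  also have "\<dots> = 2 powr q * (max a b) powr q" by (rule powr_mult)
  also have "\<dots> \<le> 2 powr q * (a powr q + b powr q)" by (intro mult_left_mono) (auto simp: max_def)
  finally show ?thesis .
qed

text \<open>The exponent per coordinate in the union bound over sets of size \<open>k\<close>: 4
  pays for the signs, the constants and a summable factor; the second term dominates
  \<open>ln (N / k)\<close> and pays for the choice of the set; the third leaves
  \<open>exp (- \<kappa> * N powr (2 / p))\<close>. The power replaces the logarithm because it sums
  easily.\<close>

definition level :: "real \<Rightarrow> real \<Rightarrow> nat \<Rightarrow> nat \<Rightarrow> real" where
  "level p \<kappa> N k = 4 + p * (N / k) powr (1 / p) + \<kappa> * N powr (2 / p) / k"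

definition level_const :: "real \<Rightarrow> real \<Rightarrow> real" where
  "level_const p \<kappa> = 24 powr (p / 2) * (2 * (4 + p) powr (p / 2) + \<kappa> powr (p / 2) * (\<Sum>k. real k powr (- (p / 2))))"

text \<open>The right-hand side is the order attained by coordinates of size
  \<open>N powr (- 1/2)\<close>. The powers \<open>p / 2\<close> of the terms of
  \<open>level\<close> turn into \<open>sqrt (N / k)\<close> and
  \<open>N * k powr (- p / 2)\<close>, each with sum of order \<open>N\<close>; this is the reason
  for the exponent \<open>2 / p\<close> in the probability.\<close>

lemma level_sum_le:
  assumes p: "p > 2" and \<kappa>: "\<kappa> \<ge> 0" and N: "N \<ge> 1" and m: "m \<le> N"
  shows "(\<Sum>k=1..m. (12 * level p \<kappa> N k / N) powr (p / 2)) \<le> level_const p \<kappa> * N powr (1 - p / 2)"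
proof -
  define q where "q = p / 2"
  have q: "q > 1" using p by (simp add: q_def)
  have term_le: "(12 * level p \<kappa> N k / N) powr q
      \<le> (24 / N) powr q * ((4 + p) powr q * (sqrt N * (1 / sqrt k)) + \<kappa> powr q * N * real k powr (- q))"
    if k: "k \<in> {1..m}" for k
  proof -
    have "1 \<le> (real N / real k) powr (1 / p)" using k m p by (intro ge_one_powr_ge_zero) auto
    then have "level p \<kappa> N k \<le> (4 + p) * (N / k) powr (1 / p) + \<kappa> * N powr (2 / p) / k"
      by (simp add: level_def distrib_right)
    then have "12 * level p \<kappa> N k / N \<le> 12 * ((4 + p) * (N / k) powr (1 / p) + \<kappa> * N powr (2 / p) / k) / N"
      by (intro divide_right_mono mult_left_mono) auto
    then have "(12 * level p \<kappa> N k / N) powr q \<le> (12 / N * ((4 + p) * (N / k) powr (1 / p) + \<kappa> * N powr (2 / p) / k)) powr q"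
      using p \<kappa> q by (intro powr_mono2) (auto simp: level_def)
    also have "\<dots> = (12 / N) powr q * ((4 + p) * (N / k) powr (1 / p) + \<kappa> * N powr (2 / p) / k) powr q"
      by (rule powr_mult)
    also have "\<dots> \<le> (12 / N) powr q * (2 powr q * (((4 + p) * (N / k) powr (1 / p)) powr q + (\<kappa> * N powr (2 / p) / k) powr q))"
      using p \<kappa> q by (intro mult_left_mono powr_add_le) auto
    also have "\<dots> = (24 / N) powr q * (((4 + p) * (N / k) powr (1 / p)) powr q + (\<kappa> * N powr (2 / p) / k) powr q)"
      using powr_mult[of "12 / N" 2 q] by simp
    also have "((4 + p) * (N / k) powr (1 / p)) powr q = (4 + p) powr q * (N / k) powr (1 / 2)"
      using p by (simp add: powr_mult powr_powr q_def)
    also have "(N / k) powr (1 / 2) = sqrt N * (1 / sqrt k)"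
      by (simp add: powr_half_sqrt real_sqrt_divide)
    also have "(\<kappa> * N powr (2 / p) / k) powr q = \<kappa> powr q * N * real k powr (- q)"
      using p N by (simp add: powr_mult powr_divide powr_powr q_def powr_minus_divide)
    finally show ?thesis .
  qed
  have summ: "summable (\<lambda>k. real k powr (- q))" using q by (subst summable_real_powr_iff) simp
  have "(\<Sum>k=1..m. (12 * level p \<kappa> N k / N) powr q)
      \<le> (\<Sum>k=1..m. (24 / N) powr q * ((4 + p) powr q * (sqrt N * (1 / sqrt k)) + \<kappa> powr q * N * real k powr (- q)))"
    by (rule sum_mono) (rule term_le)
  also have "\<dots> = (24 / N) powr q * ((4 + p) powr q * (sqrt N * (\<Sum>k=1..m. 1 / sqrt k)) + \<kappa> powr q * N * (\<Sum>k=1..m. real k powr (- q)))"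
    by (simp only: sum_distrib_left sum.distrib distrib_left)
  also have "\<dots> \<le> (24 / N) powr q * ((4 + p) powr q * (sqrt N * (2 * sqrt N)) + \<kappa> powr q * N * (\<Sum>k. real k powr (- q)))"
  proof (intro mult_left_mono add_mono)
    show "(\<Sum>k=1..m. 1 / sqrt (real k)) \<le> 2 * sqrt N"
      using sum_inverse_sqrt_le[of m] m by (meson mult_left_mono of_nat_mono order_trans real_sqrt_le_mono zero_le_numeral)
    show "(\<Sum>k=1..m. real k powr (- q)) \<le> (\<Sum>k. real k powr (- q))"
      by (intro sum_le_suminf summ) auto
  qed auto
  also have "\<dots> = level_const p \<kappa> * (N / N powr q)"
    using N by (simp add: level_const_def q_def powr_divide algebra_simps)
  also have "N / N powr q = N powr (1 - q)" using N by (simp add: powr_diff)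
  finally show ?thesis by (simp add: q_def)
qed

definition spread_const :: "real \<Rightarrow> real \<Rightarrow> real" where
  "spread_const p \<kappa> = (1 + level_const p \<kappa>) powr (1 / p)"

lemma level_const_nonneg:
  assumes "p > 2" shows "level_const p \<kappa> \<ge> 0"
proof -
  have "summable (\<lambda>k. real k powr (- (p / 2)))" using assms by (subst summable_real_powr_iff) simp
  then have "0 \<le> (\<Sum>k. real k powr (- (p / 2)))" by (intro suminf_nonneg) auto
  then show ?thesis by (simp add: level_const_def)
qed

lemma spread_const_pos: "p > 2 \<Longrightarrow> spread_const p \<kappa> > 0"
  using level_const_nonneg[of p \<kappa>] by (simp add: spread_const_def)

context random_section
begin

text \<open>The normalised projection of the first unit vector is a witness: its gauge off the first
  coordinate is at most that of a flat vector, up to a constant, after all semiaxes are replaced by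
  the smallest.\<close>

lemma spread_event:
  assumes \<kappa>: "\<kappa> \<ge> 0"
  obtains A where "A \<in> sets M" "measure M A \<le> exp (- \<kappa> * N powr (2 / p))"
    "\<And>E. E \<in> space M \<Longrightarrow> E \<notin> A \<Longrightarrow> LN powr (- \<beta>) / spread_const p \<kappa> \<le> radius N K E"
proof -
  let ?z = "\<lambda>E. orth_proj N E (unit_vec 1)"
  \<comment> \<open>The factor 12 compensates the \<open>1/6\<close> in the tail bound and the
    passage from \<open>N - 1\<close> to \<open>N\<close>, since
    \<open>2 * (N - 1) \<ge> N\<close>.\<close>
  define \<phi> where "\<phi> k = 12 * level p \<kappa> N k / N" for k
  have level0: "level p \<kappa> N k \<ge> 0" for k using p_gt_1 \<kappa> by (simp add: level_def)
  have \<phi>0: "\<phi> k \<ge> 0" for k using level0[of k] by (simp add: \<phi>_def)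
  define \<S> where "\<S> k = {S. S \<subseteq> {2..N} \<and> card S = k}" for k
  have fin: "finite (\<S> k)" for k by (simp add: \<S>_def)
  have u: "unit_vec 1 \<in> Rn N" "unit_vec 1 \<noteq> 0"
    using N_ge_2 by (intro unit_vec_Rn, simp) (auto simp: unit_vec_def fun_eq_iff fun_apply)
  define P where "P S A \<longleftrightarrow> A \<in> sets M \<and>
      measure M A \<le> 2 ^ card S * (sqrt 2 * exp (- (real (card S) * \<phi> (card S)) * (real N - 1) / 6)) \<and>
      (\<forall>E. E \<in> space M \<longrightarrow> E \<notin> A \<longrightarrow> ?z E \<noteq> 0 \<longrightarrow>
        (\<exists>i\<in>S. (?z E i)\<^sup>2 \<le> \<phi> (card S) * (norm_N N (?z E))\<^sup>2))" for S A
  define A where "A S = (SOME A. P S A)" for S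
  have "\<exists>A. P S A" if S: "S \<subseteq> {2..N}" "S \<noteq> {}" for S
    by (rule all_coordinates_large_tail[OF S \<phi>0[of "card S"]]) (unfold P_def, blast)
  then have PA: "P S (A S)" if "S \<subseteq> {2..N}" "S \<noteq> {}" for S
    unfolding A_def using that by (intro someI_ex[of "P S"])
  have A: "\<And>S. S \<subseteq> {2..N} \<Longrightarrow> S \<noteq> {} \<Longrightarrow> A S \<in> sets M"
    "\<And>S. S \<subseteq> {2..N} \<Longrightarrow> S \<noteq> {} \<Longrightarrow> measure M (A S) \<le> 2 ^ card S * (sqrt 2 * exp (- (real (card S) * \<phi> (card S)) * (real N - 1) / 6))"
    "\<And>S E. S \<subseteq> {2..N} \<Longrightarrow> S \<noteq> {} \<Longrightarrow> E \<in> space M \<Longrightarrow> E \<notin> A S \<Longrightarrow> ?z E \<noteq> 0 \<Longrightarrow>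
      \<exists>i\<in>S. (?z E i)\<^sup>2 \<le> \<phi> (card S) * (norm_N N (?z E))\<^sup>2"
    using PA unfolding P_def by blast+
  define A0 where "A0 = {E \<in> space M. ?z E = 0}"
  have A0: "A0 \<in> sets M" "measure M A0 = 0" unfolding A0_def using u by (rule orth_proj_eq_zero_null)+
  have ne: "S \<noteq> {}" if "k \<in> {1..N}" "S \<in> \<S> k" for k S using that by (auto simp: \<S>_def)
  have AS: "A S \<in> sets M" if "k \<in> {1..N}" "S \<in> \<S> k" for k S
    using A(1)[of S] ne[OF that] that by (auto simp: \<S>_def)
  define U where "U k = (\<Union>S\<in>\<S> k. A S)" for k
  have U: "U k \<in> sets M" if "k \<in> {1..N}" for k unfolding U_def using AS[OF that] fin by auto
  have U_le: "measure M (U k) \<le> exp (- \<kappa> * N powr (2 / p)) * (1 / 2) ^ k" if k: "k \<in> {1..N}" for k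
  proof -
    have k1: "real k \<ge> 1" using k by simp
    have "measure M (U k) \<le> (\<Sum>S\<in>\<S> k. measure M (A S))"
      unfolding U_def using AS[OF k] fin by (intro finite_measure_subadditive_finite) auto
    also have "\<dots> \<le> (\<Sum>S\<in>\<S> k. 2 ^ k * (sqrt 2 * exp (- (real k * \<phi> k) * (real N - 1) / 6)))"
      using A(2) ne[OF k] by (intro sum_mono) (auto simp: \<S>_def)
    also have "\<dots> = real ((N - 1) choose k) * (2 ^ k * (sqrt 2 * exp (- (real k * \<phi> k) * (real N - 1) / 6)))"
      using n_subsets[of "{2..N}" k] by (simp add: \<S>_def)
    also have "\<dots> \<le> (exp (real k / real N * N) * (1 / (real k / real N)) ^ k) *
        (exp 1 ^ k * (exp 1 * exp (- (real k * level p \<kappa> N k))))"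
    proof (intro mult_mono)
      have "real ((N - 1) choose k) \<le> real (N choose k)"
        using k N_ge_2 by (cases N; cases k) auto
      also have "\<dots> \<le> exp (real k / real N * N) * (1 / (real k / real N)) ^ k"
        using k by (intro binomial_le_exp) auto
      finally show "real ((N - 1) choose k) \<le> \<dots>" .
      show "(2 :: real) ^ k \<le> exp 1 ^ k" using exp_1_ge by (intro power_mono) auto
      show "sqrt 2 \<le> exp (1 :: real)" using exp_1_ge sqrt_2_bounds by linarith
      have "real k * level p \<kappa> N k * (2 * (real N - 1) / N) \<ge> real k * level p \<kappa> N k * 1"
        using N_ge_2 level0[of k] by (intro mult_left_mono) (auto simp: le_divide_eq)
      moreover have "real k * level p \<kappa> N k * (2 * (real N - 1) / N) = - (- (real k * \<phi> k) * (real N - 1) / 6)"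
        by (simp add: \<phi>_def)
      ultimately show "exp (- (real k * \<phi> k) * (real N - 1) / 6) \<le> exp (- (real k * level p \<kappa> N k))"
        unfolding exp_le_cancel_iff by linarith
    qed auto
    also have "\<dots> = exp (2 * k + 1 + k * ln (N / k) - k * level p \<kappa> N k)"
    proof -
      have "(1 / (real k / real N)) ^ k = exp (k * ln (N / k))"
        using k by (simp add: exp_of_nat_mult)
      moreover have "real k / real N * N = k" using N_ge_2 by simp
      ultimately show ?thesis by (simp add: exp_of_nat_mult[symmetric] exp_add[symmetric])
    qed
    also have "\<dots> \<le> exp (- \<kappa> * N powr (2 / p) - k)"
    proof -
      have "ln (real N / real k) \<le> p * (N / k) powr (1 / p)"
        using ln_powr_bound[of "N / k" "1 / p"] k p_gt_1 by (simp add: mult.commute)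
      then have "k * ln (real N / real k) \<le> k * (p * (N / k) powr (1 / p))" by (intro mult_left_mono) auto
      moreover have "k * level p \<kappa> N k = 4 * k + k * (p * (N / k) powr (1 / p)) + \<kappa> * N powr (2 / p)"
        using k1 by (simp add: level_def distrib_left)
      ultimately show ?thesis using k1 unfolding exp_le_cancel_iff by linarith
    qed
    also have "\<dots> \<le> exp (- \<kappa> * N powr (2 / p)) * (1 / 2) ^ k"
    proof -
      have "(2 :: real) ^ k \<le> exp 1 ^ k" using exp_1_ge by (intro power_mono) auto
      then have "exp (- real k) \<le> (1 / 2) ^ k"
        by (simp add: exp_minus power_divide exp_of_nat_mult[symmetric] field_simps)
      moreover have "exp (- \<kappa> * N powr (2 / p) - k) = exp (- \<kappa> * N powr (2 / p)) * exp (- real k)"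
        by (simp flip: exp_add)
      ultimately show ?thesis by (simp only: mult_left_mono exp_ge_zero)
    qed
    finally show ?thesis .
  qed
  show thesis
  proof (rule that[of "A0 \<union> (\<Union>k\<in>{1..N}. U k)"])
    show meas: "A0 \<union> (\<Union>k\<in>{1..N}. U k) \<in> sets M" using U A0 by auto
    have "measure M (A0 \<union> (\<Union>k\<in>{1..N}. U k)) \<le> measure M A0 + measure M (\<Union>k\<in>{1..N}. U k)"
      using U A0 by (intro measure_Un_le) auto
    also have "\<dots> \<le> (\<Sum>k=1..N. measure M (U k))"
    proof -
      have "U ` {1..N} \<subseteq> sets M" using U by blast
      then show ?thesis using A0(2) finite_measure_subadditive_finite[of "{1..N}" U] by simp
    qed
    also have "\<dots> \<le> (\<Sum>k=1..N. exp (- \<kappa> * N powr (2 / p)) * (1 / 2) ^ k)" using U_le by (intro sum_mono)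
    also have "\<dots> = exp (- \<kappa> * N powr (2 / p)) * (\<Sum>k=1..N. (1 / 2) ^ k)" by (simp only: sum_distrib_left)
    also have "\<dots> \<le> exp (- \<kappa> * N powr (2 / p)) * 1"
      using geometric_tail_le[of "1 / 2" 1 N] by (intro mult_left_mono) auto
    finally show "measure M (A0 \<union> (\<Union>k\<in>{1..N}. U k)) \<le> exp (- \<kappa> * N powr (2 / p))" by simp
    fix E assume E: "E \<in> space M" and nA: "E \<notin> A0 \<union> (\<Union>k\<in>{1..N}. U k)"
    note g = E[unfolded space_M]
    have z0: "?z E \<noteq> 0" using E nA by (simp add: A0_def)
    have zR: "?z E \<in> Rn N" by (rule orth_proj_Rn[OF g])
    have nz: "norm_N N (?z E) > 0" using norm_N_eq_zero_iff[OF zR] z0 norm_N_nonneg[of N "?z E"] by linarith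
    define y where "y = fscale (1 / norm_N N (?z E)) (?z E)"
    have yE: "y \<in> E" unfolding y_def using grassmannian_subspace[OF g] orth_proj_in[OF g] by (intro fvs.subspace_scale) auto
    have yR: "y \<in> Rn N" using yE grassmannian_subset_Rn[OF g] by auto
    have ny: "norm_N N y = 1" using nz by (simp add: y_def norm_N_scale)
    have "(\<Sum>i\<in>{2..N}. \<bar>y i\<bar> powr p) \<le> (\<Sum>k=1..card {2..N}. \<phi> k powr (p / 2))"
    proof (rule sum_powr_le_of_min)
      fix S assume S: "S \<subseteq> {2..N}" "S \<noteq> {}"
      have "finite S" using S finite_subset by blast
      moreover have "card S \<le> card {2..N}" using S by (intro card_mono) auto
      ultimately have "card S \<in> {1..N}" using S by (auto simp: Suc_le_eq card_gt_0_iff)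
      then have "E \<notin> A S" using nA S(1) by (auto simp: U_def \<S>_def)
      then obtain i where i: "i \<in> S" "(?z E i)\<^sup>2 \<le> \<phi> (card S) * (norm_N N (?z E))\<^sup>2"
        using A(3)[OF S E _ z0] by blast
      have "(y i)\<^sup>2 \<le> \<phi> (card S)"
        using i(2) nz by (simp add: y_def fscale_def power_divide divide_le_eq)
      then have "((y i)\<^sup>2) powr (p / 2) \<le> \<phi> (card S) powr (p / 2)" using p_gt_1 by (intro powr_mono2) auto
      moreover have "((y i)\<^sup>2) powr (p / 2) = \<bar>y i\<bar> powr p"
      proof -
        have "(y i)\<^sup>2 = \<bar>y i\<bar> powr 2" by simp
        then show ?thesis by (simp only: powr_powr) simp
      qed
      ultimately show "\<exists>i\<in>S. \<bar>y i\<bar> powr p \<le> \<phi> (card S) powr (p / 2)" using i(1) by auto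
    qed simp
    also have "\<dots> \<le> level_const p \<kappa> * N powr (1 - p / 2)"
      unfolding \<phi>_def using p_gt_2 \<kappa> N_ge_2 by (intro level_sum_le) auto
    finally have flat: "(\<Sum>i\<in>{2..N}. \<bar>y i\<bar> powr p) \<le> level_const p \<kappa> * N powr (1 - p / 2)" .
    have L0: "level_const p \<kappa> \<ge> 0" using p_gt_2 by (rule level_const_nonneg)
    have \<sigma>N: "(1 / \<sigma> N) powr p = N powr (p / 2 - 1) * LN powr (\<beta> * p)"
    proof -
      have "1 / \<sigma> N = real N powr \<alpha> * LN powr \<beta>"
        using N_ge_2 by (simp add: log_semiaxes_def powr_minus_divide)
      moreover have "\<alpha> * p = p / 2 - 1" using p_gt_1 by (simp add: \<alpha>_eq field_simps)
      ultimately show ?thesis by (simp add: powr_mult powr_powr)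
    qed
    have "gauge N p \<sigma> y = (\<bar>y 1\<bar> / \<sigma> 1) powr p + (\<Sum>i=2..N. (\<bar>y i\<bar> / \<sigma> i) powr p)"
      unfolding gauge_def using N_ge_2 by (simp add: sum.atLeast_Suc_atMost numeral_2_eq_2)
    also have "\<dots> \<le> 1 + (\<Sum>i=2..N. (1 / \<sigma> N) powr p * \<bar>y i\<bar> powr p)"
    proof (intro add_mono sum_mono)
      have "\<bar>y 1\<bar> \<le> 1" using abs_le_norm_N[OF yR, of 1] ny by simp
      then have "\<bar>y 1\<bar> / \<sigma> 1 \<le> 1" using \<sigma>_1 by (simp add: divide_le_eq)
      then show "(\<bar>y 1\<bar> / \<sigma> 1) powr p \<le> 1" using \<sigma>_1 p_gt_1 powr_mono2[of p "\<bar>y 1\<bar> / \<sigma> 1" 1] by simp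
      fix i assume i: "i \<in> {2..N}"
      then have pos: "\<sigma> i > 0" "\<sigma> N \<le> \<sigma> i" "\<sigma> N > 0" using \<sigma>_pos \<sigma>_antimono N_ge_2 by auto
      have "(\<bar>y i\<bar> / \<sigma> i) powr p \<le> (1 / \<sigma> N * \<bar>y i\<bar>) powr p"
        using pos p_gt_1 by (intro powr_mono2) (auto intro: frac_le)
      also have "\<dots> = (1 / \<sigma> N) powr p * \<bar>y i\<bar> powr p" by (rule powr_mult)
      finally show "(\<bar>y i\<bar> / \<sigma> i) powr p \<le> (1 / \<sigma> N) powr p * \<bar>y i\<bar> powr p" .
    qed
    also have "\<dots> = 1 + (1 / \<sigma> N) powr p * (\<Sum>i=2..N. \<bar>y i\<bar> powr p)" by (simp only: sum_distrib_left)
    also have "\<dots> \<le> 1 + (1 / \<sigma> N) powr p * (level_const p \<kappa> * N powr (1 - p / 2))"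
      by (intro add_left_mono mult_left_mono flat) auto
    also have "(1 / \<sigma> N) powr p * (level_const p \<kappa> * N powr (1 - p / 2)) = level_const p \<kappa> * LN powr (\<beta> * p)"
    proof -
      have "N powr (p / 2 - 1) * N powr (1 - p / 2) = 1" using N_ge_2 by (simp flip: powr_add)
      moreover have "a * b * (l * c) = l * b * (a * c)" for a b c l :: real by simp
      ultimately show ?thesis unfolding \<sigma>N by simp
    qed
    \<comment> \<open>The contribution 1 of the first coordinate is absorbed because
      \<open>LN \<ge> 1\<close>.\<close>
    also have "1 + level_const p \<kappa> * LN powr (\<beta> * p) \<le> LN powr (\<beta> * p) + level_const p \<kappa> * LN powr (\<beta> * p)"
      using log_ge_1 \<beta>_pos p_gt_1 by (intro add_right_mono ge_one_powr_ge_zero) auto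
    also have "\<dots> = (spread_const p \<kappa> * LN powr \<beta>) powr p"
      using L0 p_gt_1 by (simp add: spread_const_def powr_mult powr_powr distrib_right)
    finally have gy: "gauge N p \<sigma> y \<le> (spread_const p \<kappa> * LN powr \<beta>) powr p" .
    have "spread_const p \<kappa> * LN powr \<beta> > 0"
      using spread_const_pos[OF p_gt_2] log_ge_1 N_ge_2 by (intro mult_pos_pos) auto
    from radius_ge_gauge[OF g yE gy this]
    show "LN powr (- \<beta>) / spread_const p \<kappa> \<le> radius N K E"
      by (simp add: ny powr_minus_divide mult.commute)
  qed
qed

end

section \<open>The three regimes\<close>

context random_section
begin

lemma good_event:
  assumes "G \<in> sets M" "A \<in> sets M" "\<And>E. E \<in> space M \<Longrightarrow> E \<notin> A \<Longrightarrow> E \<in> G"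
    and "measure M A \<le> b"
  shows "1 - b \<le> measure M G"
proof -
  have "space M - A \<subseteq> G" using assms by auto
  then have "measure M (space M - A) \<le> measure M G" using assms by (intro finite_measure_mono) auto
  then show ?thesis using prob_compl[OF assms(2)] assms(4) by simp
qed

text \<open>The deterministic estimate on the head event with \<open>q = 2402\<close>, the ratio of
  \<open>n\<close> to the head length; \<open>4804 = 2 * q\<close>.\<close>

lemma upper_event:
  assumes log: "LN / 2 \<le> ln (real (n div 2402) + 2)"
  obtains A where "A \<in> sets M" "measure M A \<le> 3 * exp (- 2 * real n)"
    "\<And>E. E \<in> space M \<Longrightarrow> E \<notin> A \<Longrightarrow>
      radius N K E \<le> 30006 * sqrt 4804 * 2 powr \<beta> * (sqrt (N / n) * LN powr (- \<beta>))"
proof (rule head_event)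
  fix A assume A: "A \<in> sets M" "measure M A \<le> 3 * exp (- 2 * real n)"
    and up: "\<And>E b x. E \<in> space M \<Longrightarrow> E \<notin> A \<Longrightarrow> b \<in> {n..N} \<Longrightarrow> x \<in> supported {1..b} \<Longrightarrow>
      norm_N N (x - orth_proj N E x) \<le> 12 * sqrt (b / N) * norm_N N x"
    and low: "\<And>E x. E \<in> space M \<Longrightarrow> E \<notin> A \<Longrightarrow> x \<in> supported {1..n div 2402} \<Longrightarrow>
      sqrt (n / N) / 250 * norm_N N x \<le> norm_N N (x - orth_proj N E x)"
  show thesis
  proof (rule that[OF A])
    fix E assume E: "E \<in> space M" "E \<notin> A"
    show "radius N K E \<le> 30006 * sqrt 4804 * 2 powr \<beta> * (sqrt (N / n) * LN powr (- \<beta>))"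
    proof (rule radius_le[OF E(1)[unfolded space_M]])
      fix y assume y: "y \<in> E" "y \<in> K"
      show "norm_N N y \<le> 30006 * sqrt 4804 * 2 powr \<beta> * (sqrt (N / n) * LN powr (- \<beta>))"
        using norm_le_of_head_event[OF E(1) y, of 2402] log up[OF E] low[OF E] by simp
    qed
  qed
qed

text \<open>A point of \<open>E\<close> close to the first unit vector in sup norm has a small
  gauge. The bound \<open>10 ^ 8\<close> on \<open>N\<close> gives \<open>sqrt N \<ge> 5000\<close>,
  hence a distance of at most \<open>1/2\<close>, so the first coordinate survives.\<close>

lemma lower_event:
  assumes n: "2000 * n \<le> N" and N: "10 ^ 8 \<le> N"
  obtains A where "A \<in> sets M" "measure M A \<le> 2 * exp (- 2 * real n) + exp (- real N / 400)"
    "\<And>E. E \<in> space M \<Longrightarrow> E \<notin> A \<Longrightarrow>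
      1 / (2 * (3 + 4608 * (LN powr \<beta> * sqrt (n / N)))) \<le> radius N K E"
proof -
  obtain A1 where A1: "A1 \<in> sets M" "measure M A1 \<le> 2 * exp (- 2 * real n)"
    "\<And>E b x. E \<in> space M \<Longrightarrow> E \<notin> A1 \<Longrightarrow> b \<in> {n..N} \<Longrightarrow> x \<in> supported {1..b} \<Longrightarrow>
      norm_N N (x - orth_proj N E x) \<le> 12 * sqrt (b / N) * norm_N N x"
    using initial_segment_event by blast
  define k where "k = N div 2000"
  have k: "2000 * k \<le> N" "1 \<le> k" "k \<le> N" using N by (auto simp: k_def)
  have kN: "real N \<le> 4000 * real k"
  proof -
    have "N < 2000 * (k + 1)" using dividend_less_times_div[of 2000 N] by (simp add: k_def)
    also have "\<dots> \<le> 4000 * k" using k by simp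
    finally have "real N \<le> real (4000 * k)" by (intro of_nat_mono) simp
    then show ?thesis by simp
  qed
  obtain A2 where A2: "A2 \<in> sets M" "measure M A2 \<le> exp (- real N / 400)"
    "\<And>E S x. E \<in> space M \<Longrightarrow> E \<notin> A2 \<Longrightarrow> S \<subseteq> {1..N} \<Longrightarrow> card S = k \<Longrightarrow> x \<in> supported S \<Longrightarrow>
      norm_N N (x - orth_proj N E x) \<le> norm_N N x / 2"
    using sparse_event[OF n k(1)] by blast
  show thesis
  proof (rule that[of "A1 \<union> A2"])
    show "A1 \<union> A2 \<in> sets M" using A1 A2 by auto
    show "measure M (A1 \<union> A2) \<le> 2 * exp (- 2 * real n) + exp (- real N / 400)"
      using A1(1,2) A2(1,2) measure_Un_le[of A1 M A2] by linarith
    fix E assume E: "E \<in> space M" "E \<notin> A1 \<union> A2"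
    note g = E(1)[unfolded space_M]
    \<comment> \<open>\<open>2304 = 3 * 12 * 64\<close>: truncation, the norm of the residual, and
      \<open>sqrt (N / k) \<le> 64\<close>, which follows from
      \<open>N \<le> 4000 * k\<close>.\<close>
    define \<eta> where "\<eta> = 2304 * sqrt (n / N) / sqrt N"
    have u: "unit_vec 1 \<in> supported {1..n}" "norm_N N (unit_vec 1) = 1" "unit_vec 1 \<in> Rn N"
    proof -
      show "unit_vec 1 \<in> supported {1..n}" using n_ge_1 by (auto simp: unit_vec_def supported_def)
      show R: "unit_vec 1 \<in> Rn N" using N_ge_2 by (intro unit_vec_Rn) auto
      have "(norm_N N (unit_vec 1))\<^sup>2 = 1"
        unfolding norm_N_power2 using N_ge_2 by (subst inner_N_unit_vec) (auto simp: unit_vec_def)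
      then show "norm_N N (unit_vec 1) = 1" using power2_eq_imp_eq[of "norm_N N (unit_vec 1)" 1] by simp
    qed
    have r: "norm_N N (unit_vec 1 - orth_proj N E (unit_vec 1)) \<le> 12 * sqrt (n / N)"
      using A1(3)[of E n "unit_vec 1"] E u n_less_N by auto
    have sparse: "norm_N N (x - orth_proj N E x) \<le> norm_N N x / 2"
      if "S \<subseteq> {1..N}" "card S = k" "x \<in> supported S" for S x
      using A2(3) E that by blast
    obtain y where y: "y \<in> E"
      "\<And>i. \<bar>unit_vec 1 i - y i\<bar> \<le> 3 * norm_N N (unit_vec 1 - orth_proj N E (unit_vec 1)) / sqrt k"
      by (rule approximate_in_sup_norm[OF E(1) k(2,3) _ u(3)]) (use sparse in blast)+
    have "sqrt N \<le> sqrt (64\<^sup>2 * real k)" using kN by (intro real_sqrt_le_mono) simp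
    also have "\<dots> = 64 * sqrt k" by (simp only: real_sqrt_mult real_sqrt_abs)
    finally have sk: "sqrt N \<le> 64 * sqrt k" .
    have "3 * norm_N N (unit_vec 1 - orth_proj N E (unit_vec 1)) / sqrt k \<le> 3 * (12 * sqrt (n / N)) / sqrt k"
      using r by (intro divide_right_mono mult_left_mono) auto
    also have "\<dots> = 36 * sqrt (n / N) * (1 / sqrt k)" by simp
    also have "\<dots> \<le> 36 * sqrt (n / N) * (64 / sqrt N)"
      using sk k N_ge_2 by (intro mult_left_mono) (auto simp: field_simps)
    also have "\<dots> = \<eta>" by (simp add: \<eta>_def)
    finally have y_near: "\<bar>unit_vec 1 i - y i\<bar> \<le> \<eta>" for i using y(2)[of i] by linarith
    have \<eta>: "0 \<le> \<eta>" "\<eta> \<le> 1 / 2"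
    proof -
      show "0 \<le> \<eta>" by (simp add: \<eta>_def)
      have "5000\<^sup>2 \<le> (10 :: real) ^ 8" by simp
      also have "\<dots> \<le> real N" using of_nat_mono[OF N, where ?'a = real] by simp
      finally have "5000 \<le> sqrt N" by (rule real_le_rsqrt)
      moreover have "sqrt (n / N) \<le> 1" using n_less_N by simp
      ultimately have "2304 * sqrt (n / N) \<le> 1 / 2 * sqrt N" "0 < sqrt N" by linarith+
      then show "\<eta> \<le> 1 / 2" unfolding \<eta>_def by (intro mult_imp_div_pos_le)
    qed
    have "2 * sqrt N * LN powr \<beta> * \<eta> = 4608 * (LN powr \<beta> * sqrt (n / N))"
      using N_ge_2 by (simp add: \<eta>_def)
    then show "1 / (2 * (3 + 4608 * (LN powr \<beta> * sqrt (n / N)))) \<le> radius N K E"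
      using radius_ge_of_near_unit[OF g y(1) y_near \<eta>] by (simp only:)
  qed
qed

text \<open>With \<open>t = exp (- \<gamma> * x)\<close> the claim is void for
  \<open>t \<ge> 1/3\<close>. Otherwise the rate \<open>1 / 400\<close>, more than twice
  \<open>\<gamma>\<close>, gives \<open>b \<le> 4 * t\<^sup>2\<close>, which is below
  \<open>3 * t\<close>.\<close>

lemma prob_bound_small:
  fixes \<gamma> x :: real
  assumes "\<gamma> * x \<le> x / 1000" "x \<ge> 0" "\<gamma> > 0" "b \<le> 3 * exp (- 2 * x) + exp (- x / 400)" "0 \<le> G" "1 - b \<le> G"
  shows "1 - 3 * exp (- \<gamma> * x) \<le> G"
proof (cases "exp (- \<gamma> * x) \<ge> 1 / 3")
  case True
  then show ?thesis using assms(5) by simp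
next
  case False
  define t where "t = exp (- \<gamma> * x)"
  have t: "t < 1 / 3" "t > 0" using False by (auto simp: t_def)
  have "exp (- 2 * x) \<le> exp (- x / 400)" using assms(2) by simp
  then have "b \<le> 4 * exp (- x / 400)" using assms(4) by linarith
  also have "exp (- x / 400) \<le> exp (- \<gamma> * x + - \<gamma> * x)" using assms(1,2) by simp
  also have "\<dots> = t * t" by (simp only: exp_add t_def)
  also have "t * t \<le> (1 / 3) * t" using t by (intro mult_right_mono) auto
  finally have "b \<le> 3 * t" using t by simp
  then show ?thesis using assms(6) by (simp add: t_def)
qed

lemma sqrt_ratio: "sqrt (real N / real n) = 1 / sqrt (real n / real N)"
  by (simp add: real_sqrt_divide)

lemma target_rate:
  "real n powr (- 1/2) * real N powr (1/2) * LN powr (- \<beta>) = sqrt (N / n) * LN powr (- \<beta>)"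
  by (simp add: powr_minus_divide powr_half_sqrt real_sqrt_divide)

text \<open>The range of \<open>n\<close> is exactly what keeps
  \<open>LN powr \<beta> * sqrt (n / N)\<close> bounded, so the lower bound of
  \<open>lower_event\<close> is a constant; the upper bound holds for every
  \<open>E\<close>.\<close>

lemma small_codimension:
  assumes n: "real n \<le> 1 / 2000 * real N * LN powr (- 2 * \<beta>)" and N: "10 ^ 8 \<le> N"
    and C: "10000 \<le> C" "sqrt (1 + axis_sum_bound) \<le> C"
  shows "1 - 3 * exp (- (1 / 1000) * real n) \<le> measure M {E \<in> space M. approx_eq C (radius N K E) 1}"
proof -
  have L: "LN powr (- 2 * \<beta>) \<le> 1" using log_ge_1 \<beta>_pos N_ge_2 powr_mono[of "- 2 * \<beta>" 0 LN] by simp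
  have "real n \<le> 1 / 2000 * real N * 1" using n mult_left_mono[OF L, of "1 / 2000 * real N"] by simp
  then have n': "2000 * n \<le> N" by linarith
  obtain A where A: "A \<in> sets M" "measure M A \<le> 2 * exp (- 2 * real n) + exp (- real N / 400)"
    "\<And>E. E \<in> space M \<Longrightarrow> E \<notin> A \<Longrightarrow> 1 / (2 * (3 + 4608 * (LN powr \<beta> * sqrt (n / N)))) \<le> radius N K E"
    using lower_event[OF n' N] by blast
  have s: "LN powr \<beta> * sqrt (n / N) \<le> 1"
  proof -
    have "(LN powr \<beta> * sqrt (n / N))\<^sup>2 = LN powr (2 * \<beta>) * (n / N)" by (simp add: power_mult_distrib powr_square)
    also have "\<dots> \<le> LN powr (2 * \<beta>) * (1 / 2000 * LN powr (- 2 * \<beta>))"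
      using n N_ge_2 by (intro mult_left_mono) (auto simp: divide_le_eq mult_ac)
    also have "\<dots> = 1 / 2000" using N_ge_2 by (simp add: powr_add[symmetric] mult.left_commute[of _ "1 / 2000"])
    finally have "(LN powr \<beta> * sqrt (n / N))\<^sup>2 \<le> 1\<^sup>2" by simp
    then show ?thesis by (rule power2_le_imp_le) simp
  qed
  have "1 - measure M A \<le> measure M {E \<in> space M. approx_eq C (radius N K E) 1}"
  proof (rule good_event[OF measurable_approx_eq A(1) _ order_refl])
    fix E assume E: "E \<in> space M" "E \<notin> A"
    have "1 / C \<le> 1 / 10000" using C(1) by (intro divide_left_mono) auto
    also have "\<dots> \<le> 1 / (2 * (3 + 4608 * (LN powr \<beta> * sqrt (n / N))))"
    proof (intro divide_left_mono mult_pos_pos add_pos_nonneg)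
      have "2 * (3 + 4608 * t) \<le> 10000" if "t \<le> 1" for t :: real using that by simp
      from this[OF s] show "2 * (3 + 4608 * (LN powr \<beta> * sqrt (n / N))) \<le> 10000" .
    qed auto
    also have "\<dots> \<le> radius N K E" by (rule A(3)[OF E])
    finally have "1 / C \<le> radius N K E" .
    moreover have "radius N K E \<le> C * 1" using radius_le_const[OF E(1)[unfolded space_M]] C(2) by simp
    ultimately show "E \<in> {E \<in> space M. approx_eq C (radius N K E) 1}" using E(1) by (simp add: approx_eq_def)
  qed
  moreover have "measure M A \<le> 3 * exp (- 2 * real n) + exp (- real n / 400)"
  proof -
    have "exp (- real N / 400) \<le> exp (- real n / 400)" using n_less_N by simp
    then show ?thesis using A(2) exp_gt_zero[of "- 2 * real n"] by linarith
  qed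
  ultimately show ?thesis using prob_bound_small[of "1 / 1000" "real n"] by simp
qed

lemma intermediate_codimension:
  assumes n: "1 / 2000 * real N * LN powr (- 2 * \<beta>) \<le> real n" "real n \<le> 1 / 2000 * real N" and N: "10 ^ 8 \<le> N"
    and log: "LN / 2 \<le> ln (real (n div 2402) + 2)"
    and C: "10000 \<le> C" "30006 * sqrt 4804 * 2 powr \<beta> \<le> C"
  shows "1 - 3 * exp (- (1 / 1000) * real n) \<le> measure M {E \<in> space M. approx_eq C (radius N K E)
    (real n powr (- 1/2) * real N powr (1/2) * LN powr (- \<beta>))}"
proof -
  have n': "2000 * n \<le> N" using n(2) by linarith
  obtain A1 where A1: "A1 \<in> sets M" "measure M A1 \<le> 2 * exp (- 2 * real n) + exp (- real N / 400)"
    "\<And>E. E \<in> space M \<Longrightarrow> E \<notin> A1 \<Longrightarrow> 1 / (2 * (3 + 4608 * (LN powr \<beta> * sqrt (n / N)))) \<le> radius N K E"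
    using lower_event[OF n' N] by blast
  obtain A2 where A2: "A2 \<in> sets M" "measure M A2 \<le> 3 * exp (- 2 * real n)"
    "\<And>E. E \<in> space M \<Longrightarrow> E \<notin> A2 \<Longrightarrow>
      radius N K E \<le> 30006 * sqrt 4804 * 2 powr \<beta> * (sqrt (N / n) * LN powr (- \<beta>))"
    using upper_event[OF log] by blast
  let ?s = "LN powr \<beta> * sqrt (n / N)"
  \<comment> \<open>The reverse inequality on \<open>n\<close> bounds \<open>?s\<close> from below,
    so the additive 3 in \<open>lower_event\<close> is absorbed into a multiple of
    \<open>?s\<close>, and the two bounds match at \<open>1 / ?s\<close>.\<close>
  have s: "1 / 50 \<le> ?s"
  proof (rule power2_le_imp_le)
    have "(1 / 50)\<^sup>2 \<le> (1 / 2000 :: real)" by (simp add: power2_eq_square)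
    also have "1 / 2000 = LN powr (2 * \<beta>) * (1 / 2000 * LN powr (- 2 * \<beta>))"
      using N_ge_2 by (simp add: powr_add[symmetric] mult.left_commute[of _ "1 / 2000"])
    also have "\<dots> \<le> LN powr (2 * \<beta>) * (n / N)"
      using n(1) N_ge_2 by (intro mult_left_mono) (auto simp: le_divide_eq mult_ac)
    also have "\<dots> = ?s\<^sup>2" by (simp add: power_mult_distrib powr_square)
    finally show "(1 / 50)\<^sup>2 \<le> ?s\<^sup>2" .
  qed simp
  have rate: "sqrt (N / n) * LN powr (- \<beta>) = 1 / ?s"
    by (simp add: sqrt_ratio powr_minus_divide)
  have "1 - measure M (A1 \<union> A2) \<le> measure M {E \<in> space M. approx_eq C (radius N K E) (1 / ?s)}"
  proof (rule good_event[OF measurable_approx_eq _ _ order_refl])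
    show "A1 \<union> A2 \<in> sets M" using A1 A2 by auto
    fix E assume E: "E \<in> space M" "E \<notin> A1 \<union> A2"
    have "2 * (3 + 4608 * t) \<le> 10000 * t" if "1 / 50 \<le> t" for t :: real using that by simp
    from this[OF s] have "2 * (3 + 4608 * ?s) \<le> 10000 * ?s" .
    also have "\<dots> \<le> C * ?s" using C(1) s by (intro mult_right_mono) auto
    finally have "2 * (3 + 4608 * ?s) \<le> C * ?s" .
    then have "1 / (C * ?s) \<le> 1 / (2 * (3 + 4608 * ?s))" by (intro frac_le) (auto simp: add_pos_nonneg)
    also have "\<dots> \<le> radius N K E" using A1(3) E by blast
    finally have "1 / ?s / C \<le> radius N K E" by (simp add: mult.commute)
    moreover have "radius N K E \<le> C * (1 / ?s)"
    proof -
      have "radius N K E \<le> 30006 * sqrt 4804 * 2 powr \<beta> * (1 / ?s)" using A2(3)[of E] E unfolding rate by blast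
      also have "\<dots> \<le> C * (1 / ?s)" using C(2) s by (intro mult_right_mono) auto
      finally show ?thesis .
    qed
    ultimately show "E \<in> {E \<in> space M. approx_eq C (radius N K E) (1 / ?s)}" using E(1) by (simp add: approx_eq_def)
  qed
  moreover have "measure M (A1 \<union> A2) \<le> 3 * exp (- 2 * real n) + exp (- real n / 400)"
  proof -
    have "measure M (A1 \<union> A2) \<le> 5 * exp (- 2 * real n) + exp (- real N / 400)"
      using A1(1,2) A2(1,2) measure_Un_le[of A1 M A2] by linarith
    \<comment> \<open>The surplus over the form required by \<open>prob_bound_small\<close>. As
      \<open>N \<ge> 2000 * n\<close>, its parts are at most \<open>2 * 3/10\<close> and
      \<open>2/5\<close> of the right-hand side.\<close>
    moreover have "2 * exp (- 2 * real n) + exp (- real N / 400) \<le> exp (- real n / 400)"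
    proof -
      have "real N \<ge> 2000 * real n" using of_nat_mono[OF n', where ?'a = real] by simp
      then have "exp (- real N / 400) \<le> exp (- real n / 400 + - real n)" by simp
      also have "\<dots> \<le> exp (- real n / 400) * exp (- 1)" unfolding exp_add using n_ge_1 by (intro mult_left_mono) auto
      also have "\<dots> \<le> exp (- real n / 400) * (2 / 5)"
        using exp_1_ge by (intro mult_left_mono) (auto simp: exp_minus field_simps)
      finally have 1: "exp (- real N / 400) \<le> exp (- real n / 400) * (2 / 5)" .
      have "exp (- 2 * real n) \<le> exp (- real n / 400 + - (3 / 2))" using n_ge_1 by simp
      also have "\<dots> \<le> exp (- real n / 400) * (3 / 10)"
      proof -
        have "10 / 3 \<le> exp (3 / 2 :: real)" 
        proof -
          have "(10 / 3)\<^sup>2 \<le> (5 / 2 :: real) ^ 3" by (simp add: power2_eq_square power3_eq_cube)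
          also have "\<dots> \<le> exp 3" using exp_of_nat_ge[of 3] by simp
          also have "\<dots> = (exp (3 / 2))\<^sup>2" by (simp add: power2_eq_square flip: exp_add)
          finally show ?thesis by (rule power2_le_imp_le) simp
        qed
        then show ?thesis unfolding exp_add by (intro mult_left_mono) (auto simp: exp_minus field_simps)
      qed
      finally show ?thesis using 1 by simp
    qed
    ultimately show ?thesis by linarith
  qed
  ultimately show ?thesis unfolding target_rate rate using prob_bound_small[of "1 / 1000" "real n"] by simp
qed

text \<open>The spread event is used with rate \<open>p / 1000\<close>, so its failure probability
  is at most the target exponential \<open>t\<close>; hypothesis \<open>pn\<close> makes the other
  one at most \<open>3 * t\<^sup>2\<close>. On this range \<open>sqrt (N / n)\<close> is bounded by
  50 and disappears into the constant.\<close>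

lemma large_codimension:
  assumes n: "1 / 2000 * real N \<le> real n"
    and log: "LN / 2 \<le> ln (real (n div 2402) + 2)" and pn: "p * real n powr (2 / p) \<le> real n"
    and C: "spread_const p (p / 1000) \<le> C" "30006 * sqrt 4804 * 2 powr \<beta> * 50 \<le> C" and C0: "C > 0" "spread_const p (p / 1000) > 0"
  shows "1 - 3 * exp (- (1 / 1000) * p * real n powr (2 / p))
    \<le> measure M {E \<in> space M. approx_eq C (radius N K E) (LN powr (- \<beta>))}"
proof -
  obtain A1 where A1: "A1 \<in> sets M" "measure M A1 \<le> exp (- (p / 1000) * N powr (2 / p))"
    "\<And>E. E \<in> space M \<Longrightarrow> E \<notin> A1 \<Longrightarrow> LN powr (- \<beta>) / spread_const p (p / 1000) \<le> radius N K E"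
    using spread_event[of "p / 1000"] p_gt_1 by auto
  obtain A2 where A2: "A2 \<in> sets M" "measure M A2 \<le> 3 * exp (- 2 * real n)"
    "\<And>E. E \<in> space M \<Longrightarrow> E \<notin> A2 \<Longrightarrow>
      radius N K E \<le> 30006 * sqrt 4804 * 2 powr \<beta> * (sqrt (N / n) * LN powr (- \<beta>))"
    using upper_event[OF log] by blast
  have "1 - measure M (A1 \<union> A2) \<le> measure M {E \<in> space M. approx_eq C (radius N K E) (LN powr (- \<beta>))}"
  proof (rule good_event[OF measurable_approx_eq _ _ order_refl])
    show "A1 \<union> A2 \<in> sets M" using A1 A2 by auto
    fix E assume E: "E \<in> space M" "E \<notin> A1 \<union> A2"
    have "LN powr (- \<beta>) / C \<le> LN powr (- \<beta>) / spread_const p (p / 1000)"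
      using C(1) C0 by (intro divide_left_mono) auto
    also have "\<dots> \<le> radius N K E" using A1(3) E by blast
    finally have "LN powr (- \<beta>) / C \<le> radius N K E" .
    moreover have "radius N K E \<le> C * LN powr (- \<beta>)"
    proof -
      have "real N / real n \<le> 50\<^sup>2" using n n_ge_1 by (intro mult_imp_div_pos_le) auto
      then have "sqrt (N / n) \<le> 50" by (intro real_le_lsqrt) auto
      then have "30006 * sqrt 4804 * 2 powr \<beta> * (sqrt (N / n) * LN powr (- \<beta>))
        \<le> 30006 * sqrt 4804 * 2 powr \<beta> * (50 * LN powr (- \<beta>))"
        by (intro mult_left_mono mult_right_mono) auto
      also have "\<dots> = 30006 * sqrt 4804 * 2 powr \<beta> * 50 * LN powr (- \<beta>)" by simp
      also have "\<dots> \<le> C * LN powr (- \<beta>)" using C(2) by (intro mult_right_mono) auto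
      finally show ?thesis using A2(3)[of E] E by auto
    qed
    ultimately show "E \<in> {E \<in> space M. approx_eq C (radius N K E) (LN powr (- \<beta>))}" using E(1) by (simp add: approx_eq_def)
  qed
  moreover define t where "t = exp (- (1 / 1000) * p * real n powr (2 / p))"
  have "t > 0" by (simp add: t_def)
  have "measure M (A1 \<union> A2) \<le> exp (- (p / 1000) * N powr (2 / p)) + 3 * exp (- 2 * real n)"
    using A1(1,2) A2(1,2) measure_Un_le[of A1 M A2] by linarith
  moreover have "exp (- (p / 1000) * N powr (2 / p)) \<le> t"
    unfolding t_def using p_gt_1 n_less_N powr_mono2[of "2 / p" "real n" "real N"] by simp
  moreover have "exp (- 2 * real n) \<le> t * t"
    unfolding t_def exp_add[symmetric] using pn by simp
  ultimately have le: "1 - (t + 3 * (t * t)) \<le> measure M {E \<in> space M. approx_eq C (radius N K E) (LN powr (- \<beta>))}"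
    by linarith
  show ?thesis
  proof (cases "t \<ge> 1 / 3")
    case True
    then have "1 - 3 * t \<le> measure M {E \<in> space M. approx_eq C (radius N K E) (LN powr (- \<beta>))}"
      using measure_nonneg[of M "{E \<in> space M. approx_eq C (radius N K E) (LN powr (- \<beta>))}"] by linarith
    then show ?thesis unfolding t_def .
  next
    case False
    then have "t * t \<le> (1 / 3) * t" using \<open>t > 0\<close> by (intro mult_right_mono) auto
    then have "1 - 3 * t \<le> measure M {E \<in> space M. approx_eq C (radius N K E) (LN powr (- \<beta>))}"
      using le \<open>t > 0\<close> by linarith
    then show ?thesis unfolding t_def .
  qed
qed

text \<open>For \<open>N \<le> N0\<close> radius and target both lie between positive constants
  depending on \<open>N0\<close>, so the comparison holds for every \<open>E\<close> and probability
  plays no part. All three targets have this form.\<close>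

lemma bounded_dimension:
  assumes N: "N \<le> N0" and T: "ln (real N0 + 1) powr (- \<beta>) \<le> T" "T \<le> sqrt N0"
    and C: "sqrt N0 * (3 + 2 * sqrt N0 * ln (real N0 + 1) powr \<beta>) \<le> C"
      "sqrt (1 + axis_sum_bound) * ln (real N0 + 1) powr \<beta> \<le> C"
  shows "measure M {E \<in> space M. approx_eq C (radius N K E) T} = 1"
proof -
  have LN_le: "LN \<le> ln (real N0 + 1)" using N by simp
  have L1: "1 \<le> ln (real N0 + 1)" using LN_le log_ge_1 by linarith
  have N0: "1 \<le> sqrt N0" using N N_ge_2 by simp
  have D0: "0 < 3 + 2 * sqrt N0 * ln (real N0 + 1) powr \<beta>" by (intro add_pos_nonneg) auto
  have C0: "C > 0" using C(1) D0 N0 mult_pos_pos[of "sqrt N0"] by (smt (verit))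
  have "approx_eq C (radius N K E) T" if E: "E \<in> space M" for E
    unfolding approx_eq_def
  proof
    note g = E[unfolded space_M]
    have "T / C \<le> sqrt N0 / (sqrt N0 * (3 + 2 * sqrt N0 * ln (real N0 + 1) powr \<beta>))"
      using T(2) C(1) C0 D0 N0 by (intro frac_le) auto
    also have "\<dots> = 1 / (3 + 2 * sqrt N0 * ln (real N0 + 1) powr \<beta>)" using N0 by simp
    also have "\<dots> \<le> 1 / (3 + 2 * sqrt N * LN powr \<beta>)"
    proof (intro divide_left_mono add_left_mono mult_mono)
      show "LN powr \<beta> \<le> ln (real N0 + 1) powr \<beta>" using LN_le log_ge_1 \<beta>_pos by (intro powr_mono2) auto
    qed (use N D0 in \<open>auto intro!: mult_pos_pos add_pos_nonneg\<close>)
    also have "\<dots> \<le> radius N K E" by (rule radius_ge_const[OF g n_less_N])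
    finally show "T / C \<le> radius N K E" .
    have "radius N K E \<le> sqrt (1 + axis_sum_bound)" by (rule radius_le_const[OF g])
    also have "\<dots> = (sqrt (1 + axis_sum_bound) * ln (real N0 + 1) powr \<beta>) * ln (real N0 + 1) powr (- \<beta>)"
      using N N_ge_2 by (simp add: mult.assoc flip: powr_add)
    also have "\<dots> \<le> C * T" using T(1) C(2) C0 by (intro mult_mono) auto
    finally show "radius N K E \<le> C * T" .
  qed
  then have "{E \<in> space M. approx_eq C (radius N K E) T} = space M" by auto
  then show ?thesis using prob_space by simp
qed

end

text \<open>The first property makes the head length at least of order \<open>sqrt N\<close>, so
  that its logarithm is at least half of \<open>LN\<close>. The second holds because
  \<open>2 / p < 1\<close>.\<close>

lemma dimension_threshold:
  fixes p \<beta> :: real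
  assumes p: "p > 2" and \<beta>: "\<beta> > 0"
  obtains N0 :: nat where "N0 \<ge> 1"
    "\<And>N n. N \<ge> N0 \<Longrightarrow> 1 / 2000 * real N * ln (real N + 1) powr (- 2 * \<beta>) \<le> real n \<Longrightarrow>
      ln (real N + 1) / 2 \<le> ln (real (n div 2402) + 2)"
    "\<And>N n. N \<ge> N0 \<Longrightarrow> 1 / 2000 * real N \<le> real n \<Longrightarrow> p * real n powr (2 / p) \<le> real n"
    "\<And>N. N \<ge> N0 \<Longrightarrow> 10 ^ 8 \<le> N"
proof -
  define a where "a = 1 - 2 / p"
  have a: "a > 0" using p by (simp add: a_def)
  have "eventually (\<lambda>N::nat. 2402 * 2000 * sqrt (real N + 1) \<le> real N * ln (real N + 1) powr (- 2 * \<beta>)) at_top"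
    using \<beta> by real_asymp
  moreover have "eventually (\<lambda>N::nat. p \<le> (1 / 2000 * real N) powr a) at_top"
    using a by real_asymp
  moreover have "eventually (\<lambda>N::nat. 10 ^ 8 \<le> N) at_top" by (rule eventually_ge_at_top)
  ultimately have "eventually (\<lambda>N::nat. 2402 * 2000 * sqrt (real N + 1) \<le> real N * ln (real N + 1) powr (- 2 * \<beta>)
      \<and> p \<le> (1 / 2000 * real N) powr a \<and> 10 ^ 8 \<le> N) at_top"
    by eventually_elim auto
  then obtain N0 where N0: "\<And>N. N \<ge> N0 \<Longrightarrow> 2402 * 2000 * sqrt (real N + 1) \<le> real N * ln (real N + 1) powr (- 2 * \<beta>)"
    "\<And>N. N \<ge> N0 \<Longrightarrow> p \<le> (1 / 2000 * real N) powr a" "\<And>N. N \<ge> N0 \<Longrightarrow> 10 ^ 8 \<le> N"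
    by (auto simp: eventually_at_top_linorder)
  show thesis
  proof (rule that[of N0])
    show "N0 \<ge> 1" using N0(3)[of N0] by simp
    show "10 ^ 8 \<le> N" if "N \<ge> N0" for N using N0(3) that .
    show "ln (real N + 1) / 2 \<le> ln (real (n div 2402) + 2)"
      if "N \<ge> N0" "1 / 2000 * real N * ln (real N + 1) powr (- 2 * \<beta>) \<le> real n" for N n
    proof -
      have "n \<le> 2402 * (n div 2402) + 2402" using dividend_less_times_div[of 2402 n] by simp
      then have "real n \<le> real (2402 * (n div 2402) + 2402)" by (simp only: of_nat_le_iff)
      then have "sqrt (real N + 1) \<le> real (n div 2402) + 2" using N0(1)[OF that(1)] that(2) by simp
      then have "ln (sqrt (real N + 1)) \<le> ln (real (n div 2402) + 2)" by (subst ln_le_cancel_iff) auto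
      then show ?thesis by (simp add: ln_sqrt)
    qed
    show "p * real n powr (2 / p) \<le> real n" if "N \<ge> N0" "1 / 2000 * real N \<le> real n" for N n
    proof -
      have N: "real N > 0" using N0(3)[OF that(1)] by simp
      have "p \<le> (1 / 2000 * real N) powr a" by (rule N0(2)[OF that(1)])
      also have "\<dots> \<le> real n powr a" using that(2) a by (intro powr_mono2) auto
      finally have "p * real n powr (2 / p) \<le> real n powr a * real n powr (2 / p)" by (intro mult_right_mono) auto
      also have "\<dots> = real n" using that(2) N by (simp add: a_def flip: powr_add)
      finally show ?thesis .
    qed
  qed
qed

theorem proposition6p10:
  shows "\<exists>\<gamma>::real. \<gamma> > 0 \<and>
    (\<forall>p \<alpha> \<beta> :: real. p > 1 \<and> \<alpha> > 0 \<and> \<alpha> = 1/2 - 1/p \<and> \<beta> > 1/2 - 1/p \<longrightarrow>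
      (\<exists>c c' C :: real. c > 0 \<and> c' > 0 \<and> C \<ge> 1 \<and>
        (\<forall>(n::nat) (N::nat) M. 1 \<le> n \<and> n < N \<and> is_haar_grassmannian N n M \<longrightarrow>
          (let R = radius N (ellipsoid N p (log_semiaxes \<alpha> \<beta>)) in
            (real n \<le> c * real N * ln (real N + 1) powr (- 2 * \<beta>) \<longrightarrow>
               measure M {E \<in> space M. approx_eq C (R E) 1} \<ge> 1 - 3 * exp (- \<gamma> * real n)) \<and>
            (c * real N * ln (real N + 1) powr (- 2 * \<beta>) \<le> real n \<and> real n \<le> c' * real N \<longrightarrow>
               measure M {E \<in> space M. approx_eq C (R E)
                   (real n powr (- 1/2) * real N powr (1/2) * ln (real N + 1) powr (- \<beta>))}
                 \<ge> 1 - 3 * exp (- \<gamma> * real n)) \<and>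
            (c' * real N \<le> real n \<longrightarrow>
               measure M {E \<in> space M. approx_eq C (R E) (ln (real N + 1) powr (- \<beta>))}
                 \<ge> 1 - 3 * exp (- \<gamma> * p * real n powr (2 / p)))))))"
proof (rule exI[of _ "1 / 1000"], rule conjI, simp, intro allI impI, goal_cases)
  case (1 p \<alpha> \<beta>)
  then have p1: "p > 1" and \<alpha>: "\<alpha> > 0" "\<alpha> = 1/2 - 1/p" and \<beta>: "\<beta> > \<alpha>" by auto
  \<comment> \<open>The dimension 2 is a dummy: only facts free of \<open>N\<close> are taken from
    this instance, since the constants must be fixed before \<open>N\<close>.\<close>
  interpret L: log_ellipsoid p \<alpha> \<beta> 2 using p1 \<alpha> \<beta> by unfold_locales auto
  obtain N0 where N0: "N0 \<ge> 1"
    "\<And>N n. N \<ge> N0 \<Longrightarrow> 1 / 2000 * real N * ln (real N + 1) powr (- 2 * \<beta>) \<le> real n \<Longrightarrow>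
      ln (real N + 1) / 2 \<le> ln (real (n div 2402) + 2)"
    "\<And>N n. N \<ge> N0 \<Longrightarrow> 1 / 2000 * real N \<le> real n \<Longrightarrow> p * real n powr (2 / p) \<le> real n"
    "\<And>N. N \<ge> N0 \<Longrightarrow> 10 ^ 8 \<le> N"
    using dimension_threshold[OF L.p_gt_2 L.\<beta>_pos] by blast
  define AB where "AB = sqrt (1 + log_ellipsoid.axis_sum_bound \<alpha> \<beta>)"
  define CU where "CU = 30006 * sqrt 4804 * 2 powr \<beta>"
  define CS where "CS = spread_const p (p / 1000)"
  define D where "D = sqrt N0 * (3 + 2 * sqrt N0 * ln (real N0 + 1) powr \<beta>)"
  define D' where "D' = AB * ln (real N0 + 1) powr \<beta>"
  define C where "C = 10000 + AB + CU * 50 + CS + D + D'"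
  have AB: "AB \<ge> 0" using L.axis_sum_bound_nonneg by (simp add: AB_def)
  have nonneg: "CU \<ge> 0" "CS > 0" "D \<ge> 0" "D' \<ge> 0"
    using AB spread_const_pos[OF L.p_gt_2] by (auto simp: CU_def CS_def D_def D'_def)
  have C: "10000 \<le> C" "AB \<le> C" "CU \<le> C" "CU * 50 \<le> C" "CS \<le> C" "D \<le> C" "D' \<le> C" "C > 0"
    using AB nonneg by (auto simp: C_def)
  show ?case
  proof (rule exI[of _ "1 / 2000"], rule exI[of _ "1 / 2000"], rule exI[of _ C],
      intro conjI[of "_ < _"] conjI[of "_ \<le> _"] allI impI, goal_cases)
    case (4 n N M)
    then interpret random_section N n M p \<alpha> \<beta>
      using p1 \<alpha> \<beta> by unfold_locales auto
    show ?case
    proof (cases "N0 \<le> N")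
      case True
      note big = N0(4)[OF True]
      have i: "1 - 3 * exp (- (1 / 1000) * real n) \<le> measure M {E \<in> space M. approx_eq C (radius N K E) 1}"
        if "real n \<le> 1 / 2000 * real N * LN powr (- 2 * \<beta>)"
        using small_codimension[OF that big C(1)] C(2) by (simp add: AB_def)
      have ii: "1 - 3 * exp (- (1 / 1000) * real n) \<le> measure M {E \<in> space M. approx_eq C (radius N K E)
          (real n powr (- 1/2) * real N powr (1/2) * LN powr (- \<beta>))}"
        if "1 / 2000 * real N * LN powr (- 2 * \<beta>) \<le> real n" "real n \<le> 1 / 2000 * real N"
        using intermediate_codimension[OF that big N0(2)[OF True that(1)] C(1)] C(3) by (simp add: CU_def)
      have iii: "1 - 3 * exp (- (1 / 1000) * p * real n powr (2 / p))
          \<le> measure M {E \<in> space M. approx_eq C (radius N K E) (LN powr (- \<beta>))}"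
        if n: "1 / 2000 * real N \<le> real n"
      proof -
        have "LN powr (- 2 * \<beta>) \<le> 1" using log_ge_1 \<beta>_pos N_ge_2 powr_mono[of "- 2 * \<beta>" 0 LN] by simp
        then have "1 / 2000 * real N * LN powr (- 2 * \<beta>) \<le> 1 / 2000 * real N * 1" by (intro mult_left_mono) auto
        then have log: "LN / 2 \<le> ln (real (n div 2402) + 2)" using n by (intro N0(2)[OF True]) simp
        show ?thesis
          using large_codimension[OF n log N0(3)[OF True n], of C] C nonneg by (simp add: CU_def CS_def)
      qed
      show ?thesis unfolding Let_def using i ii iii by blast
    next
      case False
      \<comment> \<open>Below the threshold the three targets lie between
        \<open>ln (N0 + 1) powr (- \<beta>)\<close> and \<open>sqrt N0\<close>, for the middle one
        because \<open>1 \<le> N / n \<le> N0\<close>.\<close>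
      then have N: "N \<le> N0" by simp
      have one: "measure M {E \<in> space M. approx_eq C (radius N K E) T} = 1"
        if "ln (real N0 + 1) powr (- \<beta>) \<le> T" "T \<le> sqrt N0" for T
        using bounded_dimension[OF N that] C(6,7) by (simp add: D_def D'_def AB_def)
      have "LN \<le> ln (real N0 + 1)" using N by simp
      then have L1: "1 \<le> ln (real N0 + 1)" "LN \<le> ln (real N0 + 1)" using log_ge_1 by linarith+
      have t0: "ln (real N0 + 1) powr (- \<beta>) \<le> LN powr (- \<beta>)" "LN powr (- \<beta>) \<le> 1"
      proof -
        show "ln (real N0 + 1) powr (- \<beta>) \<le> LN powr (- \<beta>)"
          using L1 log_ge_1 \<beta>_pos N_ge_2 by (intro powr_mono2') auto
        show "LN powr (- \<beta>) \<le> 1" using log_ge_1 \<beta>_pos N_ge_2 powr_mono[of "- \<beta>" 0 LN] by simp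
      qed
      have s0: "1 \<le> sqrt N0" using N0(1) by simp
      have q: "1 \<le> sqrt (N / n)" "sqrt (N / n) \<le> sqrt N0"
      proof -
        show "1 \<le> sqrt (N / n)" using n_ge_1 n_less_N by simp
        have "real N / real n \<le> real N / 1" using n_ge_1 by (intro divide_left_mono) auto
        also have "\<dots> \<le> real N0" using N by simp
        finally show "sqrt (N / n) \<le> sqrt N0" by simp
      qed
      have "ln (real N0 + 1) powr (- \<beta>) \<le> sqrt (N / n) * LN powr (- \<beta>)" "sqrt (N / n) * LN powr (- \<beta>) \<le> sqrt N0"
      proof -
        show "ln (real N0 + 1) powr (- \<beta>) \<le> sqrt (N / n) * LN powr (- \<beta>)"
          using mult_right_mono[OF q(1), of "LN powr (- \<beta>)"] t0(1) by simp
        have "sqrt (N / n) * LN powr (- \<beta>) \<le> sqrt (N / n) * 1" by (intro mult_left_mono t0(2)) simp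
        then show "sqrt (N / n) * LN powr (- \<beta>) \<le> sqrt N0" using q(2) by linarith
      qed
      from one[OF this] have ii: "measure M {E \<in> space M. approx_eq C (radius N K E)
          (real n powr (- 1/2) * real N powr (1/2) * LN powr (- \<beta>))} = 1"
        unfolding target_rate .
      have "measure M {E \<in> space M. approx_eq C (radius N K E) 1} = 1"
        by (intro one) (use t0 s0 in linarith)+
      moreover have "measure M {E \<in> space M. approx_eq C (radius N K E) (LN powr (- \<beta>))} = 1"
        by (intro one) (use t0 s0 in linarith)+
      ultimately show ?thesis unfolding Let_def using ii by simp
    qed
  qed (use C in auto)
qed

end
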